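(* Let $r\ge 3$ be an odd integer. For $m$ ranging over the positive integers such that $p=2m+1$ is a prime, a random tree with $m+1$ edges asymptotically almost surely decomposes $$K_n\setminus K_t,\qquad \text{where } t=\frac{r+1}{2}\ \text{ and }\ n=r(2m+1)+t;$$ that is, the probability that a random tree with $m+1$ edges decomposes $K_n\setminus K_t$ tends to $1$ as $m\to\infty$ through the integers $m$ such that $2m+1$ is prime.
   Context: A graph $H$ decomposes a graph $G$ if $G$ is the edge-disjoint union of isomorphic copies of $H$ (i.e. the edge set of $G$ can be partitioned into edge sets of subgraphs of $G$ each isomorphic to $H$). A random tree with $k$ edges is an unlabelled tree (isomorphism class of trees) chosen uniformly at random among all unlabelled trees with $k$ edges. $K_n\setminus K_t$ is the graph obtained from the complete graph $K_n$ by removing all the edges of a complete subgraph on $t$ vertices (the $t$ vertices are kept and form an independent set). *)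

theory Defs
  imports
    "HOL-Probability.Probability_Mass_Function"
    "HOL-Library.Disjoint_Sets"
    "HOL-Computational_Algebra.Primes"
begin

section \<open>Finite simple graphs\<close>

type_synonym 'a ugraph = "'a set \<times> 'a set set"

abbreviation verts :: "'a ugraph \<Rightarrow> 'a set" where
  "verts \<equiv> fst"

abbreviation edges :: "'a ugraph \<Rightarrow> 'a set set" where
  "edges \<equiv> snd"

definition simple_graph :: "'a ugraph \<Rightarrow> bool" where
  "simple_graph G \<longleftrightarrow> finite (verts G) \<and> (\<forall>e\<in>edges G. e \<subseteq> verts G \<and> card e = 2)"

definition subgraph :: "'a ugraph \<Rightarrow> 'a ugraph \<Rightarrow> bool" where
  "subgraph H G \<longleftrightarrow> simple_graph H \<and> verts H \<subseteq> verts G \<and> edges H \<subseteq> edges G"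

definition graph_iso :: "'a ugraph \<Rightarrow> 'b ugraph \<Rightarrow> bool" where
  "graph_iso G H \<longleftrightarrow>
     (\<exists>f. bij_betw f (verts G) (verts H) \<and> edges H = (\<lambda>e. f ` e) ` edges G)"

definition adjacency :: "'a ugraph \<Rightarrow> ('a \<times> 'a) set" where
  "adjacency G = {(u, v). {u, v} \<in> edges G}"

definition connected_graph :: "'a ugraph \<Rightarrow> bool" where
  "connected_graph G \<longleftrightarrow> verts G \<noteq> {} \<and> (\<forall>u\<in>verts G. \<forall>v\<in>verts G. (u, v) \<in> (adjacency G)\<^sup>*)"

definition is_cycle :: "'a ugraph \<Rightarrow> 'a list \<Rightarrow> bool" where
  "is_cycle G xs \<longleftrightarrow> length xs \<ge> 3 \<and> distinct xs \<and>
     (\<forall>i<length xs. {xs ! i, xs ! (Suc i mod length xs)} \<in> edges G)"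

definition tree :: "'a ugraph \<Rightarrow> bool" where
  "tree G \<longleftrightarrow> simple_graph G \<and> connected_graph G \<and> (\<nexists>xs. is_cycle G xs)"


section \<open>Decompositions\<close>

definition decomposes :: "'a ugraph \<Rightarrow> 'b ugraph \<Rightarrow> bool" where
  "decomposes H G \<longleftrightarrow>
     (\<exists>P. partition_on (edges G) P \<and>
          (\<forall>p\<in>P. \<exists>S. subgraph S G \<and> graph_iso H S \<and> edges S = p))"

definition all_pairs :: "'a set \<Rightarrow> 'a set set" where
  "all_pairs A = {e. e \<subseteq> A \<and> card e = 2}"

text \<open>
  The complete graph on \<open>n\<close> vertices with the edges of a complete subgraph on \<open>t\<close> of them
  removed (for \<open>t \<le> n\<close>); the \<open>t\<close> vertices themselves are kept.
\<close>

definition complete_minus_clique :: "nat \<Rightarrow> nat \<Rightarrow> nat ugraph" where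
  "complete_minus_clique n t = ({..<n}, all_pairs {..<n} - all_pairs {..<t})"


section \<open>Random unlabelled trees\<close>

text \<open>
  Every finite tree is isomorphic to one whose vertices are natural numbers, so
  isomorphism classes can be taken within the type of graphs on natural numbers.
\<close>

definition trees_with_edges :: "nat \<Rightarrow> nat ugraph set" where
  "trees_with_edges k = {T. tree T \<and> card (edges T) = k}"

definition tree_iso_rel :: "nat \<Rightarrow> (nat ugraph \<times> nat ugraph) set" where
  "tree_iso_rel k =
     {(S, T). S \<in> trees_with_edges k \<and> T \<in> trees_with_edges k \<and> graph_iso S T}"

definition unlabelled_trees :: "nat \<Rightarrow> nat ugraph set set" where
  "unlabelled_trees k = trees_with_edges k // tree_iso_rel k"

definition random_tree :: "nat \<Rightarrow> nat ugraph set pmf" where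
  "random_tree k = pmf_of_set (unlabelled_trees k)"

text \<open>
  By \<open>decomposes_cong\<close> below, the choice of the representative does not matter.
\<close>

definition class_decomposes :: "'a ugraph set \<Rightarrow> 'b ugraph \<Rightarrow> bool" where
  "class_decomposes C G \<longleftrightarrow> (\<exists>T\<in>C. decomposes T G)"


subsection \<open>Well-definedness\<close>

lemma graph_iso_refl: "graph_iso G G"
  unfolding graph_iso_def by (intro exI[of _ id]) auto

lemma graph_iso_sym:
  assumes "simple_graph G" "graph_iso G H"
  shows "graph_iso H G"
proof -
  obtain f where f: "bij_betw f (verts G) (verts H)" "edges H = (\<lambda>e. f ` e) ` edges G"
    using assms(2) unfolding graph_iso_def by blast
  let ?g = "inv_into (verts G) f"
  have "?g ` f ` e = e" if "e \<in> edges G" for e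
    using that assms(1) f(1) unfolding simple_graph_def
    by (metis bij_betw_imp_inj_on inv_into_image_cancel)
  hence "edges G = (\<lambda>e. ?g ` e) ` edges H"
    unfolding f(2) image_image by simp
  with bij_betw_inv_into[OF f(1)] show ?thesis
    unfolding graph_iso_def by blast
qed

lemma graph_iso_trans:
  assumes "graph_iso G H" "graph_iso H K"
  shows "graph_iso G K"
proof -
  obtain f g where f: "bij_betw f (verts G) (verts H)" "edges H = (\<lambda>e. f ` e) ` edges G"
    and g: "bij_betw g (verts H) (verts K)" "edges K = (\<lambda>e. g ` e) ` edges H"
    using assms unfolding graph_iso_def by metis
  have "edges K = (\<lambda>e. (g \<circ> f) ` e) ` edges G"
    unfolding g(2) f(2) by (auto simp: image_image image_comp)
  with bij_betw_trans[OF f(1) g(1)] show ?thesis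
    unfolding graph_iso_def by blast
qed

lemma decomposes_cong:
  assumes "simple_graph S" "graph_iso S T"
  shows "decomposes S G \<longleftrightarrow> decomposes T (G :: 'c ugraph)"
proof -
  have "graph_iso S U \<longleftrightarrow> graph_iso T U" for U :: "'c ugraph"
    using graph_iso_trans[OF assms(2)] graph_iso_trans[OF graph_iso_sym[OF assms]] by metis
  thus ?thesis unfolding decomposes_def by simp
qed

lemma simple_graph_iso:
  assumes "simple_graph G" "graph_iso G H"
  shows "simple_graph H"
proof -
  obtain f where f: "bij_betw f (verts G) (verts H)" "edges H = (\<lambda>e. f ` e) ` edges G"
    using assms(2) unfolding graph_iso_def by blast
  have "f ` e \<subseteq> verts H \<and> card (f ` e) = 2" if "e \<in> edges G" for e
  proof -
    have e: "e \<subseteq> verts G" "card e = 2"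
      using that assms(1) unfolding simple_graph_def by auto
    have "card (f ` e) = card e"
      by (rule card_image[OF inj_on_subset[OF bij_betw_imp_inj_on[OF f(1)] e(1)]])
    thus ?thesis
      using e image_mono[OF e(1), of f] bij_betw_imp_surj_on[OF f(1)] by simp
  qed
  moreover have "finite (verts H)"
    using assms(1) bij_betw_finite[OF f(1)] unfolding simple_graph_def by simp
  ultimately show ?thesis
    unfolding simple_graph_def f(2) by simp
qed

lemma connected_graph_iso:
  assumes "connected_graph G" "graph_iso G H"
  shows "connected_graph H"
proof -
  obtain f where f: "bij_betw f (verts G) (verts H)" "edges H = (\<lambda>e. f ` e) ` edges G"
    using assms(2) unfolding graph_iso_def by blast
  have step: "(f x, f y) \<in> adjacency H" if "(x, y) \<in> adjacency G" for x y
  proof -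
    from that have "f ` {x, y} \<in> edges H"
      unfolding f(2) adjacency_def by blast
    thus ?thesis by (simp add: adjacency_def)
  qed
  have reach: "(f u, f v) \<in> (adjacency H)\<^sup>*" if "(u, v) \<in> (adjacency G)\<^sup>*" for u v
    using that by (induction rule: rtrancl_induct) (auto intro: rtrancl_into_rtrancl step)
  have "verts H = f ` verts G"
    using bij_betw_imp_surj_on[OF f(1)] by (rule sym)
  thus ?thesis
    using assms(1) reach unfolding connected_graph_def by simp
qed

lemma is_cycle_iso:
  assumes "graph_iso G H" "simple_graph G" "is_cycle G xs"
  shows "\<exists>ys. is_cycle H ys"
proof -
  obtain f where f: "bij_betw f (verts G) (verts H)" "edges H = (\<lambda>e. f ` e) ` edges G"
    using assms(1) unfolding graph_iso_def by blast
  have e: "{xs ! i, xs ! (Suc i mod length xs)} \<in> edges G" if "i < length xs" for i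
    using assms(3) that unfolding is_cycle_def by blast
  have "set xs \<subseteq> verts G"
    using e assms(2) unfolding simple_graph_def by (fastforce simp: in_set_conv_nth)
  hence "inj_on f (set xs)"
    using f(1) unfolding bij_betw_def by (blast intro: inj_on_subset)
  moreover have "{map f xs ! i, map f xs ! (Suc i mod length xs)} \<in> edges H"
    if i: "i < length xs" for i
  proof -
    have "f ` {xs ! i, xs ! (Suc i mod length xs)} \<in> edges H"
      using e[OF i] unfolding f(2) by blast
    moreover have "Suc i mod length xs < length xs"
      using i by (intro mod_less_divisor) auto
    ultimately show ?thesis using i by simp
  qed
  ultimately have "is_cycle H (map f xs)"
    using assms(3) unfolding is_cycle_def by (simp add: distinct_map)
  thus ?thesis by blast
qed

lemma tree_iso:
  assumes "tree G" "graph_iso G H"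
  shows "tree H"
proof -
  have G: "simple_graph G" "connected_graph G" "\<nexists>xs. is_cycle G xs"
    using assms(1) unfolding tree_def by simp_all
  have H: "simple_graph H" by (rule simple_graph_iso[OF G(1) assms(2)])
  have "\<nexists>xs. is_cycle H xs"
    using is_cycle_iso[OF graph_iso_sym[OF G(1) assms(2)] H] G(3) by metis
  with H connected_graph_iso[OF G(2) assms(2)] show ?thesis
    unfolding tree_def by simp
qed

lemma card_edges_iso:
  assumes "simple_graph G" "graph_iso G H"
  shows "card (edges H) = card (edges G)"
proof -
  obtain f where f: "bij_betw f (verts G) (verts H)" "edges H = (\<lambda>e. f ` e) ` edges G"
    using assms(2) unfolding graph_iso_def by blast
  have "edges G \<subseteq> Pow (verts G)"
    using assms(1) unfolding simple_graph_def by blast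
  hence "inj_on (\<lambda>e. f ` e) (edges G)"
    using inj_on_image_Pow[OF bij_betw_imp_inj_on[OF f(1)]] by (rule inj_on_subset[rotated])
  thus ?thesis unfolding f(2) by (rule card_image)
qed

lemma trees_with_edges_iso:
  assumes "T \<in> trees_with_edges k" "graph_iso T S"
  shows "S \<in> trees_with_edges k"
proof -
  have "tree T" "simple_graph T" "card (edges T) = k"
    using assms(1) unfolding trees_with_edges_def tree_def by simp_all
  thus ?thesis
    using tree_iso[OF _ assms(2)] card_edges_iso[OF _ assms(2)]
    unfolding trees_with_edges_def by simp
qed

lemma equiv_tree_iso_rel: "equiv (trees_with_edges k) (tree_iso_rel k)"
proof (intro equivI)
  show "tree_iso_rel k \<subseteq> trees_with_edges k \<times> trees_with_edges k"
    unfolding tree_iso_rel_def by blast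
  show "refl_on (trees_with_edges k) (tree_iso_rel k)"
    by (simp add: tree_iso_rel_def refl_on_def graph_iso_refl)
  show "sym (tree_iso_rel k)"
    by (auto simp: sym_def tree_iso_rel_def trees_with_edges_def tree_def intro: graph_iso_sym)
  show "trans (tree_iso_rel k)"
    by (auto simp: tree_iso_rel_def trans_def intro: graph_iso_trans)
qed

lemma card_verts_tree_le:
  assumes "tree T" "card (edges T) = k"
  shows "card (verts T) \<le> 2 * k + 1"
proof (cases "\<exists>v. verts T \<subseteq> {v}")
  case True
  then obtain v where "verts T \<subseteq> {v}" by blast
  from card_mono[OF _ this] show ?thesis by simp
next
  case False
  have fin: "finite (verts T)" and sub: "edges T \<subseteq> Pow (verts T)"
    and two: "\<And>e. e \<in> edges T \<Longrightarrow> card e = 2"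
    using assms(1) unfolding tree_def simple_graph_def by blast+
  have "verts T \<subseteq> \<Union> (edges T)"
  proof
    fix v assume v: "v \<in> verts T"
    with False obtain w where w: "w \<in> verts T" "w \<noteq> v" by blast
    with v have "(v, w) \<in> (adjacency T)\<^sup>*"
      using assms(1) unfolding tree_def connected_graph_def by blast
    with w(2) obtain x where "(v, x) \<in> adjacency T"
      by (metis converse_rtranclE)
    thus "v \<in> \<Union> (edges T)" unfolding adjacency_def by blast
  qed
  moreover have "finite (\<Union> (edges T))"
    by (rule finite_subset[OF _ fin]) (use sub in blast)
  ultimately have "card (verts T) \<le> card (\<Union> (edges T))"
    by (intro card_mono)
  also have "\<dots> \<le> (\<Sum>e\<in>edges T. card e)"
    by (rule card_Union_le_sum_card)
  also have "\<dots> = 2 * k" using two assms(2) by simp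
  finally show ?thesis by simp
qed

lemma finite_unlabelled_trees: "finite (unlabelled_trees k)"
proof -
  let ?A = "Pow {..<2 * k + 1} \<times> Pow (Pow {..<2 * k + 1})"
  have "unlabelled_trees k \<subseteq> (\<lambda>T. tree_iso_rel k `` {T}) ` ?A"
  proof
    fix C assume "C \<in> unlabelled_trees k"
    then obtain T where T: "T \<in> trees_with_edges k" "C = tree_iso_rel k `` {T}"
      unfolding unlabelled_trees_def by (rule quotientE)
    have sg: "simple_graph T" and fin: "finite (verts T)" and le: "card (verts T) \<le> 2 * k + 1"
      using T(1) card_verts_tree_le
      unfolding trees_with_edges_def tree_def simple_graph_def by blast+
    obtain f where f: "bij_betw f (verts T) {0..<card (verts T)}"
      using ex_bij_betw_finite_nat[OF fin] by blast
    define S where "S = ({0..<card (verts T)}, (\<lambda>e. f ` e) ` edges T)"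
    have iso: "graph_iso T S"
      using f unfolding graph_iso_def S_def by auto
    hence "(T, S) \<in> tree_iso_rel k"
      using T(1) trees_with_edges_iso unfolding tree_iso_rel_def by blast
    hence "C = tree_iso_rel k `` {S}"
      using T(2) equiv_class_eq[OF equiv_tree_iso_rel] by simp
    moreover have "S \<in> ?A"
    proof -
      have "verts S \<subseteq> {..<2 * k + 1}" using le by (auto simp: S_def)
      moreover have "edges S \<subseteq> Pow (verts S)"
        using simple_graph_iso[OF sg iso] unfolding simple_graph_def by blast
      ultimately show ?thesis by (cases S) auto
    qed
    ultimately show "C \<in> (\<lambda>T. tree_iso_rel k `` {T}) ` ?A" by blast
  qed
  thus ?thesis by (rule finite_subset) simp
qed

lemma unlabelled_trees_nonempty: "unlabelled_trees k \<noteq> {}"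
proof -
  define T :: "nat ugraph" where "T = ({..k}, (\<lambda>i. {0, i}) ` {1..k})"
  have simple: "simple_graph T"
  proof -
    have "{0, i} \<subseteq> {..k} \<and> card {0, i} = 2" if "i \<in> {1..k}" for i
      using that by simp
    thus ?thesis unfolding simple_graph_def T_def by simp
  qed
  have zero: "(0, v) \<in> (adjacency T)\<^sup>*" "(v, 0) \<in> (adjacency T)\<^sup>*" if "v \<le> k" for v
  proof -
    have "{0, v} \<in> edges T" if "v \<noteq> 0"
      using that \<open>v \<le> k\<close> unfolding T_def snd_conv by (intro imageI) simp
    hence "v = 0 \<or> (0, v) \<in> adjacency T \<and> (v, 0) \<in> adjacency T"
      unfolding adjacency_def by (cases "v = 0") (simp_all add: insert_commute)
    thus "(0, v) \<in> (adjacency T)\<^sup>*" "(v, 0) \<in> (adjacency T)\<^sup>*" by auto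
  qed
  have conn: "connected_graph T"
  proof -
    have "(u, v) \<in> (adjacency T)\<^sup>*" if "u \<le> k" "v \<le> k" for u v
      using zero(2)[OF that(1)] zero(1)[OF that(2)] by (rule rtrancl_trans)
    thus ?thesis unfolding connected_graph_def by (auto simp: T_def)
  qed
  have "\<not> is_cycle T xs" for xs
  proof
    assume "is_cycle T xs"
    hence len: "length xs \<ge> 3" and dist: "distinct xs"
      and e: "\<And>i. i < length xs \<Longrightarrow> {xs ! i, xs ! (Suc i mod length xs)} \<in> edges T"
      unfolding is_cycle_def by blast+
    have z: "xs ! i = 0 \<or> xs ! (Suc i mod length xs) = 0" if i: "i < length xs" for i
    proof -
      obtain j where "{xs ! i, xs ! (Suc i mod length xs)} = {0, j}"
        using e[OF i] unfolding T_def snd_conv by (elim imageE)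
      thus ?thesis unfolding doubleton_eq_iff by metis
    qed
    have inj: "i = j" if "i < length xs" "j < length xs" "xs ! i = 0" "xs ! j = 0" for i j
      using that dist nth_eq_iff_index_eq by metis
    have pos: "0 < length xs" using len by linarith
    have m: "Suc 0 mod length xs = 1" "Suc 1 mod length xs = 2" "0 < length xs" "1 < length xs"
      "2 < length xs" "Suc 2 mod length xs < length xs"
      using len pos mod_less_divisor[OF pos] by simp_all
    have z01: "xs ! 0 = 0 \<or> xs ! 1 = 0" using z[OF m(3)] unfolding m(1) .
    have z12: "xs ! 1 = 0 \<or> xs ! 2 = 0" using z[OF m(4)] unfolding m(2) .
    have one: "xs ! 1 = 0" using z01 z12 inj[OF m(3) m(5)] by auto
    have "xs ! 2 \<noteq> 0" using one inj[OF m(4) m(5)] by auto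
    hence "xs ! (Suc 2 mod length xs) = 0" using z[OF m(5)] by (elim disjE) simp_all
    hence "Suc 2 mod length xs = 1" using one inj[OF m(6) m(4)] by metis
    thus False using len by (cases "length xs = 3") simp_all
  qed
  hence "tree T" using simple conn unfolding tree_def by blast
  moreover have "card (edges T) = k"
  proof -
    have "inj_on (\<lambda>i::nat. {0, i}) {1..k}" by (auto simp: inj_on_def doubleton_eq_iff)
    thus ?thesis unfolding T_def by (simp add: card_image)
  qed
  ultimately have "T \<in> trees_with_edges k" unfolding trees_with_edges_def by blast
  hence "tree_iso_rel k `` {T} \<in> unlabelled_trees k"
    unfolding unlabelled_trees_def by (rule quotientI)
  thus ?thesis by blast
qed

lemma set_pmf_random_tree: "set_pmf (random_tree k) = unlabelled_trees k"
  unfolding random_tree_def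
  by (rule set_pmf_of_set[OF unlabelled_trees_nonempty finite_unlabelled_trees])

end

theory Submission
  imports Defs
begin

text \<open>
  Let \<open>p = 2m + 1\<close>, \<open>q = (r - 1) / 2\<close> and let \<open>I\<close> be the set of non-leaves of a tree with \<open>m + 2\<close>
  vertices. If \<open>(4m + 27) / 9 \<le> |I| \<le> 2m / 3\<close> and \<open>m \<ge> 12\<close>, the tree decomposes the graph, as follows.
  Remove a leaf \<open>x0\<close>. One constructs \<open>r\<close> embeddings of the rest into the group
  \<open>Z_p \<times> Z_r\<close> whose edge differences partition the elements with nonzero first coordinate. Each
  embedding first places a subtree containing \<open>I\<close> greedily in layer 0 or in the layers 0 and
  \<open>g\<close>; the first two together use up all differences in layer 0. The remaining leaves are added
  greedily, and those of the first embedding absorb exactly the differences left over. In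
  \<open>q\<close> embeddings \<open>x0\<close> is placed so that the differences \<open>(0, \<plusminus>g)\<close> are covered, and in the
  other \<open>q + 1\<close> it becomes a vertex of the independent set. All translates form the decomposition.

  Trees that violate the bounds on \<open>I\<close> are exponentially rare. Rooted trees weighted by
  \<open>x ^ nodes * u ^ leaves\<close> satisfy Polya's functional equation, which bounds the total weight for
  \<open>(x, u) = (0.43, 1/2)\<close> and \<open>(0.233, 2)\<close>; hence at most \<open>O(0.341 ^ (-n))\<close> trees have too few or too many
  leaves. The same equation shows that the generating function reaches 1 at \<open>x = 0.34\<close>,
  so that, up to a polynomial factor, there are at least \<open>0.34 ^ (-n)\<close> trees in total.
\<close>

section \<open>Connected subsets of a tree\<close>

text \<open>The counts are tight. A copy without \<open>x0\<close> has \<open>m\<close> edges, so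
  \<open>r\<close> copies need all \<open>r * (p - 1)\<close> differences with nonzero first
  coordinate, and the \<open>r\<close> edges at \<open>x0\<close> just suffice for the
  \<open>q\<close> pairs \<open>(0, \<plusminus>g)\<close> and the \<open>q + 1\<close> independent
  vertices. Greedy placement needs slack, so one copy is completed last; until then its missing
  leaves keep differences spare.

  The bounds on \<open>|I|\<close> come from placing subtrees with \<open>m1 + 1\<close> vertices.
  Between two layers a vertex costs two of the \<open>2m\<close> options: one jump and one position.
  A second copy in the same layers finds \<open>m1\<close> jumps blocked, so about
  \<open>3 * m1\<close> options are needed and \<open>m1\<close> is about \<open>2m/3\<close>. In
  layer 0 this leaves \<open>s = m - m1\<close>, about \<open>m/3\<close>, pairs
  \<open>\<plusminus>d\<close> for the next copy. Within one layer a vertex costs three options, so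
  the greedy placement stops after about \<open>2s/3\<close> pairs; the other \<open>s/3\<close>
  take up to two vertices of \<open>I\<close> each, in all \<open>4s/3\<close>, about
  \<open>4m/9\<close>.

  Typically about \<open>0.56 n\<close> of \<open>n\<close> vertices are non-leaves, well inside
  these bounds. The constants 0.34 and 0.341 lie just above 0.3383, the radius of convergence for
  rooted trees.\<close>

lemma rtrancl_simple_path:
  assumes "(a, b) \<in> R\<^sup>*"
  shows "\<exists>xs. xs \<noteq> [] \<and> hd xs = a \<and> last xs = b \<and> distinct xs \<and>
           (\<forall>i. Suc i < length xs \<longrightarrow> (xs ! i, xs ! Suc i) \<in> R)"
  using assms
proof (induction rule: converse_rtrancl_induct)
  case base
  show ?case by (intro exI[of _ "[b]"]) auto
next
  case (step y z)
  then obtain xs where xs: "xs \<noteq> []" "hd xs = z" "last xs = b" "distinct xs"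
    "\<And>i. Suc i < length xs \<Longrightarrow> (xs ! i, xs ! Suc i) \<in> R" by blast
  show ?case
  proof (cases "y \<in> set xs")
    case True
    then obtain k where k: "k < length xs" "xs ! k = y" by (auto simp: in_set_conv_nth)
    show ?thesis
    proof (intro exI[of _ "drop k xs"] conjI allI impI)
      fix i assume "Suc i < length (drop k xs)"
      thus "(drop k xs ! i, drop k xs ! Suc i) \<in> R" using xs(5)[of "k + i"] by simp
    qed (use k xs in \<open>auto simp: hd_drop_conv_nth last_drop\<close>)
  next
    case False
    show ?thesis
    proof (intro exI[of _ "y # xs"] conjI allI impI)
      fix i assume "Suc i < length (y # xs)"
      thus "((y # xs) ! i, (y # xs) ! Suc i) \<in> R"
        using xs step.hyps(1) by (cases i) (auto simp: hd_conv_nth)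
    qed (use False xs in auto)
  qed
qed

text \<open>A simple path from \<open>a\<close> to \<open>b\<close> that avoids the edge has at
  least three vertices, and the edge closes it to a cycle.\<close>

lemma tree_edge_is_bridge:
  assumes "tree (V, E)" "{a, b} \<in> E"
  shows "(a, b) \<notin> (adjacency (V, E - {{a, b}}))\<^sup>*"
proof
  assume "(a, b) \<in> (adjacency (V, E - {{a, b}}))\<^sup>*"
  from rtrancl_simple_path[OF this] obtain xs where xs: "xs \<noteq> []" "hd xs = a" "last xs = b"
    "distinct xs" "\<And>i. Suc i < length xs \<Longrightarrow> (xs ! i, xs ! Suc i) \<in> adjacency (V, E - {{a, b}})"
    by blast
  have ab: "a \<noteq> b" using assms by (auto simp: tree_def simple_graph_def)
  have ends: "xs ! 0 = a" "xs ! (length xs - 1) = b"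
    using xs by (simp_all add: hd_conv_nth last_conv_nth)
  have "length xs \<noteq> 1" using ends ab by auto
  moreover have "length xs \<noteq> 2"
    using ends xs(5)[of 0] by (auto simp: adjacency_def numeral_2_eq_2)
  moreover have "length xs \<noteq> 0" using xs(1) by simp
  ultimately have len: "length xs \<ge> 3" by linarith
  have "is_cycle (V, E) xs"
    unfolding is_cycle_def
  proof (intro conjI allI impI)
    fix i assume i: "i < length xs"
    show "{xs ! i, xs ! (Suc i mod length xs)} \<in> edges (V, E)"
    proof (cases "Suc i < length xs")
      case True
      thus ?thesis using xs(5)[OF True] by (simp add: adjacency_def)
    next
      case False
      hence "i = length xs - 1" using i by simp
      moreover have "Suc i mod length xs = 0" using False i by (simp add: not_less_eq less_Suc_eq)
      ultimately show ?thesis using ends assms(2) by (simp add: insert_commute)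
    qed
  qed (use len xs in auto)
  thus False using assms(1) by (simp add: tree_def)
qed

text \<open>Reachability from the root alone suffices, as adjacency is symmetric, and it survives
  the addition of a vertex along an edge without a further argument.\<close>

definition connected_from :: "'a set set \<Rightarrow> 'a \<Rightarrow> 'a set \<Rightarrow> bool" where
  "connected_from E w S \<longleftrightarrow> w \<in> S \<and> (\<forall>v\<in>S. (w, v) \<in> (adjacency (S, {e \<in> E. e \<subseteq> S}))\<^sup>*)"

lemma adjacency_mono: "E \<subseteq> E' \<Longrightarrow> adjacency (V, E) \<subseteq> adjacency (V', E')"
  by (auto simp: adjacency_def)

lemma connected_from_singleton: "connected_from E w {w}"
  by (simp add: connected_from_def)

lemma connected_from_insert:
  assumes "connected_from E w S" "u \<in> S" "{u, v} \<in> E"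
  shows "connected_from E w (insert v S)"
proof -
  let ?A = "adjacency (S, {e \<in> E. e \<subseteq> S})"
  let ?B = "adjacency (insert v S, {e \<in> E. e \<subseteq> insert v S})"
  have "?A\<^sup>* \<subseteq> ?B\<^sup>*" by (intro rtrancl_mono adjacency_mono) auto
  moreover have "(u, v) \<in> ?B" using assms by (auto simp: adjacency_def)
  ultimately show ?thesis
    using assms unfolding connected_from_def by (auto intro: rtrancl_into_rtrancl)
qed

text \<open>Every greedy step takes its next edge from here: \<open>S\<close> is the part already
  embedded, \<open>W\<close> the part to be reached.\<close>

lemma connected_from_boundary:
  assumes "connected_from E w W" "w \<in> S" "S \<subset> W"
  obtains u v where "u \<in> S" "v \<in> W - S" "{u, v} \<in> E"
proof -
  obtain x where x: "x \<in> W - S" using assms(3) by blast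
  hence "(w, x) \<in> (adjacency (W, {e \<in> E. e \<subseteq> W}))\<^sup>*"
    using assms(1) by (auto simp: connected_from_def)
  hence "x \<in> S \<or> (\<exists>u v. u \<in> S \<and> v \<in> W - S \<and> {u, v} \<in> E)"
    by (induction rule: rtrancl_induct) (use assms(2) in \<open>auto simp: adjacency_def\<close>)
  thus ?thesis using x that by blast
qed

lemma connected_from_extend:
  assumes "connected_from E w S" "connected_from E w W" "S \<subseteq> W" "finite W"
    "card S \<le> k" "k \<le> card W"
  obtains S' where "S \<subseteq> S'" "S' \<subseteq> W" "card S' = k" "connected_from E w S'"
  using assms
proof (induction "k - card S" arbitrary: S thesis)
  case 0
  thus ?case by (metis diff_is_0_eq le_antisym order_refl)
next
  case (Suc n)
  hence "S \<subset> W" by auto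
  then obtain u v where uv: "u \<in> S" "v \<in> W - S" "{u, v} \<in> E"
    using connected_from_boundary[of E w W S] Suc.prems by (auto simp: connected_from_def)
  have fS: "finite S" using Suc.prems finite_subset by blast
  have c: "card (insert v S) = Suc (card S)" using uv fS by simp
  show ?case
  proof (rule Suc.hyps(1)[of "insert v S"])
    fix S' assume "insert v S \<subseteq> S'" "S' \<subseteq> W" "card S' = k" "connected_from E w S'"
    thus thesis using Suc.prems(1) by blast
  qed (use Suc.hyps Suc.prems uv c connected_from_insert[of E w S u v] in auto)
qed

lemma connected_from_Un:
  assumes "connected_from E w S" "connected_from E w W"
  shows "connected_from E w (S \<union> W)"
proof -
  have "(adjacency (S, {e \<in> E. e \<subseteq> S}))\<^sup>* \<subseteq> (adjacency (S \<union> W, {e \<in> E. e \<subseteq> S \<union> W}))\<^sup>*"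
    by (intro rtrancl_mono adjacency_mono) auto
  moreover have "(adjacency (W, {e \<in> E. e \<subseteq> W}))\<^sup>* \<subseteq> (adjacency (S \<union> W, {e \<in> E. e \<subseteq> S \<union> W}))\<^sup>*"
    by (intro rtrancl_mono adjacency_mono) auto
  ultimately show ?thesis using assms by (auto simp: connected_from_def)
qed

text \<open>Two such edges would give a detour through \<open>v\<close>, \<open>b\<close>,
  \<open>w\<close>, \<open>a\<close> around the bridge \<open>{v, a}\<close>. Consequently each
  newly embedded vertex brings one new edge, hence one new difference up to sign.\<close>

lemma tree_unique_neighbour:
  assumes "tree (V, E)" "connected_from E w S" "v \<notin> S"
    "a \<in> S" "b \<in> S" "{a, v} \<in> E" "{b, v} \<in> E"
  shows "a = b"
proof (rule ccontr)
  assume ab: "a \<noteq> b"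
  let ?A = "adjacency (S, {e \<in> E. e \<subseteq> S})" and ?B = "adjacency (V, E - {{v, a}})"
  have sub: "?A\<^sup>* \<subseteq> ?B\<^sup>*"
    using assms(3) by (intro rtrancl_mono adjacency_mono) auto
  have "sym ?A" by (auto simp: sym_def adjacency_def insert_commute)
  hence "(b, w) \<in> ?A\<^sup>*"
    using assms(2,5) sym_rtrancl[of ?A] by (auto simp: connected_from_def sym_def)
  moreover have "(w, a) \<in> ?A\<^sup>*" using assms(2,4) by (auto simp: connected_from_def)
  ultimately have "(b, a) \<in> ?B\<^sup>*" using sub by (meson rtrancl_trans subsetD)
  moreover have "(v, b) \<in> ?B"
    using assms(7) ab by (auto simp: adjacency_def insert_commute doubleton_eq_iff)
  ultimately have "(v, a) \<in> ?B\<^sup>*" by (meson converse_rtrancl_into_rtrancl)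
  moreover have "{v, a} \<in> E" using assms(6) by (simp add: insert_commute)
  ultimately show False using tree_edge_is_bridge[OF assms(1)] by blast
qed

definition neighbours :: "'a set set \<Rightarrow> 'a \<Rightarrow> 'a set" where
  "neighbours E v = {u. {v, u} \<in> E}"

definition inner_verts :: "'a ugraph \<Rightarrow> 'a set" where
  "inner_verts G = {v \<in> verts G. card (neighbours (edges G) v) \<ge> 2}"

section \<open>Embeddings with distinct differences\<close>

text \<open>Elements of the group \<open>Z_p \<times> Z_r\<close> are represented by pairs of least residues.\<close>

locale grid =
  fixes p r :: int
  assumes p_odd: "odd p" and p_pos: "p > 0" and r_odd: "odd r" and r_pos: "r > 0"
begin

definition L :: "(int \<times> int) set" where "L = {0..<p} \<times> {0..<r}"
definition add :: "int \<times> int \<Rightarrow> int \<times> int \<Rightarrow> int \<times> int" where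
  "add a b = ((fst a + fst b) mod p, (snd a + snd b) mod r)"
definition sub :: "int \<times> int \<Rightarrow> int \<times> int \<Rightarrow> int \<times> int" where
  "sub a b = ((fst a - fst b) mod p, (snd a - snd b) mod r)"
definition neg :: "int \<times> int \<Rightarrow> int \<times> int" where
  "neg a = ((- fst a) mod p, (- snd a) mod r)"

lemma finite_L [simp]: "finite L" by (simp add: L_def)

lemma L_closed [simp]: "add a b \<in> L" "sub a b \<in> L" "neg a \<in> L" "(0, 0) \<in> L"
  using p_pos r_pos by (auto simp: L_def add_def sub_def neg_def)

lemma sub_add [simp]: "b \<in> L \<Longrightarrow> sub (add a b) a = b"
  by (auto simp: L_def add_def sub_def mod_diff_left_eq)
lemma add_sub [simp]: "b \<in> L \<Longrightarrow> add a (sub b a) = b"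
  by (auto simp: L_def add_def sub_def mod_add_right_eq)
lemma neg_sub [simp]: "neg (sub a b) = sub b a"
  by (auto simp: sub_def neg_def mod_minus_eq)
lemma neg_neg [simp]: "a \<in> L \<Longrightarrow> neg (neg a) = a"
  by (auto simp: L_def neg_def mod_minus_eq)
lemma sub_eq_0_iff: "\<lbrakk>a \<in> L; b \<in> L\<rbrakk> \<Longrightarrow> sub a b = (0, 0) \<longleftrightarrow> a = b"
  by (metis add_sub sub_add sub_def diff_self mod_0 fst_conv snd_conv L_closed(4))
lemma sub_self [simp]: "sub a a = (0, 0)" by (simp add: sub_def)
lemma sub_translate [simp]: "sub (add a g) (add b g) = sub a b"
  by (auto simp: add_def sub_def mod_diff_eq)
lemma add_eq_iff: "\<lbrakk>b \<in> L; c \<in> L\<rbrakk> \<Longrightarrow> add a b = add a c \<longleftrightarrow> b = c"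
  by (metis sub_add)
lemma add_commute: "add a b = add b a" by (simp add: add_def ac_simps)
lemma add_zero [simp]: "a \<in> L \<Longrightarrow> add a (0, 0) = a" "a \<in> L \<Longrightarrow> add (0, 0) a = a"
  by (auto simp: L_def add_def)
lemma neg_zero [simp]: "neg (0, 0) = (0, 0)" by (simp add: neg_def)

lemma mod_neg_eq_self:
  fixes x k :: int
  assumes "odd k" "0 \<le> x" "x < k" "(- x) mod k = x"
  shows "x = 0"
proof -
  have "k dvd - x - x" using assms(4) by (metis mod_eq_dvd_iff mod_mod_trivial)
  hence "k dvd 2 * x" by (simp add: algebra_simps)
  hence "k dvd x" using assms(1) coprime_dvd_mult_right_iff[of k 2 x]
    by (simp add: coprime_commute)
  thus ?thesis using assms(2,3) zdvd_not_zless by force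
qed

text \<open>Odd moduli exclude elements of order two. Hence every edge contributes exactly two
  differences.\<close>

lemma neg_ne_self: "\<lbrakk>a \<in> L; a \<noteq> (0, 0)\<rbrakk> \<Longrightarrow> neg a \<noteq> a"
  using mod_neg_eq_self[of p "fst a"] mod_neg_eq_self[of r "snd a"] p_odd r_odd
  by (auto simp: L_def neg_def prod_eq_iff)

end

locale tree_grid = grid p r for p r +
  fixes V :: "'a set" and E :: "'a set set" and w :: 'a
  assumes tree: "tree (V, E)" and w_in: "w \<in> V"
begin

text \<open>The last argument is the set of differences, in both directions, along the embedded edges.\<close>

inductive partial_emb :: "'a set \<Rightarrow> ('a \<Rightarrow> int \<times> int) \<Rightarrow> (int \<times> int) set \<Rightarrow> bool" where
  root: "partial_emb {w} (\<lambda>_. (0, 0)) {}"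
| step: "\<lbrakk>partial_emb S \<phi> A; u \<in> S; v \<in> V - S; {u, v} \<in> E; y \<in> L; y \<notin> \<phi> ` S;
          sub y (\<phi> u) \<notin> A\<rbrakk>
         \<Longrightarrow> partial_emb (insert v S) (\<phi>(v := y)) (insert (sub y (\<phi> u)) (insert (sub (\<phi> u) y) A))"

lemma finite_V: "finite V" using tree by (simp add: tree_def simple_graph_def)

lemma edge_ne: "{a, b} \<in> E \<Longrightarrow> a \<noteq> b"
  using tree by (auto simp: tree_def simple_graph_def)

lemma edge_verts: "{a, b} \<in> E \<Longrightarrow> a \<in> V \<and> b \<in> V"
  using tree by (auto simp: tree_def simple_graph_def)

text \<open>The quantifiers range over oriented edges, so two edges with opposite differences are
  excluded too.\<close>

definition rainbow :: "'a set \<Rightarrow> ('a \<Rightarrow> int \<times> int) \<Rightarrow> bool" where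
  "rainbow S \<phi> \<longleftrightarrow> (\<forall>a\<in>S. \<forall>b\<in>S. \<forall>a'\<in>S. \<forall>b'\<in>S. {a, b} \<in> E \<longrightarrow> {a', b'} \<in> E \<longrightarrow>
     sub (\<phi> b) (\<phi> a) = sub (\<phi> b') (\<phi> a') \<longrightarrow> a = a' \<and> b = b')"

text \<open>By \<open>tree_unique_neighbour\<close> the only new edge is \<open>{u, v}\<close>. Its
  two differences are distinct and, as \<open>A\<close> is closed under \<open>neg\<close>, both
  new; this keeps the count of \<open>A\<close> exact.\<close>

lemma partial_emb_facts:
  assumes "partial_emb S \<phi> A"
  shows "connected_from E w S \<and> S \<subseteq> V \<and> finite S \<and> inj_on \<phi> S \<and> \<phi> ` S \<subseteq> L \<and> \<phi> w = (0, 0) \<and>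
         A \<subseteq> L - {(0, 0)} \<and> (\<forall>d\<in>A. neg d \<in> A) \<and> card A + 2 = 2 * card S \<and>
         (\<forall>a\<in>S. \<forall>b\<in>S. {a, b} \<in> E \<longrightarrow> sub (\<phi> b) (\<phi> a) \<in> A) \<and> rainbow S \<phi>"
  using assms
proof (induction rule: partial_emb.induct)
  case root
  show ?case using w_in edge_ne[of w w] connected_from_singleton[of E w] by (auto simp: rainbow_def)
next
  case (step S \<phi> A u v y)
  let ?d = "sub y (\<phi> u)" and ?n = "sub (\<phi> u) y" and ?f = "\<phi>(v := y)"
  have S: "connected_from E w S" "S \<subseteq> V" "finite S" "inj_on \<phi> S" "\<phi> ` S \<subseteq> L" "\<phi> w = (0, 0)"
    "A \<subseteq> L - {(0, 0)}" "\<forall>d\<in>A. neg d \<in> A" "card A + 2 = 2 * card S"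
    "\<And>a b. \<lbrakk>a \<in> S; b \<in> S; {a, b} \<in> E\<rbrakk> \<Longrightarrow> sub (\<phi> b) (\<phi> a) \<in> A" "rainbow S \<phi>"
    using step.IH by auto
  have wS: "w \<in> S" using S(1) by (simp add: connected_from_def)
  have vS: "v \<notin> S" using step.hyps by blast
  have uniq: "a = u" if "a \<in> S" "{a, v} \<in> E" for a
    using tree_unique_neighbour[OF tree S(1) vS that(1) step.hyps(2) that(2) step.hyps(4)] .
  have yu: "y \<noteq> \<phi> u" "\<phi> u \<in> L" using step.hyps S(5) by auto
  have d0: "?d \<noteq> (0, 0)" "?n \<noteq> (0, 0)" using yu step.hyps(5) by (auto simp: sub_eq_0_iff)
  have nd: "neg ?d = ?n" "neg ?n = ?d" by simp_all
  have nA: "?n \<notin> A" using S(8) step.hyps(7) nd by metis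
  have dn: "?d \<noteq> ?n" using neg_ne_self[of ?d] d0 nd by simp
  have fA: "finite A" by (rule finite_subset[OF _ finite_L]) (use S(7) in blast)
  have c: "card (insert ?d (insert ?n A)) = card A + 2"
    using fA nA dn step.hyps(7) by simp
  have new: "(a = v \<and> b = u) \<or> (a = u \<and> b = v)"
    if "a \<in> insert v S" "b \<in> insert v S" "{a, b} \<in> E" "\<not> (a \<in> S \<and> b \<in> S)" for a b
    using that uniq edge_ne[OF that(3)] by (auto simp: insert_commute)
  have val: "sub (?f b) (?f a) = (if a \<in> S \<and> b \<in> S then sub (\<phi> b) (\<phi> a) else if b = v then ?d else ?n)"
    if "a \<in> insert v S" "b \<in> insert v S" "{a, b} \<in> E" for a b
    using new[OF that] that vS step.hyps(2) by auto
  have rb: "rainbow (insert v S) ?f"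
    unfolding rainbow_def
  proof (intro ballI impI)
    fix a b a' b'
    assume h: "a \<in> insert v S" "b \<in> insert v S" "a' \<in> insert v S" "b' \<in> insert v S"
      "{a, b} \<in> E" "{a', b'} \<in> E" "sub (?f b) (?f a) = sub (?f b') (?f a')"
    show "a = a' \<and> b = b'"
    proof (cases "a \<in> S \<and> b \<in> S"; cases "a' \<in> S \<and> b' \<in> S")
      assume x: "a \<in> S \<and> b \<in> S" "a' \<in> S \<and> b' \<in> S"
      hence "sub (\<phi> b) (\<phi> a) = sub (\<phi> b') (\<phi> a')"
        using h(7) val[OF h(1,2,5)] val[OF h(3,4,6)] by simp
      thus ?thesis using S(11) x h(5,6) unfolding rainbow_def by blast
    next
      assume x: "a \<in> S \<and> b \<in> S" "\<not> (a' \<in> S \<and> b' \<in> S)"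
      hence "sub (\<phi> b) (\<phi> a) \<in> {?d, ?n}"
        using h(7) val[OF h(1,2,5)] val[OF h(3,4,6)] by (auto split: if_splits)
      thus ?thesis using S(10)[of a b] x h(5) step.hyps(7) nA by auto
    next
      assume x: "\<not> (a \<in> S \<and> b \<in> S)" "a' \<in> S \<and> b' \<in> S"
      hence "sub (\<phi> b') (\<phi> a') \<in> {?d, ?n}"
        using h(7) val[OF h(1,2,5)] val[OF h(3,4,6)] by (auto split: if_splits)
      thus ?thesis using S(10)[of a' b'] x h(6) step.hyps(7) nA by auto
    next
      assume x: "\<not> (a \<in> S \<and> b \<in> S)" "\<not> (a' \<in> S \<and> b' \<in> S)"
      thus ?thesis
        using h(7) val[OF h(1,2,5)] val[OF h(3,4,6)] new[OF h(1,2,5) x(1)] new[OF h(3,4,6) x(2)]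
          dn vS step.hyps(2) by (auto split: if_splits)
    qed
  qed
  have inA: "sub (?f b) (?f a) \<in> insert ?d (insert ?n A)"
    if "a \<in> insert v S" "b \<in> insert v S" "{a, b} \<in> E" for a b
    using val[OF that] S(10)[of a b] that(3) by auto
  show ?case
  proof (intro conjI)
    show "connected_from E w (insert v S)" using connected_from_insert[OF S(1) step.hyps(2,4)] .
    show "inj_on ?f (insert v S)" using S(4) vS step.hyps(6) by (auto simp: inj_on_def)
    show "?f ` insert v S \<subseteq> L" using S(5) step.hyps(5) by auto
    show "insert ?d (insert ?n A) \<subseteq> L - {(0, 0)}" using S(7) d0 by auto
    show "\<forall>d\<in>insert ?d (insert ?n A). neg d \<in> insert ?d (insert ?n A)" using S(8) nd by auto
    show "card (insert ?d (insert ?n A)) + 2 = 2 * card (insert v S)"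
      using c S(3,9) vS by simp
    show "\<forall>a\<in>insert v S. \<forall>b\<in>insert v S. {a, b} \<in> E \<longrightarrow> sub (?f b) (?f a) \<in> insert ?d (insert ?n A)"
      using inA by blast
    show "rainbow (insert v S) ?f" by (rule rb)
  qed (use S wS vS step.hyps in auto)
qed

end

section \<open>Counting the options of a greedy step\<close>

context grid begin

text \<open>Translation by \<open>z\<close> is injective, so an occupied position excludes at most
  one difference of \<open>K\<close>.\<close>

lemma choose_difference:
  assumes "K \<subseteq> L" "finite Occ" "card (K \<inter> Bad) + card Occ < card K"
  obtains d where "d \<in> K" "d \<notin> Bad" "add z d \<notin> Occ"
proof -
  have fK: "finite K" using assms(1) finite_L finite_subset by blast
  have "card {d \<in> K. add z d \<in> Occ} \<le> card Occ"
  proof (rule card_inj_on_le[of "add z"])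
    show "inj_on (add z) {d \<in> K. add z d \<in> Occ}"
      using assms(1) by (auto intro!: inj_onI simp: add_eq_iff subset_iff)
  qed (use assms in auto)
  moreover have "card (K \<inter> Bad \<union> {d \<in> K. add z d \<in> Occ}) \<le> card (K \<inter> Bad) + card {d \<in> K. add z d \<in> Occ}"
    by (rule card_Un_le)
  ultimately have "card (K \<inter> Bad \<union> {d \<in> K. add z d \<in> Occ}) < card K" using assms(3) by linarith
  hence "K \<inter> Bad \<union> {d \<in> K. add z d \<in> Occ} \<noteq> K" by auto
  thus ?thesis using that by blast
qed

end

context tree_grid begin

text \<open>From a position \<open>z\<close> the next vertex is reached by a difference in \<open>K z\<close>. At most \<open>c\<close> of these are
  excluded at the start, each new edge excludes at most \<open>e\<close> more, and at most \<open>card W + b\<close> target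
  positions are occupied or blocked.\<close>

lemma grow:
  assumes "partial_emb S \<phi> A" and W: "connected_from E w W" "W \<subseteq> V" and "S \<subseteq> W" and "\<phi> ` S \<subseteq> Reg"
    and K: "\<And>z. z \<in> Reg \<Longrightarrow> K z \<subseteq> L" "\<And>z. z \<in> Reg \<Longrightarrow> card (K z) = N"
      "\<And>z d. \<lbrakk>z \<in> Reg; d \<in> K z\<rbrakk> \<Longrightarrow> add z d \<in> Reg \<and> d \<in> KK \<and> neg d \<in> KK"
    and e: "\<And>z d. \<lbrakk>z \<in> Reg; d \<in> KK\<rbrakk> \<Longrightarrow> card (K z \<inter> {d, neg d}) \<le> e"
    and "\<And>z. z \<in> Reg \<Longrightarrow> card (K z \<inter> (A \<union> X)) \<le> c"
    and X: "\<And>d. d \<in> X \<Longrightarrow> neg d \<in> X" "X \<subseteq> L" and "A \<inter> X = {}"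
    and Blk: "finite Blk" "card Blk \<le> b"
    and "S \<noteq> W \<Longrightarrow> c + e * (card W - card S - 1) + card W + b \<le> N"
  shows "\<exists>\<phi>' A'. partial_emb W \<phi>' A' \<and> (\<forall>a\<in>S. \<phi>' a = \<phi> a) \<and> A \<subseteq> A' \<and> A' \<inter> X = {} \<and>
           \<phi>' ` (W - S) \<inter> Blk = {} \<and> \<phi>' ` W \<subseteq> Reg \<and> A' - A \<subseteq> KK"
  using assms(1,4,5,10,13,16)
proof (induction "card W - card S" arbitrary: S \<phi> A c)
  case 0
  have "finite W" using W(2) finite_V finite_subset by blast
  hence "S = W" using 0 by (metis card_seteq diff_is_0_eq)
  thus ?case using 0 by auto
next
  case (Suc n)
  have fW: "finite W" using W(2) finite_V finite_subset by blast
  have SW: "S \<noteq> W" using Suc.hyps(2) by auto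
  note num = Suc.prems(6)[OF SW]
  have facts: "connected_from E w S" "S \<subseteq> V" "finite S" "\<phi> ` S \<subseteq> L" "A \<subseteq> L"
    using partial_emb_facts[OF Suc.prems(1)] by auto
  have wS: "w \<in> S" using facts(1) by (simp add: connected_from_def)
  obtain u v where uv: "u \<in> S" "v \<in> W - S" "{u, v} \<in> E"
    using connected_from_boundary[OF W(1) wS] SW Suc.prems(2) by blast
  have z: "\<phi> u \<in> Reg" "\<phi> u \<in> L" using uv(1) Suc.prems(3) facts(4) by auto
  have cS: "card S < card W" using SW Suc.prems(2) fW by (simp add: psubset_card_mono psubset_eq)
  have "card (\<phi> ` S \<union> Blk) \<le> card S + b"
    using card_Un_le[of "\<phi> ` S" Blk] card_image_le[OF facts(3), of \<phi>] Blk(2) by linarith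
  hence "card (K (\<phi> u) \<inter> (A \<union> X)) + card (\<phi> ` S \<union> Blk) < card (K (\<phi> u))"
    using Suc.prems(4)[OF z(1)] K(2)[OF z(1)] num cS by linarith
  then obtain d where d: "d \<in> K (\<phi> u)" "d \<notin> A \<union> X" "add (\<phi> u) d \<notin> \<phi> ` S \<union> Blk"
    using choose_difference[OF K(1)[OF z(1)], of "\<phi> ` S \<union> Blk" "A \<union> X" "\<phi> u"] facts(3) Blk(1) by auto
  define y where "y = add (\<phi> u) d"
  have dL: "d \<in> L" using d(1) K(1)[OF z(1)] by blast
  have sd: "sub y (\<phi> u) = d" "sub (\<phi> u) y = neg d"
    unfolding y_def using dL sub_add[OF dL, of "\<phi> u"] neg_sub[of "add (\<phi> u) d" "\<phi> u"] by simp_all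
  have yR: "y \<in> Reg" "d \<in> KK" "neg d \<in> KK" using K(3)[OF z(1) d(1)] by (auto simp: y_def)
  have vS: "v \<notin> S" using uv by blast
  let ?S = "insert v S" and ?f = "\<phi>(v := y)" and ?A = "insert d (insert (neg d) A)"
  have st: "partial_emb ?S ?f ?A"
    using partial_emb.step[OF Suc.prems(1) uv(1) _ uv(3), of y] uv W(2) d sd y_def by auto
  have cardS: "card ?S = Suc (card S)" using vS facts(3) by simp
  have "card (K z \<inter> (?A \<union> X)) \<le> c + e" if "z \<in> Reg" for z
  proof -
    have eq: "K z \<inter> (?A \<union> X) = (K z \<inter> (A \<union> X)) \<union> (K z \<inter> {d, neg d})" by blast
    have "card (K z \<inter> (?A \<union> X)) \<le> card (K z \<inter> (A \<union> X)) + card (K z \<inter> {d, neg d})"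
      unfolding eq by (rule card_Un_le)
    also have "\<dots> \<le> c + e" by (intro add_mono Suc.prems(4) e that yR(2))
    finally show ?thesis .
  qed
  moreover have "?A \<inter> X = {}"
    using Suc.prems(5) d(2) X(1)[of "neg d"] dL by auto
  moreover have "c + e + e * (card W - card ?S - 1) + card W + b \<le> N" if "?S \<noteq> W"
  proof -
    have "card ?S < card W"
      using that uv Suc.prems(2) fW by (intro psubset_card_mono) auto
    hence "card W - card S - 1 = Suc (card W - card ?S - 1)" using cardS by simp
    thus ?thesis using num by (simp add: algebra_simps)
  qed
  moreover have "n = card W - card ?S" using Suc.hyps(2) cardS by simp
  moreover have "?S \<subseteq> W" using uv Suc.prems(2) by blast
  moreover have "?f ` ?S \<subseteq> Reg" using Suc.prems(3) yR(1) by auto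
  ultimately obtain \<phi>' A' where IH: "partial_emb W \<phi>' A'" "\<forall>a\<in>?S. \<phi>' a = ?f a" "?A \<subseteq> A'"
    "A' \<inter> X = {}" "\<phi>' ` (W - ?S) \<inter> Blk = {}" "\<phi>' ` W \<subseteq> Reg" "A' - ?A \<subseteq> KK"
    using Suc.hyps(1)[OF _ st, of "c + e"] by metis
  have vy: "\<phi>' v = y" using IH(2) by simp
  have agree: "\<forall>a\<in>S. \<phi>' a = \<phi> a" using IH(2) vS by auto
  have blk: "\<phi>' ` (W - S) \<inter> Blk = {}" 
  proof -
    have "\<phi>' ` (W - S) \<subseteq> insert y (\<phi>' ` (W - ?S))" using vy by auto
    moreover have "y \<notin> Blk" using d(3) y_def by simp
    ultimately show ?thesis using IH(5) by blast
  qed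
  have sub: "A' - A \<subseteq> KK" using IH(7) yR by blast
  have AA: "A \<subseteq> A'" using IH(3) by blast
  show ?case using IH(1,4,6) agree blk sub AA by blast
qed

end

section \<open>Differences sorted by their second coordinate\<close>

context grid begin

text \<open>First coordinate 0 is left out because the differences \<open>(0, h)\<close> are
  reserved for the edge at the removed leaf.\<close>

definition slice :: "int \<Rightarrow> (int \<times> int) set" where "slice g = {1..<p} \<times> {g}"
text \<open>The differences that lead from the layer of \<open>z\<close> to the other one of the
  layers 0 and \<open>g\<close>; for \<open>g = 0\<close> the two layers coincide.\<close>

definition jumps :: "int \<Rightarrow> int \<times> int \<Rightarrow> (int \<times> int) set" where
  "jumps g z = (if snd z = 0 then slice g else slice (r - g))"
definition two_layers :: "int \<Rightarrow> (int \<times> int) set" where "two_layers g = {0..<p} \<times> {0, g}"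
definition diff_class :: "int \<Rightarrow> (int \<times> int) set" where "diff_class g = slice g \<union> slice (r - g)"

lemma finite_slice [simp]: "finite (slice g)" by (simp add: slice_def)

lemma card_slice [simp]: "card (slice g) = nat (p - 1)"
  by (simp add: slice_def card_cartesian_product)

lemma slice_subset: "\<lbrakk>0 \<le> g; g < r\<rbrakk> \<Longrightarrow> slice g \<subseteq> L" by (auto simp: slice_def L_def)

lemma mod_minus_pos: "\<lbrakk>0 < x; x < k\<rbrakk> \<Longrightarrow> (- x) mod k = k - x" for x k :: int
  by (metis add.commute diff_add_cancel mod_add_self1 mod_pos_pos_trivial uminus_add_conv_diff
      diff_less_eq less_add_same_cancel2 diff_ge_0_iff_ge less_imp_le)

lemma neg_slice_pos: "\<lbrakk>d \<in> slice g; 0 < g; g < r\<rbrakk> \<Longrightarrow> neg d \<in> slice (r - g)"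
  by (auto simp: slice_def neg_def mod_minus_pos)

lemma neg_slice_0: "d \<in> slice 0 \<Longrightarrow> neg d \<in> slice 0"
  by (auto simp: slice_def neg_def mod_minus_pos)

lemma slice_disjoint: "g \<noteq> h \<Longrightarrow> slice g \<inter> slice h = {}" by (auto simp: slice_def)

lemma r_ne_double: "r - g \<noteq> g" using r_odd by (metis add_diff_cancel_left' diff_eq_eq even_add)

lemma card_neg_closed_slice:
  assumes "U \<subseteq> L" "\<And>d. d \<in> U \<Longrightarrow> neg d \<in> U" "0 < g" "g < r"
  shows "card (U \<inter> slice (r - g)) = card (U \<inter> slice g)"
proof (rule bij_betw_same_card)
  show "bij_betw neg (U \<inter> slice (r - g)) (U \<inter> slice g)"
  proof (rule bij_betw_byWitness[of _ neg])
    show "neg ` (U \<inter> slice (r - g)) \<subseteq> U \<inter> slice g"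
      using assms neg_slice_pos[of _ "r - g"] by auto
    show "neg ` (U \<inter> slice g) \<subseteq> U \<inter> slice (r - g)"
      using assms neg_slice_pos[of _ g] by auto
  qed (use assms in auto)
qed

text \<open>Negation exchanges the two slices of \<open>diff_class g\<close>, so a symmetric set
  blocks at each position only half of what it contains of the class.\<close>

lemma card_jumps_Int:
  assumes "U \<subseteq> L" "\<And>d. d \<in> U \<Longrightarrow> neg d \<in> U" "0 < g" "g < r"
  shows "2 * card (jumps g z \<inter> U) = card (U \<inter> diff_class g)"
proof -
  have fU: "finite U" using assms(1) finite_L finite_subset by blast
  have "card (U \<inter> diff_class g) = card (U \<inter> slice g) + card (U \<inter> slice (r - g))"
    unfolding diff_class_def Int_Un_distrib
    using slice_disjoint[of g "r - g"] r_ne_double[of g] fU by (subst card_Un_disjoint) auto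
  thus ?thesis using card_neg_closed_slice[OF assms] by (simp add: jumps_def Int_commute)
qed

text \<open>The last item is the advantage over a single layer: \<open>d\<close> and
  \<open>neg d\<close> are jumps from different layers, so a new edge removes only one jump from
  each position.\<close>

lemma jumps_facts:
  assumes "0 < g" "g < r" "z \<in> two_layers g"
  shows "jumps g z \<subseteq> L" "card (jumps g z) = nat (p - 1)"
    "d \<in> jumps g z \<Longrightarrow> add z d \<in> two_layers g \<and> d \<in> diff_class g \<and> neg d \<in> diff_class g"
    "card (jumps g z \<inter> {d, neg d}) \<le> 1"
proof -
  show "jumps g z \<subseteq> L" using assms slice_subset by (auto simp: jumps_def)
  show "card (jumps g z) = nat (p - 1)" by (simp add: jumps_def)
  show "add z d \<in> two_layers g \<and> d \<in> diff_class g \<and> neg d \<in> diff_class g" if "d \<in> jumps g z"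
    using that assms neg_slice_pos[of d g] neg_slice_pos[of d "r - g"] p_pos
    by (auto simp: jumps_def two_layers_def diff_class_def add_def slice_def split: if_splits)
  have "\<not> (d \<in> jumps g z \<and> neg d \<in> jumps g z)"
    using assms neg_slice_pos[of d g] neg_slice_pos[of d "r - g"] r_ne_double[of g]
    by (auto simp: jumps_def slice_def split: if_splits)
  hence "jumps g z \<inter> {d, neg d} \<subseteq> {d} \<or> jumps g z \<inter> {d, neg d} \<subseteq> {neg d}" by blast
  thus "card (jumps g z \<inter> {d, neg d}) \<le> 1"
    by (metis card_mono card.empty card_insert_disjoint empty_iff finite.emptyI finite.insertI One_nat_def)
qed

end

context tree_grid begin

text \<open>A difference \<open>d\<close> in \<open>slice 0\<close> is used up by two steps: a vertex \<open>u\<close> of \<open>I\<close> is placed with a difference of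
  the class of \<open>g\<close> such that the position displaced by \<open>d\<close> is free, and then a further neighbour of
  \<open>u\<close>, which exists since \<open>u\<close> is not a leaf, is placed there.\<close>

lemma pair_steps:
  assumes "partial_emb S \<phi> A" and "\<phi> ` S \<subseteq> two_layers g" and g: "0 < g" "g < r"
    and X: "\<And>d. d \<in> X \<Longrightarrow> neg d \<in> X" "X \<subseteq> L" and "A \<inter> X = {}"
    and I: "connected_from E w I" "I \<subseteq> V'" "V' \<subseteq> V"
      "\<And>v. v \<in> I - {w} \<Longrightarrow> \<exists>a\<in>V'. \<exists>b\<in>V'. a \<noteq> b \<and> {v, a} \<in> E \<and> {v, b} \<in> E"
    and "S \<subseteq> V'"
    and "card (slice 0 - (A \<union> X)) = 2 * s" and "2 * s \<le> card (I - S)"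
    and "\<And>z. z \<in> two_layers g \<Longrightarrow> card (jumps g z \<inter> (A \<union> X)) \<le> c"
    and "c + s + 2 * (card S + 2 * s) < nat (p - 1)"
  shows "\<exists>S' \<phi>' A'. partial_emb S' \<phi>' A' \<and> S \<subseteq> S' \<and> S' \<subseteq> V' \<and> A' \<inter> X = {} \<and>
           slice 0 \<subseteq> A' \<union> X \<and> \<phi>' ` S' \<subseteq> two_layers g \<and> card S' = card S + 2 * s \<and>
           card (S' - I) \<le> card (S - I) + s \<and> A' \<subseteq> A \<union> slice 0 \<union> diff_class g"
  using assms(1,2,7,12-16)
proof (induction s arbitrary: S \<phi> A c)
  case 0
  have "slice 0 \<subseteq> A \<union> X" using 0 by simp
  thus ?case using 0 by (intro exI[of _ S] exI[of _ \<phi>] exI[of _ A]) auto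
next
  case (Suc s)
  have facts: "connected_from E w S" "S \<subseteq> V" "finite S" "\<phi> ` S \<subseteq> L" "A \<subseteq> L"
    "\<And>d. d \<in> A \<Longrightarrow> neg d \<in> A"
    using partial_emb_facts[OF Suc.prems(1)] by auto
  have wS: "w \<in> S" using facts(1) by (simp add: connected_from_def)
  have "I - S \<noteq> {}" using Suc.prems(6) by (intro notI) simp
  then obtain u v where uv: "u \<in> S" "v \<in> I - S" "{u, v} \<in> E"
    using connected_from_boundary[OF connected_from_Un[OF facts(1) I(1)] wS] by blast
  have v: "v \<notin> S" "v \<in> V'" "v \<noteq> w" "v \<in> V" using uv(2) wS I by auto
  \<comment> \<open>Only one of the two neighbours of \<open>v\<close> can lie in the connected set
    \<open>S\<close>, as \<open>v\<close> itself does not.\<close>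
  have "\<exists>x\<in>V'. {v, x} \<in> E \<and> x \<notin> S"
    using I(4)[of v] uv(2) v tree_unique_neighbour[OF tree facts(1) v(1)]
    by (metis DiffD1 DiffI insert_commute singletonD)
  then obtain x where x: "x \<in> V'" "{v, x} \<in> E" "x \<notin> S" by blast
  have xv: "x \<noteq> v" using edge_ne[OF x(2)] by simp
  have "slice 0 - (A \<union> X) \<noteq> {}" using Suc.prems(5) by force
  then obtain d0 where d0: "d0 \<in> slice 0" "d0 \<notin> A \<union> X" by blast
  have d0L: "d0 \<in> L" "d0 \<noteq> (0, 0)" "snd d0 = 0"
    using d0(1) slice_subset[of 0] r_pos by (auto simp: slice_def)
  have z: "\<phi> u \<in> two_layers g" "\<phi> u \<in> L" using uv(1) Suc.prems(2) facts(4) by auto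
  note jf = jumps_facts[OF g z(1)]
  \<comment> \<open>The second set forbids every \<open>y\<close> whose displacement by
    \<open>d0\<close> is occupied, so a single choice of \<open>d\<close> secures both new
    positions.\<close>
  define Occ where "Occ = \<phi> ` S \<union> (\<lambda>y. sub y d0) ` \<phi> ` S"
  have "card Occ \<le> card (\<phi> ` S) + card ((\<lambda>y. sub y d0) ` \<phi> ` S)"
    unfolding Occ_def by (rule card_Un_le)
  also have "\<dots> \<le> card S + card S"
    by (intro add_mono card_image_le order_trans[OF card_image_le card_image_le] finite_imageI facts(3))
  finally have "card Occ \<le> 2 * card S" by simp
  hence "card (jumps g (\<phi> u) \<inter> (A \<union> X)) + card Occ < card (jumps g (\<phi> u))"
  proof -
    have "c + 2 * card S < nat (p - 1)" by (rule le_less_trans[OF _ Suc.prems(8)]) simp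
    thus ?thesis unfolding jf(2)
      by (rule le_less_trans[rotated]) (intro add_mono Suc.prems(7) z(1) \<open>card Occ \<le> 2 * card S\<close>)
  qed
  moreover have "finite Occ" using facts(3) by (simp add: Occ_def)
  ultimately obtain d where d: "d \<in> jumps g (\<phi> u)" "d \<notin> A \<union> X" "add (\<phi> u) d \<notin> Occ"
    using choose_difference[OF jf(1), of Occ "A \<union> X" "\<phi> u"] by blast
  have dL: "d \<in> L" using d(1) jf(1) by blast
  have dc: "d \<in> diff_class g" "neg d \<in> diff_class g" using jf(3)[OF d(1)] by auto
  have cls0: "diff_class g \<inter> slice 0 = {}" using g by (auto simp: diff_class_def slice_def)
  define y where "y = add (\<phi> u) d"
  define y' where "y' = add y d0"
  have sy: "sub y (\<phi> u) = d" "sub (\<phi> u) y = neg d"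
    unfolding y_def using dL sub_add[OF dL, of "\<phi> u"] neg_sub[of "add (\<phi> u) d" "\<phi> u"] by simp_all
  have sy': "sub y' y = d0" "sub y y' = neg d0"
    unfolding y'_def using d0L sub_add[of d0 y] neg_sub[of "add y d0" y] by simp_all
  have yL: "y \<in> L" "y' \<in> L" by (simp_all add: y_def y'_def)
  have yy': "y' \<noteq> y" using sy' d0L(2) sub_self by metis
  have y'S: "y' \<notin> \<phi> ` S"
  proof
    assume "y' \<in> \<phi> ` S"
    hence "sub y' d0 \<in> Occ" by (auto simp: Occ_def)
    moreover have "sub y' d0 = y" unfolding y'_def using yL(1) by (subst add_commute) simp
    ultimately show False using d(3) y_def by simp
  qed
  let ?S1 = "insert v S" and ?f1 = "\<phi>(v := y)" and ?A1 = "insert d (insert (neg d) A)"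
  have st1: "partial_emb ?S1 ?f1 ?A1"
    using partial_emb.step[OF Suc.prems(1) uv(1) _ uv(3), of y] v d(2,3) sy yL
    by (auto simp: y_def Occ_def)
  let ?S2 = "insert x ?S1" and ?f2 = "?f1(x := y')" and ?A2 = "insert d0 (insert (neg d0) ?A1)"
  have d0A1: "d0 \<notin> ?A1" using d0 dc cls0 by auto
  have f1S: "y' \<notin> ?f1 ` ?S1" using y'S yy' v(1) by auto
  have st2: "partial_emb ?S2 ?f2 ?A2"
    using partial_emb.step[OF st1, of v x y'] x xv I(3) yL f1S d0A1 sy' by auto
  have c2: "card ?S2 = card S + 2" using x(3) xv v(1) facts(3) by simp
  have lay: "?f2 ` ?S2 \<subseteq> two_layers g"
  proof -
    have "y \<in> two_layers g" using jf(3)[OF d(1)] by (simp add: y_def)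
    moreover from this have "y' \<in> two_layers g"
      using d0L(3) g p_pos by (auto simp: y'_def two_layers_def add_def)
    ultimately show ?thesis using Suc.prems(2) by auto
  qed
  have AX: "?A2 \<inter> X = {}" using Suc.prems(3) d(2) d0(2) X(1)[of "neg d"] X(1)[of "neg d0"] dL d0L by auto
  have n0: "neg d0 \<in> slice 0" "neg d0 \<noteq> d0" "neg d0 \<notin> A \<union> X"
    using neg_slice_0[OF d0(1)] neg_ne_self[OF d0L(1,2)] d0(2) X(1)[of "neg d0"] facts(6)[of "neg d0"] d0L(1)
    by auto
  have "slice 0 - (?A2 \<union> X) = (slice 0 - (A \<union> X)) - {d0, neg d0}"
    using dc cls0 by auto
  hence rem: "card (slice 0 - (?A2 \<union> X)) = 2 * s"
    using Suc.prems(5) d0 n0 by (simp add: card_Diff_subset)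
  have "card (I - S) \<le> card ((I - ?S2) \<union> {v, x})"
    using I finite_V by (intro card_mono) (auto intro: finite_subset)
  also have "\<dots> \<le> card (I - ?S2) + 2"
    using card_Un_le[of "I - ?S2" "{v, x}"] card_insert_le_m1[of 2 "{x}" v] by (simp add: card_insert_if split: if_splits)
  finally have Irem: "2 * s \<le> card (I - ?S2)" using Suc.prems(6) by simp
  have bnd: "card (jumps g z \<inter> (?A2 \<union> X)) \<le> c + 1" if zz: "z \<in> two_layers g" for z
  proof -
    have "jumps g z \<inter> slice 0 = {}" using g by (auto simp: jumps_def slice_def split: if_splits)
    hence eq: "jumps g z \<inter> (?A2 \<union> X) = (jumps g z \<inter> (A \<union> X)) \<union> (jumps g z \<inter> {d, neg d})"
      using d0(1) n0(1) by blast
    have "card (jumps g z \<inter> (?A2 \<union> X)) \<le> card (jumps g z \<inter> (A \<union> X)) + card (jumps g z \<inter> {d, neg d})"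
      unfolding eq by (rule card_Un_le)
    also have "\<dots> \<le> c + 1" by (intro add_mono Suc.prems(7)[OF zz] jumps_facts(4)[OF g zz])
    finally show ?thesis .
  qed
  have "\<exists>S' \<phi>' A'. partial_emb S' \<phi>' A' \<and> ?S2 \<subseteq> S' \<and> S' \<subseteq> V' \<and> A' \<inter> X = {} \<and>
           slice 0 \<subseteq> A' \<union> X \<and> \<phi>' ` S' \<subseteq> two_layers g \<and> card S' = card ?S2 + 2 * s \<and>
           card (S' - I) \<le> card (?S2 - I) + s \<and> A' \<subseteq> ?A2 \<union> slice 0 \<union> diff_class g"
    by (rule Suc.IH[OF st2 lay AX _ rem Irem bnd]) (use v x Suc.prems c2 in auto)
  then obtain S' \<phi>' A' where R: "partial_emb S' \<phi>' A'" "?S2 \<subseteq> S'" "S' \<subseteq> V'" "A' \<inter> X = {}"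
    "slice 0 \<subseteq> A' \<union> X" "\<phi>' ` S' \<subseteq> two_layers g" "card S' = card ?S2 + 2 * s"
    "card (S' - I) \<le> card (?S2 - I) + s" "A' \<subseteq> ?A2 \<union> slice 0 \<union> diff_class g" by blast
  \<comment> \<open>As \<open>v\<close> is in \<open>I\<close>, only \<open>x\<close> can add to the
    part outside \<open>I\<close>. This keeps the union with \<open>I\<close> small when the set is
    extended later.\<close>
  have "?S2 - I \<subseteq> insert x (S - I)" using uv(2) by blast
  hence "card (?S2 - I) \<le> card (insert x (S - I))" using facts(3) by (intro card_mono) auto
  hence i: "card (?S2 - I) \<le> card (S - I) + 1" using card_insert_le_m1[of _ "S - I" x] facts(3)
    by (simp add: card_insert_if split: if_splits)
  have s1: "card S' = card S + 2 * Suc s" using R(7) c2 by simp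
  have s2: "card (S' - I) \<le> card (S - I) + Suc s" using R(8) i by linarith
  have s3: "A' \<subseteq> A \<union> slice 0 \<union> diff_class g" using R(9) dc d0(1) n0(1) by blast
  have s4: "S \<subseteq> S'" using R(2) by blast
  show ?case using R(1,3-6) s1 s2 s3 s4 by blast
qed

end

section \<open>Using up the remaining differences exactly\<close>

lemma sorted_enumeration:
  fixes x :: "'a \<Rightarrow> int"
  assumes "finite Q"
  obtains q where "bij_betw q {..<card Q} Q" "\<And>i j. \<lbrakk>i \<le> j; j < card Q\<rbrakk> \<Longrightarrow> x (q i) \<le> x (q j)"
proof -
  obtain xs where xs: "set xs = Q" "distinct xs" using assms finite_distinct_list by blast
  define ys where "ys = sort_key x xs"
  have ys: "set ys = Q" "distinct ys" "sorted (map x ys)" "length ys = card Q"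
    using xs by (auto simp: ys_def distinct_card)
  show ?thesis
  proof (rule that[of "\<lambda>i. ys ! i"])
    show "bij_betw ((!) ys) {..<card Q} Q" using bij_betw_nth[OF ys(2)] ys by metis
    show "x (ys ! i) \<le> x (ys ! j)" if "i \<le> j" "j < card Q" for i j
      using sorted_nth_mono[OF ys(3), of i j] that ys(4) by simp
  qed
qed

text \<open>Matching both sequences in increasing order makes the sums increase; the sums below \<open>p\<close> are kept.
  The remaining sums are at least \<open>p\<close>, so the tails have total spread less than \<open>p\<close>, and matching the
  tails in opposite order makes the differences increase within an interval of length less than \<open>p\<close>.\<close>

lemma absorbing_assignment:
  fixes x :: "'a \<Rightarrow> int" and p :: int
  assumes "finite Q" "finite R" "card Q = card R" "R \<subseteq> {1..<p}" "\<And>v. v \<in> Q \<Longrightarrow> 0 \<le> x v \<and> x v < p"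
  obtains d \<sigma> where "bij_betw d Q R" "inj_on (\<lambda>v. (x v + d v) mod p) {v \<in> Q. \<sigma> v}"
    "inj_on (\<lambda>v. (x v - d v) mod p) {v \<in> Q. \<not> \<sigma> v}"
proof -
  define n where "n = card Q"
  obtain q where q: "bij_betw q {..<n} Q" "\<And>i j. \<lbrakk>i \<le> j; j < n\<rbrakk> \<Longrightarrow> x (q i) \<le> x (q j)"
    using sorted_enumeration[OF assms(1), of x] n_def by metis
  obtain e where e: "bij_betw e {..<n} R" "\<And>i j. \<lbrakk>i \<le> j; j < n\<rbrakk> \<Longrightarrow> e i \<le> e j"
    using sorted_enumeration[OF assms(2), of "\<lambda>z. z"] n_def assms(3) by metis
  have e_less: "e i < e j" if "i < j" "j < n" for i j
  proof -
    have "e i \<noteq> e j" using bij_betw_imp_inj_on[OF e(1)] that by (auto simp: inj_on_def)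
    thus ?thesis using e(2)[of i j] that by simp
  qed
  have xb: "0 \<le> x (q i)" "x (q i) < p" if "i < n" for i
    using assms(5)[of "q i"] bij_betwE[OF q(1)] that by auto
  have eb: "1 \<le> e i" "e i < p" if "i < n" for i
  proof -
    have "e i \<in> {1..<p}" using assms(4) bij_betwE[OF e(1)] that by blast
    thus "1 \<le> e i" "e i < p" by auto
  qed
  \<comment> \<open>Both sequences increase, so the indices with sum below \<open>p\<close> form an
    initial segment, of length \<open>N\<close>.\<close>
  define N where "N = card {i. i < n \<and> x (q i) + e i < p}"
  have down: "x (q i) + e i < p" if "i \<le> j" "j < n" "x (q j) + e j < p" for i j
    using q(2)[OF that(1,2)] e(2)[OF that(1,2)] that(3) by linarith
  have low: "i < N \<longleftrightarrow> x (q i) + e i < p" if "i < n" for i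
  proof
    assume "i < N"
    show "x (q i) + e i < p"
    proof (rule ccontr)
      assume "\<not> x (q i) + e i < p"
      hence "j < i" if "j < n" "x (q j) + e j < p" for j
        using down[of i j] that by (cases "j < i") auto
      hence "{j. j < n \<and> x (q j) + e j < p} \<subseteq> {..<i}" by blast
      hence "N \<le> card {..<i}" unfolding N_def by (intro card_mono) auto
      thus False using \<open>i < N\<close> by simp
    qed
  next
    assume "x (q i) + e i < p"
    hence "{..i} \<subseteq> {j. j < n \<and> x (q j) + e j < p}" using down[of _ i] that by auto
    hence "card {..i} \<le> N" unfolding N_def by (intro card_mono) auto
    thus "i < N" by simp
  qed
  have Nn: "N \<le> n" unfolding N_def using card_mono[of "{..<n}" "{i. i < n \<and> x (q i) + e i < p}"] by auto
  \<comment> \<open>The identity below \<open>N\<close> and a reversal from \<open>N\<close> on. It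
    is an involution, which makes it its own witness for bijectivity.\<close>
  define h where "h i = (if i < N then i else n - 1 - (i - N))" for i
  have h: "bij_betw h {..<n} {..<n}"
    by (rule bij_betw_byWitness[of _ h]) (use Nn in \<open>auto simp: h_def\<close>)
  define qi where "qi = inv_into {..<n} q"
  have qi: "bij_betw qi Q {..<n}" unfolding qi_def using q(1) by (rule bij_betw_inv_into)
  have qqi: "q (qi v) = v" if "v \<in> Q" for v
    unfolding qi_def using q(1) that by (simp add: bij_betw_inv_into_right)
  have qin: "qi v < n" if "v \<in> Q" for v using bij_betwE[OF qi] that by auto
  define d where "d v = e (h (qi v))" for v
  have d: "bij_betw d Q R"
    unfolding d_def using bij_betw_trans[OF bij_betw_trans[OF qi h] e(1)] by (simp add: comp_def)
  have plus: "x (q i) + e (h i) < x (q j) + e (h j) \<and> x (q j) + e (h j) < p" if "i < j" "j < N" for i j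
    using that Nn q(2)[of i j] e_less[of i j] low[of j] by (auto simp: h_def)
  have minus: "x (q i) - e (h i) < x (q j) - e (h j) \<and> x (q j) - e (h j) < x (q i) - e (h i) + p"
    if "N \<le> i" "i < j" "j < n" for i j
  proof -
    have hj: "h j < h i" "h i < n" "h i = n - 1 - (i - N)" "h j = n - 1 - (j - N)" "N \<le> h j"
      using that by (auto simp: h_def)
    have a: "x (q i) \<le> x (q j)" "e (h j) < e (h i)" using q(2)[of i j] that e_less[OF hj(1,2)] by auto
    have "x (q N) + e N \<ge> p" using low[of N] that by simp
    moreover have "x (q N) \<le> x (q i)" "e N \<le> e (h j)"
      using q(2)[of N i] that e(2)[of N "h j"] hj by auto
    moreover have "x (q j) < p" "e (h i) < p" using xb[of j] that eb[of "h i"] hj by auto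
    ultimately show ?thesis using a by linarith
  qed
  show thesis
  proof (rule that[OF d, of "\<lambda>v. qi v < N"])
    show "inj_on (\<lambda>v. (x v + d v) mod p) {v \<in> Q. qi v < N}"
    proof (rule inj_onI)
      fix v v' assume h: "v \<in> {v \<in> Q. qi v < N}" "v' \<in> {v \<in> Q. qi v < N}"
        "(x v + d v) mod p = (x v' + d v') mod p"
      have b: "0 \<le> x (q i) + e (h i) \<and> x (q i) + e (h i) < p" if "i < N" for i
        using low[of i] xb[of i] eb[of i] that Nn by (auto simp: h_def)
      have "x v + d v = x v' + d v'"
        using h b[of "qi v"] b[of "qi v'"] qqi by (auto simp: d_def)
      hence "\<not> qi v < qi v'" "\<not> qi v' < qi v"
        using plus[of "qi v" "qi v'"] plus[of "qi v'" "qi v"] h qqi by (auto simp: d_def)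
      hence "qi v = qi v'" by simp
      moreover have "q (qi v) = v" "q (qi v') = v'" using qqi h(1,2) by blast+
      ultimately show "v = v'" by metis
    qed
    show "inj_on (\<lambda>v. (x v - d v) mod p) {v \<in> Q. \<not> qi v < N}"
    proof (rule inj_onI)
      fix v v' assume h: "v \<in> {v \<in> Q. \<not> qi v < N}" "v' \<in> {v \<in> Q. \<not> qi v < N}"
        "(x v - d v) mod p = (x v' - d v') mod p"
      have dv: "p dvd (x v - d v) - (x v' - d v')" using h(3) by (simp add: mod_eq_dvd_iff)
      have no: "\<not> (p dvd b - a)" if "a < b" "b < a + p" for a b :: int
        using that zdvd_not_zless[of "b - a" p] by auto
      have "\<not> qi v < qi v'"
      proof
        assume "qi v < qi v'"
        hence "\<not> p dvd (x v' - d v') - (x v - d v)"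
          using minus[of "qi v" "qi v'"] h qqi qin[of v'] by (intro no) (auto simp: d_def)
        thus False using dv by (simp add: dvd_diff_commute)
      qed
      moreover have "\<not> qi v' < qi v"
      proof
        assume "qi v' < qi v"
        hence "\<not> p dvd (x v - d v) - (x v' - d v')"
          using minus[of "qi v'" "qi v"] h qqi qin[of v] by (intro no) (auto simp: d_def)
        thus False using dv by simp
      qed
      ultimately have "qi v = qi v'" by simp
      moreover have "q (qi v) = v" "q (qi v') = v'" using qqi h(1,2) by blast+
      ultimately show "v = v'" by metis
    qed
  qed
qed

context tree_grid begin

text \<open>Here the differences are prescribed in advance instead of being chosen greedily. All
  parents lie in \<open>S\<close>, so the leaves can be added in any order.\<close>

lemma attach_leaves:
  assumes "partial_emb S \<phi> A" "finite Q" "Q \<subseteq> V - S"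
    and "\<And>v. v \<in> Q \<Longrightarrow> par v \<in> S \<and> {par v, v} \<in> E"
    and "\<And>v. v \<in> Q \<Longrightarrow> \<delta> v \<in> L \<and> \<delta> v \<notin> A \<and> add (\<phi> (par v)) (\<delta> v) \<notin> \<phi> ` S"
    and "inj_on (\<lambda>v. add (\<phi> (par v)) (\<delta> v)) Q"
    and "\<And>v v'. \<lbrakk>v \<in> Q; v' \<in> Q; v \<noteq> v'\<rbrakk> \<Longrightarrow> \<delta> v' \<noteq> \<delta> v \<and> \<delta> v' \<noteq> neg (\<delta> v)"
  shows "partial_emb (S \<union> Q) (\<lambda>v. if v \<in> Q then add (\<phi> (par v)) (\<delta> v) else \<phi> v)
           (A \<union> (\<Union>v\<in>Q. {\<delta> v, neg (\<delta> v)}))"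
  using assms(2-7)
proof (induction Q rule: finite_induct)
  case empty
  show ?case using assms(1) by simp
next
  case (insert v Q)
  let ?y = "\<lambda>v. add (\<phi> (par v)) (\<delta> v)"
  let ?f = "\<lambda>v. if v \<in> Q then ?y v else \<phi> v" and ?A = "A \<union> (\<Union>v\<in>Q. {\<delta> v, neg (\<delta> v)})"
  have st: "partial_emb (S \<union> Q) ?f ?A"
    by (rule insert.IH) (use insert.prems in \<open>auto simp: inj_on_def\<close>)
  have pv: "par v \<in> S" "{par v, v} \<in> E" "\<delta> v \<in> L" "\<delta> v \<notin> A" "?y v \<notin> \<phi> ` S"
    using insert.prems(2,3)[of v] by auto
  have pQ: "par v \<notin> Q" using pv(1) insert.prems(1) by blast
  have fp: "?f (par v) = \<phi> (par v)" using pQ by simp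
  have sd: "sub (?y v) (\<phi> (par v)) = \<delta> v" "sub (\<phi> (par v)) (?y v) = neg (\<delta> v)"
    using pv(3) sub_add[of "\<delta> v" "\<phi> (par v)"] neg_sub[of "?y v" "\<phi> (par v)"] by simp_all
  have "?y v \<notin> ?f ` (S \<union> Q)"
    using pv(5) insert.prems(4) insert.hyps(2) by (auto simp: inj_on_def)
  moreover have "\<delta> v \<notin> ?A"
    using pv(4) insert.prems(5)[of _ v] insert.hyps(2) by auto
  ultimately have "partial_emb (insert v (S \<union> Q)) (?f(v := ?y v)) (insert (\<delta> v) (insert (neg (\<delta> v)) ?A))"
    using partial_emb.step[OF st, of "par v" v "?y v"] pv insert.prems(1) insert.hyps(2) sd fp by auto
  moreover have "?f(v := ?y v) = (\<lambda>u. if u \<in> insert v Q then ?y u else \<phi> u)" by auto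
  moreover have "insert (\<delta> v) (insert (neg (\<delta> v)) ?A) = A \<union> (\<Union>v\<in>insert v Q. {\<delta> v, neg (\<delta> v)})" by auto
  moreover have "insert v (S \<union> Q) = S \<union> insert v Q" by auto
  ultimately show ?case by (simp only:)
qed

end

section \<open>A family of embeddings covering all differences\<close>

text \<open>\<open>V'\<close> stands for the tree without the removed leaf and \<open>w\<close> for
  the neighbour of that leaf; every embedding sends \<open>w\<close> to the origin.\<close>

locale odd_tree_grid = tree_grid p r V E w for p r :: int and V :: "'a set" and E w +
  fixes q :: int and V' :: "'a set"
  assumes q: "r = 2 * q + 1" "q > 0"
    and V': "V' \<subseteq> V" "connected_from E w V'"
begin

lemma qr: "q < r" "2 * q < r" "r < 2 * q + 2" "0 < q" using q by auto

definition nonzero_diffs :: "(int \<times> int) set" where "nonzero_diffs = {1..<p} \<times> {0..<r}"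
definition pos_diffs :: "(int \<times> int) set" where "pos_diffs = {1..<p} \<times> {1..q}"
definition neg_diffs :: "(int \<times> int) set" where "neg_diffs = {1..<p} \<times> {q+1..<r}"

lemma nonzero_diffs_split: "nonzero_diffs = slice 0 \<union> (pos_diffs \<union> neg_diffs)"
  using qr by (auto simp: nonzero_diffs_def slice_def pos_diffs_def neg_diffs_def)

lemma nonzero_diffs_facts: "finite nonzero_diffs" "nonzero_diffs \<subseteq> L" "finite V'"
  "pos_diffs \<subseteq> L" "neg_diffs \<subseteq> L" "finite pos_diffs" "finite neg_diffs"
  using qr finite_subset[OF V'(1) finite_V]
  by (auto simp: nonzero_diffs_def pos_diffs_def neg_diffs_def L_def)

lemma neg_pos_diffs: "d \<in> pos_diffs \<Longrightarrow> neg d \<in> neg_diffs"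
  using qr by (auto simp: pos_diffs_def neg_diffs_def neg_def mod_minus_pos)

lemma neg_neg_diffs: "d \<in> neg_diffs \<Longrightarrow> neg d \<in> pos_diffs"
  using qr by (auto simp: pos_diffs_def neg_diffs_def neg_def mod_minus_pos)

lemma neg_nonzero_diffs: "d \<in> nonzero_diffs \<Longrightarrow> neg d \<in> nonzero_diffs"
  using neg_pos_diffs[of d] neg_neg_diffs[of d] neg_slice_0[of d] by (auto simp: nonzero_diffs_split)

lemma card_unused:
  assumes "U \<subseteq> nonzero_diffs" "\<And>d. d \<in> U \<Longrightarrow> neg d \<in> U" "slice 0 \<subseteq> U"
  shows "2 * card (pos_diffs - U) + card U = card nonzero_diffs"
    "2 * card (neg_diffs - U) + card U = card nonzero_diffs"
proof -
  have UL: "d \<in> L" if "d \<in> U" for d using assms(1) nonzero_diffs_facts(2) that by blast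
  have "bij_betw neg (pos_diffs - U) (neg_diffs - U)"
  proof (rule bij_betw_byWitness[of _ neg])
    have *: "d \<in> U" if "neg d \<in> U" "d \<in> L" for d using assms(2)[OF that(1)] that(2) by simp
    show "neg ` (pos_diffs - U) \<subseteq> neg_diffs - U" "neg ` (neg_diffs - U) \<subseteq> pos_diffs - U"
      using neg_pos_diffs neg_neg_diffs * nonzero_diffs_facts(4,5) by blast+
    show "\<forall>a\<in>pos_diffs - U. neg (neg a) = a" "\<forall>a\<in>neg_diffs - U. neg (neg a) = a"
      using nonzero_diffs_facts(4,5) neg_neg by blast+
  qed
  hence eq: "card (pos_diffs - U) = card (neg_diffs - U)" by (rule bij_betw_same_card)
  have "nonzero_diffs = U \<union> ((pos_diffs - U) \<union> (neg_diffs - U))"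
    using assms(1,3) nonzero_diffs_split by blast
  moreover have disj: "pos_diffs \<inter> neg_diffs = {}" by (auto simp: pos_diffs_def neg_diffs_def)
  moreover have "finite U" using assms(1) nonzero_diffs_facts(1) finite_subset by blast
  ultimately have "card nonzero_diffs = card U + card ((pos_diffs - U) \<union> (neg_diffs - U))"
    using nonzero_diffs_facts(6,7) by (simp add: card_Un_disjoint Int_Un_distrib)
  moreover have "card ((pos_diffs - U) \<union> (neg_diffs - U)) = card (pos_diffs - U) + card (neg_diffs - U)"
    using nonzero_diffs_facts(6,7) disj by (intro card_Un_disjoint) auto
  ultimately have "card nonzero_diffs = card U + (card (pos_diffs - U) + card (neg_diffs - U))" by simp
  with eq show "2 * card (pos_diffs - U) + card U = card nonzero_diffs"
    "2 * card (neg_diffs - U) + card U = card nonzero_diffs" by linarith+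
qed

lemma leaf_phase:
  assumes "partial_emb S \<phi> A" and "S0 \<subseteq> S" "S \<subseteq> V'" and g: "0 < g" "g \<le> q"
    and "\<phi> ` S0 \<subseteq> two_layers g" and lv: "\<And>v. v \<in> V' - S0 \<Longrightarrow> \<exists>u\<in>S0. {u, v} \<in> E"
    and X: "\<And>d. d \<in> X \<Longrightarrow> neg d \<in> X" "X \<subseteq> nonzero_diffs" and "A \<inter> X = {}" "A \<subseteq> nonzero_diffs"
    and "slice 0 \<subseteq> A \<union> X"
    and num: "2 * card V' + card X + 2 * card (V' - S0) \<le> card nonzero_diffs + 4"
    and "\<phi> ` (S - S0) \<inter> two_layers g = {}"
  shows "\<exists>\<phi>' A'. partial_emb V' \<phi>' A' \<and> A \<subseteq> A' \<and> A' \<inter> X = {} \<and> A' \<subseteq> nonzero_diffs \<and>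
           (\<forall>v\<in>S. \<phi>' v = \<phi> v) \<and> \<phi>' ` (V' - S) \<inter> two_layers g = {}"
  using assms(1-3,6,10-12,14)
proof (induction "card V' - card S" arbitrary: S \<phi> A)
  case 0
  have "S = V'" using 0 nonzero_diffs_facts(3) by (metis card_seteq diff_is_0_eq)
  thus ?case using 0 by blast
next
  case (Suc n)
  have fV: "finite V'" by (rule nonzero_diffs_facts)
  have facts: "finite S" "\<phi> ` S \<subseteq> L" "A \<subseteq> L" "\<And>d. d \<in> A \<Longrightarrow> neg d \<in> A" "card A + 2 = 2 * card S"
    using partial_emb_facts[OF Suc.prems(1)] by auto
  have "S \<noteq> V'" using Suc.hyps(2) by auto
  then obtain v where v: "v \<in> V'" "v \<notin> S" using Suc.prems(3) by blast
  then obtain u where u: "u \<in> S0" "{u, v} \<in> E" using lv[of v] Suc.prems(2) by blast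
  have uS: "u \<in> S" using u Suc.prems(2) by blast
  have z: "\<phi> u \<in> two_layers g" "\<phi> u \<in> L" using u uS Suc.prems(4) facts(2) by auto
  define U where "U = A \<union> X"
  define K where "K = (if snd (\<phi> u) = 0 then neg_diffs else pos_diffs)"
  have K: "K \<subseteq> L" "finite K" "K \<subseteq> nonzero_diffs"
    using nonzero_diffs_facts nonzero_diffs_split by (auto simp: K_def)
  have U: "U \<subseteq> nonzero_diffs" "\<And>d. d \<in> U \<Longrightarrow> neg d \<in> U" "slice 0 \<subseteq> U"
    using Suc.prems(6,7) X facts(4) by (auto simp: U_def)
  have "2 * card (K - U) + card U = card nonzero_diffs" using card_unused[OF U] by (simp add: K_def)
  moreover have "card U \<le> card A + card X" unfolding U_def by (rule card_Un_le)
  ultimately have unused: "2 * card (K - U) + card A + card X \<ge> card nonzero_diffs" by linarith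
  have "card S + 1 \<le> card V'"
    using v Suc.prems(3) fV by (metis Suc_eq_plus1 Suc_leI psubsetI psubset_card_mono)
  moreover have "card (S - S0) + 1 \<le> card (V' - S0)"
  proof -
    have "card (insert v (S - S0)) \<le> card (V' - S0)"
      using v Suc.prems(2,3) fV by (intro card_mono) auto
    thus ?thesis using v facts(1) by simp
  qed
  \<comment> \<open>The hypothesis \<open>num\<close> describes the worst case, the moment before
    the last leaf is placed.\<close>
  ultimately have lt: "card (S - S0) < card (K - U)" using unused num facts(5) by linarith
  have "card (\<phi> ` (S - S0)) \<le> card (S - S0)" using facts(1) by (intro card_image_le) auto
  hence cnt: "card ((K - U) \<inter> {}) + card (\<phi> ` (S - S0)) < card (K - U)" using lt by simp
  have KU: "K - U \<subseteq> L" "finite (\<phi> ` (S - S0))" using K facts(1) by auto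
  obtain d where d: "d \<in> K - U" "add (\<phi> u) d \<notin> \<phi> ` (S - S0)"
    using choose_difference[OF KU cnt, of "\<phi> u"] by metis
  have dL: "d \<in> L" using d K by blast
  define y where "y = add (\<phi> u) d"
  have sy: "sub y (\<phi> u) = d" "sub (\<phi> u) y = neg d"
    unfolding y_def using dL sub_add[OF dL, of "\<phi> u"] neg_sub[of "add (\<phi> u) d" "\<phi> u"] by simp_all
  have y2: "y \<notin> two_layers g"
  proof -
    have zs: "snd (\<phi> u) = 0 \<or> snd (\<phi> u) = g" using z(1) by (auto simp: two_layers_def)
    have ds: "if snd (\<phi> u) = 0 then q < snd d \<and> snd d < r else 0 < snd d \<and> snd d \<le> q"
      using d(1) by (auto simp: K_def pos_diffs_def neg_diffs_def)
    have "snd y = (snd (\<phi> u) + snd d) mod r" by (simp add: y_def add_def)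
    also have "\<dots> = snd (\<phi> u) + snd d"
      using zs ds g qr by (intro mod_pos_pos_trivial) (auto split: if_splits)
    finally show ?thesis using zs ds g by (auto simp: two_layers_def split: if_splits)
  qed
  have yS: "y \<notin> \<phi> ` S" using y2 d(2) Suc.prems(2,4) by (auto simp: y_def)
  have dU: "d \<notin> A" "d \<notin> X" "neg d \<notin> X" using d(1) X(1)[of "neg d"] dL by (auto simp: U_def)
  have dn: "d \<in> nonzero_diffs" "neg d \<in> nonzero_diffs" using d K neg_nonzero_diffs by blast+
  let ?S = "insert v S" and ?f = "\<phi>(v := y)" and ?A = "insert d (insert (neg d) A)"
  have st: "partial_emb ?S ?f ?A"
    using partial_emb.step[OF Suc.prems(1) uS _ u(2), of y] v V'(1) yS sy dU by (auto simp: y_def)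
  have n: "n = card V' - card ?S" using Suc.hyps(2) v facts(1) by simp
  have vS0: "v \<notin> S0" using v(2) Suc.prems(2) by blast
  have "\<exists>\<phi>' A'. partial_emb V' \<phi>' A' \<and> ?A \<subseteq> A' \<and> A' \<inter> X = {} \<and> A' \<subseteq> nonzero_diffs \<and>
           (\<forall>v\<in>?S. \<phi>' v = ?f v) \<and> \<phi>' ` (V' - ?S) \<inter> two_layers g = {}"
  proof (rule Suc.hyps(1)[OF n st])
    show "?f ` S0 \<subseteq> two_layers g" using Suc.prems(4) vS0 by auto
    have sub: "?f ` (?S - S0) \<subseteq> insert y (\<phi> ` (S - S0))" by auto
    have "insert y (\<phi> ` (S - S0)) \<inter> two_layers g = {}" using y2 Suc.prems(8) by simp
    thus "?f ` (?S - S0) \<inter> two_layers g = {}"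
      using Int_mono[OF sub order_refl[of "two_layers g"]] by (metis subset_empty)
  qed (use Suc.prems v dU dn in auto)
  then obtain \<phi>' A' where R: "partial_emb V' \<phi>' A'" "?A \<subseteq> A'" "A' \<inter> X = {}" "A' \<subseteq> nonzero_diffs"
    "\<forall>v\<in>?S. \<phi>' v = ?f v" "\<phi>' ` (V' - ?S) \<inter> two_layers g = {}" by blast
  have "\<phi>' v = y" using R(5) by simp
  hence "\<phi>' ` (V' - S) \<subseteq> insert y (\<phi>' ` (V' - ?S))" by auto
  hence "\<phi>' ` (V' - S) \<inter> two_layers g = {}" using R(6) y2 by blast
  moreover have "\<forall>a\<in>S. \<phi>' a = \<phi> a" using R(5) v(2) by auto
  moreover have "A \<subseteq> A'" using R(2) by blast
  ultimately show ?case using R(1,3,4) by blast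
qed

end

lemma mod_add_diff: "(a + (k - b)) mod k = (a - b) mod k" for a b k :: int
proof -
  have "a + (k - b) = (a - b) + k" by simp
  thus ?thesis by (simp only: mod_add_self2)
qed

context odd_tree_grid begin

text \<open>All parents are in layer 0, so a leaf with difference \<open>\<plusminus>(d, k)\<close>
  lands in layer \<open>k\<close> or \<open>r - k\<close> according to the sign. Leaves with
  different \<open>k\<close> or different signs cannot collide, and for each fixed \<open>k\<close>
  the lemma \<open>absorbing_assignment\<close> distributes the available \<open>d\<close> and the
  signs.\<close>

lemma absorb_leaves:
  assumes st: "partial_emb S \<phi> A" and "S \<subseteq> V'" and lay: "\<phi> ` S \<subseteq> two_layers 0"
    and lv: "\<And>v. v \<in> V' - S \<Longrightarrow> \<exists>u\<in>S. {u, v} \<in> E"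
    and X: "\<And>d. d \<in> X \<Longrightarrow> neg d \<in> X" "X \<subseteq> nonzero_diffs" and "A \<inter> X = {}" "A \<subseteq> nonzero_diffs"
    and "slice 0 \<subseteq> A \<union> X"
    and num: "card A + card X + 2 * card (V' - S) = card nonzero_diffs"
  shows "\<exists>\<phi>' A'. partial_emb V' \<phi>' A' \<and> A' \<inter> X = {} \<and> A' \<subseteq> nonzero_diffs"
proof -
  have facts: "finite S" "\<phi> ` S \<subseteq> L" "A \<subseteq> L" "\<And>d. d \<in> A \<Longrightarrow> neg d \<in> A"
    using partial_emb_facts[OF st] by auto
  define Q where "Q = V' - S"
  define U where "U = A \<union> X"
  define R where "R = pos_diffs - U"
  have fQ: "finite Q" and fR: "finite R"
    unfolding Q_def R_def using nonzero_diffs_facts(3,6) by auto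
  have U: "U \<subseteq> nonzero_diffs" "\<And>d. d \<in> U \<Longrightarrow> neg d \<in> U" "slice 0 \<subseteq> U"
    using assms(8,9) X facts(4) by (auto simp: U_def)
  have fU: "finite A" "finite X" using assms(8) X(2) nonzero_diffs_facts(1) finite_subset by blast+
  have "card U = card A + card X"
    unfolding U_def using fU assms(7) by (rule card_Un_disjoint)
  hence "card R = card Q" using card_unused(1)[OF U] num unfolding R_def Q_def by linarith
  \<comment> \<open>Only the second coordinate of \<open>\<beta>\<close> matters: it splits
    \<open>Q\<close> into groups of the right sizes. Within a group the first coordinates are
    assigned anew.\<close>
  then obtain \<beta> where \<beta>: "bij_betw \<beta> Q R"
    using finite_same_card_bij[OF fQ fR] by auto
  obtain par where par: "par v \<in> S" "{par v, v} \<in> E" if "v \<in> Q" for v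
    using lv unfolding Q_def by metis
  define x where "x v = fst (\<phi> (par v))" for v
  have x: "\<phi> (par v) = (x v, 0)" "0 \<le> x v" "x v < p" if "v \<in> Q" for v
  proof -
    have "\<phi> (par v) \<in> two_layers 0" using par(1)[OF that] lay by blast
    thus "\<phi> (par v) = (x v, 0)" "0 \<le> x v" "x v < p" by (auto simp: two_layers_def x_def)
  qed
  define k where "k v = snd (\<beta> v)" for v
  have k: "1 \<le> k v" "k v \<le> q" if "v \<in> Q" for v
    using bij_betwE[OF \<beta>] that by (auto simp: R_def k_def pos_diffs_def)
  \<comment> \<open>One predicate for both objects, so that assignments and signs can be chosen for
    all \<open>h\<close> at once.\<close>
  define good where "good h z \<longleftrightarrow> bij_betw (fst z) {v \<in> Q. k v = h} {e. (e, h) \<in> R} \<and>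
           inj_on (\<lambda>v. (x v + fst z v) mod p) {v \<in> {v \<in> Q. k v = h}. snd z v} \<and>
           inj_on (\<lambda>v. (x v - fst z v) mod p) {v \<in> {v \<in> Q. k v = h}. \<not> snd z v}" for h z
  have "\<exists>z. good h z" for h
  proof -
    have bb: "bij_betw (\<lambda>v. fst (\<beta> v)) {v \<in> Q. k v = h} {e. (e, h) \<in> R}"
      unfolding bij_betw_def
    proof
      show "inj_on (\<lambda>v. fst (\<beta> v)) {v \<in> Q. k v = h}"
        using bij_betw_imp_inj_on[OF \<beta>] by (auto simp: inj_on_def k_def prod_eq_iff)
      show "(\<lambda>v. fst (\<beta> v)) ` {v \<in> Q. k v = h} = {e. (e, h) \<in> R}"
      proof (intro equalityI subsetI)
        fix e assume "e \<in> {e. (e, h) \<in> R}"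
        then obtain v where "v \<in> Q" "\<beta> v = (e, h)"
          using bij_betw_imp_surj_on[OF \<beta>] by (metis imageE mem_Collect_eq)
        thus "e \<in> (\<lambda>v. fst (\<beta> v)) ` {v \<in> Q. k v = h}"
          by (intro image_eqI[of _ _ v]) (auto simp: k_def)
      next
        fix e assume "e \<in> (\<lambda>v. fst (\<beta> v)) ` {v \<in> Q. k v = h}"
        then obtain v where "v \<in> Q" "k v = h" "e = fst (\<beta> v)" by blast
        thus "e \<in> {e. (e, h) \<in> R}" using bij_betwE[OF \<beta>] by (force simp: k_def)
      qed
    qed
    have 1: "finite {v \<in> Q. k v = h}" using fQ by simp
    have 2: "{e. (e, h) \<in> R} \<subseteq> {1..<p}" by (auto simp: R_def pos_diffs_def)
    have 3: "finite {e. (e, h) \<in> R}" using 2 finite_subset by blast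
    have 4: "0 \<le> x v \<and> x v < p" if "v \<in> {v \<in> Q. k v = h}" for v using x(2,3)[of v] that by simp
    obtain d \<sigma> where "bij_betw d {v \<in> Q. k v = h} {e. (e, h) \<in> R}"
      "inj_on (\<lambda>v. (x v + d v) mod p) {v \<in> {v \<in> Q. k v = h}. \<sigma> v}"
      "inj_on (\<lambda>v. (x v - d v) mod p) {v \<in> {v \<in> Q. k v = h}. \<not> \<sigma> v}"
      by (rule absorbing_assignment[where x = x, OF 1 3 bij_betw_same_card[OF bb] 2 4]) (assumption, rule that)
    hence "good h (d, \<sigma>)" by (simp only: good_def fst_conv snd_conv)
    thus ?thesis by blast
  qed
  then obtain z where z: "\<And>h. good h (z h)" by metis
  define d where "d h = fst (z h)" for h
  define \<sigma> where "\<sigma> h = snd (z h)" for h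
  have d: "\<And>h. bij_betw (d h) {v \<in> Q. k v = h} {e. (e, h) \<in> R}"
    and inj_plus: "\<And>h. inj_on (\<lambda>v. (x v + d h v) mod p) {v \<in> {v \<in> Q. k v = h}. \<sigma> h v}"
    and inj_minus: "\<And>h. inj_on (\<lambda>v. (x v - d h v) mod p) {v \<in> {v \<in> Q. k v = h}. \<not> \<sigma> h v}"
    using z unfolding good_def d_def \<sigma>_def by blast+
  define D where "D v = (d (k v) v, k v)" for v
  define sg where "sg v = \<sigma> (k v) v" for v
  define \<delta> where "\<delta> v = (if sg v then D v else neg (D v))" for v
  have DR: "D v \<in> R" if "v \<in> Q" for v
    using bij_betwE[OF d[of "k v"]] that by (auto simp: D_def)
  have D_inj: "v = v'" if "v \<in> Q" "v' \<in> Q" "D v = D v'" for v v'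
    using that bij_betw_imp_inj_on[OF d[of "k v"]] by (auto simp: D_def inj_on_def)
  have Dpos: "1 \<le> fst (D v)" "fst (D v) < p" "snd (D v) = k v" "D v \<in> L" "D v \<in> nonzero_diffs" "D v \<notin> U"
    if "v \<in> Q" for v
    using DR[OF that] nonzero_diffs_facts(4) nonzero_diffs_split by (auto simp: R_def pos_diffs_def D_def)
  have negD: "neg (D v) = (p - fst (D v), r - k v)" if "v \<in> Q" for v
    using Dpos[OF that] k[OF that] qr by (simp add: neg_def mod_minus_pos)
  have \<delta>L: "\<delta> v \<in> L" "\<delta> v \<in> nonzero_diffs" "\<delta> v \<notin> U" if "v \<in> Q" for v
    using Dpos[OF that] neg_nonzero_diffs[of "D v"] U(2)[of "neg (D v)"] by (auto simp: \<delta>_def)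
  have \<delta>_pm: "\<delta> v = D v \<or> \<delta> v = neg (D v)" for v by (simp add: \<delta>_def)
  have diff: "\<delta> v' \<noteq> \<delta> v \<and> \<delta> v' \<noteq> neg (\<delta> v)" if "v \<in> Q" "v' \<in> Q" "v \<noteq> v'" for v v'
  proof -
    have "D v \<noteq> D v'" using D_inj that by blast
    moreover from this have "neg (D v) \<noteq> neg (D v')" using Dpos(4) that neg_neg by metis
    moreover have "D v \<noteq> neg (D v')" "neg (D v) \<noteq> D v'"
      using negD that k[OF that(1)] k[OF that(2)] qr by (auto simp: D_def)
    ultimately show ?thesis using \<delta>_pm[of v] \<delta>_pm[of v'] Dpos(4)[OF that(1)] by auto
  qed
  define y where "y v = add (\<phi> (par v)) (\<delta> v)" for v
  \<comment> \<open>As \<open>k v\<close> is at most \<open>q\<close>, the layer of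
    \<open>y v\<close> reveals both \<open>k v\<close> and the sign.\<close>
  have y: "y v = (if sg v then ((x v + d (k v) v) mod p, k v) else ((x v - d (k v) v) mod p, r - k v))"
    if "v \<in> Q" for v
    using x[OF that] negD[OF that] k[OF that] qr
    by (auto simp: y_def add_def \<delta>_def D_def neg_def mod_add_right_eq mod_add_diff)
  have y_inj: "inj_on y Q"
  proof (rule inj_onI)
    fix v v' assume v: "v \<in> Q" "v' \<in> Q" "y v = y v'"
    have kk: "k v = k v'" "sg v = sg v'"
      using y[OF v(1)] y[OF v(2)] v(3) k[OF v(1)] k[OF v(2)] qr by (auto split: if_splits)
    show "v = v'"
    proof (cases "sg v")
      case True
      thus ?thesis using inj_plus[of "k v"] v kk y[OF v(1)] y[OF v(2)] by (auto simp: inj_on_def sg_def)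
    next
      case False
      thus ?thesis using inj_minus[of "k v"] v kk y[OF v(1)] y[OF v(2)] by (auto simp: inj_on_def sg_def)
    qed
  qed
  have y_new: "y v \<notin> \<phi> ` S" if "v \<in> Q" for v
  proof -
    have "snd (y v) \<noteq> 0" using y[OF that] k[OF that] qr by auto
    thus ?thesis using lay by (auto simp: two_layers_def)
  qed
  have st': "partial_emb (S \<union> Q) (\<lambda>v. if v \<in> Q then add (\<phi> (par v)) (\<delta> v) else \<phi> v)
           (A \<union> (\<Union>v\<in>Q. {\<delta> v, neg (\<delta> v)}))"
  proof (rule attach_leaves[OF st fQ])
    show "Q \<subseteq> V - S" using V'(1) by (auto simp: Q_def)
    show "\<delta> v \<in> L \<and> \<delta> v \<notin> A \<and> add (\<phi> (par v)) (\<delta> v) \<notin> \<phi> ` S" if "v \<in> Q" for v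
      using \<delta>L[OF that] y_new[OF that] by (auto simp: U_def y_def)
    show "inj_on (\<lambda>v. add (\<phi> (par v)) (\<delta> v)) Q" using y_inj by (simp add: y_def [abs_def])
  qed (use par diff in auto)
  have SQ: "S \<union> Q = V'" using assms(2) by (auto simp: Q_def)
  have disj: "(A \<union> (\<Union>v\<in>Q. {\<delta> v, neg (\<delta> v)})) \<inter> X = {}"
  proof -
    have "\<delta> v \<notin> X \<and> neg (\<delta> v) \<notin> X" if "v \<in> Q" for v
      using \<delta>L[OF that] X(1)[of "neg (\<delta> v)"] by (auto simp: U_def)
    thus ?thesis using assms(7) by blast
  qed
  have sub: "A \<union> (\<Union>v\<in>Q. {\<delta> v, neg (\<delta> v)}) \<subseteq> nonzero_diffs"
    using assms(8) \<delta>L(2) neg_nonzero_diffs by blast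
  show ?thesis by (intro exI conjI) (rule st'[unfolded SQ], rule disj, rule sub)
qed

section \<open>Greedy placement of the non-leaves\<close>

lemma connected_root: "connected_from E w W \<Longrightarrow> {w} \<subseteq> W"
  by (simp add: connected_from_def)

text \<open>Within one layer both \<open>d\<close> and \<open>neg d\<close> are jumps from every
  position. So a new vertex costs three options: two differences and one position.\<close>

lemma grow_in_layer_0:
  assumes W: "connected_from E w W" "W \<subseteq> V'"
    and X: "\<And>d. d \<in> X \<Longrightarrow> neg d \<in> X" "X \<subseteq> L" "card (slice 0 \<inter> X) \<le> c"
    and "c + 3 * card W \<le> nat (p - 1) + 4"
  shows "\<exists>\<phi> A. partial_emb W \<phi> A \<and> \<phi> ` W \<subseteq> two_layers 0 \<and> A \<subseteq> slice 0 \<and> A \<inter> X = {}"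
proof -
  have fW: "finite W" using W(2) nonzero_diffs_facts(3) finite_subset by blast
  have jz: "jumps 0 z = slice 0" if "z \<in> two_layers 0" for z
    using that by (auto simp: jumps_def two_layers_def)
  have cw: "card W \<ge> 2" if "{w} \<noteq> W"
  proof -
    have "card {w} < card W"
      using that connected_root[OF W(1)] fW by (intro psubset_card_mono) auto
    thus ?thesis by simp
  qed
  have "\<exists>\<phi>' A'. partial_emb W \<phi>' A' \<and> (\<forall>a\<in>{w}. \<phi>' a = (0, 0)) \<and> {} \<subseteq> A' \<and> A' \<inter> X = {} \<and>
           \<phi>' ` (W - {w}) \<inter> {} = {} \<and> \<phi>' ` W \<subseteq> two_layers 0 \<and> A' - {} \<subseteq> slice 0"
  proof (rule grow[OF root W(1), where K = "jumps 0" and N = "nat (p - 1)" and e = 2 and c = c and b = 0])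
    show "W \<subseteq> V" using W(2) V'(1) by blast
    show "{w} \<subseteq> W" by (rule connected_root[OF W(1)])
    show "(\<lambda>_. (0, 0)) ` {w} \<subseteq> two_layers 0" using p_pos by (simp add: two_layers_def)
    show "jumps 0 z \<subseteq> L" if "z \<in> two_layers 0" for z using jz[OF that] slice_subset[of 0] r_pos by simp
    show "card (jumps 0 z) = nat (p - 1)" if "z \<in> two_layers 0" for z using jz[OF that] by simp
    show "add z d \<in> two_layers 0 \<and> d \<in> slice 0 \<and> neg d \<in> slice 0" if "z \<in> two_layers 0" "d \<in> jumps 0 z" for z d
    proof -
      have d: "d \<in> slice 0" using jz[OF that(1)] that(2) by simp
      have "snd z = 0" "snd d = 0" using that(1) d by (auto simp: two_layers_def slice_def)
      hence "add z d \<in> two_layers 0" using p_pos by (simp add: two_layers_def add_def)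
      thus ?thesis using d neg_slice_0[OF d] by blast
    qed
    show "card (jumps 0 z \<inter> {d, neg d}) \<le> 2" for z d
    proof -
      have "card (jumps 0 z \<inter> {d, neg d}) \<le> card {d, neg d}" by (intro card_mono) auto
      also have "\<dots> \<le> 2" by (simp add: card_insert_if)
      finally show ?thesis .
    qed
    show "card (jumps 0 z \<inter> ({} \<union> X)) \<le> c" if "z \<in> two_layers 0" for z using jz[OF that] X(3) by simp
    show "c + 2 * (card W - card {w} - 1) + card W + 0 \<le> nat (p - 1)" if "{w} \<noteq> W"
      using cw[OF that] assms(6) by simp
  qed (use X in auto)
  thus ?thesis by auto
qed

lemma grow_in_two_layers:
  assumes "partial_emb S \<phi> A" and W: "connected_from E w W" "W \<subseteq> V'" and "S \<subseteq> W"
    and "\<phi> ` S \<subseteq> two_layers g" and g: "0 < g" "g \<le> q"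
    and X: "\<And>d. d \<in> X \<Longrightarrow> neg d \<in> X" "X \<subseteq> L" and "A \<inter> X = {}"
    and "\<And>z. z \<in> two_layers g \<Longrightarrow> card (jumps g z \<inter> (A \<union> X)) \<le> c"
    and "finite Blk" "card Blk \<le> b"
    and "S \<noteq> W \<Longrightarrow> c + (card W - card S - 1) + card W + b \<le> nat (p - 1)"
  shows "\<exists>\<phi>' A'. partial_emb W \<phi>' A' \<and> (\<forall>a\<in>S. \<phi>' a = \<phi> a) \<and> A \<subseteq> A' \<and> A' \<inter> X = {} \<and>
           \<phi>' ` (W - S) \<inter> Blk = {} \<and> \<phi>' ` W \<subseteq> two_layers g \<and> A' - A \<subseteq> diff_class g"
proof (rule grow[OF assms(1) W(1), where K = "jumps g" and N = "nat (p - 1)" and e = 1 and c = c and b = b])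
  have g': "0 < g" "g < r" using g qr by auto
  show "W \<subseteq> V" using W(2) V'(1) by blast
  show "jumps g z \<subseteq> L" "card (jumps g z) = nat (p - 1)" if "z \<in> two_layers g" for z
    using jumps_facts(1,2)[OF g' that] by auto
  show "add z d \<in> two_layers g \<and> d \<in> diff_class g \<and> neg d \<in> diff_class g"
    if "z \<in> two_layers g" "d \<in> jumps g z" for z d using jumps_facts(3)[OF g' that] .
  show "card (jumps g z \<inter> {d, neg d}) \<le> 1" if "z \<in> two_layers g" for z d
    using jumps_facts(4)[OF g' that] .
qed (use assms in auto)

text \<open>The position \<open>(0, g)\<close> is blocked because it is kept for the removed
  leaf.\<close>

lemma first_in_two_layers:
  assumes W: "connected_from E w W" "W \<subseteq> V'" and g: "0 < g" "g \<le> q"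
    and X: "\<And>d. d \<in> X \<Longrightarrow> neg d \<in> X" "X \<subseteq> L"
    and "\<And>z. z \<in> two_layers g \<Longrightarrow> card (jumps g z \<inter> X) \<le> c"
    and "c + 2 * card W \<le> nat (p - 1) + 1"
  shows "\<exists>\<phi> A. partial_emb W \<phi> A \<and> \<phi> ` W \<subseteq> two_layers g \<and> A \<subseteq> diff_class g \<and> A \<inter> X = {} \<and> (0, g) \<notin> \<phi> ` W"
proof -
  have fW: "finite W" using W(2) nonzero_diffs_facts(3) finite_subset by blast
  have cw: "card W \<ge> 2" if "{w} \<noteq> W"
  proof -
    have "card {w} < card W"
      using that connected_root[OF W(1)] fW by (intro psubset_card_mono) auto
    thus ?thesis by simp
  qed
  have "\<exists>\<phi>' A'. partial_emb W \<phi>' A' \<and> (\<forall>a\<in>{w}. \<phi>' a = (0, 0)) \<and> {} \<subseteq> A' \<and> A' \<inter> X = {} \<and>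
           \<phi>' ` (W - {w}) \<inter> {(0, g)} = {} \<and> \<phi>' ` W \<subseteq> two_layers g \<and> A' - {} \<subseteq> diff_class g"
  proof (rule grow_in_two_layers[OF root W, where c = c and b = 1])
    show "(\<lambda>_. (0, 0)) ` {w} \<subseteq> two_layers g" using p_pos by (simp add: two_layers_def)
    show "{w} \<subseteq> W" by (rule connected_root[OF W(1)])
    show "c + (card W - card {w} - 1) + card W + 1 \<le> nat (p - 1)" if "{w} \<noteq> W"
      using cw[OF that] assms(8) by simp
  qed (use assms in auto)
  then obtain \<phi>' A' where R: "partial_emb W \<phi>' A'" "\<phi>' w = (0, 0)" "A' \<inter> X = {}"
    "\<phi>' ` (W - {w}) \<inter> {(0, g)} = {}" "\<phi>' ` W \<subseteq> two_layers g" "A' \<subseteq> diff_class g" by auto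
  have "(0, g) \<notin> \<phi>' ` W" using R(2,4) g by auto
  thus ?thesis using R by blast
qed

lemma diff_class_nonzero: "0 < g \<Longrightarrow> g \<le> q \<Longrightarrow> diff_class g \<subseteq> nonzero_diffs"
  using qr by (auto simp: diff_class_def slice_def nonzero_diffs_def)

lemma slice_0_nonzero: "slice 0 \<subseteq> nonzero_diffs"
  using qr by (auto simp: slice_def nonzero_diffs_def)

text \<open>\<open>X\<close> holds the differences of the copy in layer 0 and leaves
  \<open>s\<close> pairs of \<open>slice 0\<close>. At three options per vertex only
  \<open>j\<close> of them, about two thirds, can be used inside layer 0. The other
  \<open>s - j\<close> go to \<open>pair_steps\<close>, and each takes up to two vertices of
  \<open>I\<close>; hence the lower bound on \<open>card I\<close>. The final bound on jumps leaves
  room for the second copy of class 1.\<close>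

lemma exhaust_slice_0:
  assumes I: "connected_from E w I" "I \<subseteq> V'"
      "\<And>v. v \<in> I - {w} \<Longrightarrow> \<exists>a\<in>V'. \<exists>b\<in>V'. a \<noteq> b \<and> {v, a} \<in> E \<and> {v, b} \<in> E"
    and X: "\<And>d. d \<in> X \<Longrightarrow> neg d \<in> X" "X \<subseteq> slice 0" "card X = 2 * m1"
    and m: "p = 2 * int m + 1" "card V' = m + 1" "m1 < m" "card I \<le> m1 + 1"
    and s: "s = m - m1" "j = 2 * s div 3" "j + 1 + 2 * (s - j) \<le> card I"
    and num: "3 * m1 \<le> 2 * m" "2 * s + 2 \<le> m" "2 \<le> s"
  shows "\<exists>S \<phi> A. partial_emb S \<phi> A \<and> I \<subseteq> S \<and> S \<subseteq> V' \<and> m1 + 1 \<le> card S \<and> \<phi> ` S \<subseteq> two_layers 1 \<and>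
           A \<inter> X = {} \<and> slice 0 \<subseteq> A \<union> X \<and> A \<subseteq> slice 0 \<union> diff_class 1 \<and>
           (\<forall>z\<in>two_layers 1. card (jumps 1 z \<inter> A) \<le> m1)"
proof -
  have N: "nat (p - 1) = 2 * m" using m(1) by simp
  have fV: "finite V'" by (rule nonzero_diffs_facts)
  have fI: "finite I" using I(2) fV finite_subset by blast
  have XL: "X \<subseteq> L" using X(2) slice_subset[of 0] r_pos by auto
  have j: "3 * j \<le> 2 * s" "j \<le> s" "2 * s \<le> 3 * j + 2" using s(2) by auto
  have sm: "s + m1 = m" using s(1) m(3) by simp
  have wV': "w \<in> V'" using V'(2) by (simp add: connected_from_def)
  obtain B where B: "{w} \<subseteq> B" "B \<subseteq> V'" "card B = j + 1" "connected_from E w B"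
    using connected_from_extend[OF connected_from_singleton V'(2) _ fV, of "j + 1"] wV' m j s by auto
  have fB: "finite B" using B(2) fV finite_subset by blast
  have slX: "slice 0 \<inter> X = X" using X(2) by blast
  have "2 * m1 + 3 * card B \<le> nat (p - 1) + 4" unfolding N B(3) using j(1) sm by presburger
  then obtain \<phi>1 A1 where 1: "partial_emb B \<phi>1 A1" "\<phi>1 ` B \<subseteq> two_layers 0" "A1 \<subseteq> slice 0" "A1 \<inter> X = {}"
    using grow_in_layer_0[OF B(4,2) X(1) XL, of "2 * m1"] X(3) slX by auto
  have c1: "card A1 = 2 * j" using partial_emb_facts[OF 1(1)] B(3) by simp
  have fin: "finite X" "finite A1" using X(2) 1(3) finite_slice finite_subset by blast+
  have "card (slice 0 - (A1 \<union> X)) = card (slice 0) - card (A1 \<union> X)"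
    using 1(3) X(2) fin by (intro card_Diff_subset) auto
  also have "card (A1 \<union> X) = card A1 + card X" using fin(2,1) 1(4) by (rule card_Un_disjoint)
  finally have rem: "card (slice 0 - (A1 \<union> X)) = 2 * (s - j)"
    using c1 X(3) N s(1) m(3) by (simp add: algebra_simps)
  have "card (I - B) \<ge> card I - card B" using fB by (rule diff_card_le_card_Diff)
  hence IB: "2 * (s - j) \<le> card (I - B)" using s(3) B(3) by linarith
  have lay1: "\<phi>1 ` B \<subseteq> two_layers 1" using 1(2) by (auto simp: two_layers_def)
  have jmp: "jumps 1 z \<inter> slice 0 = {}" if "z \<in> two_layers 1" for z
    using that qr by (auto simp: jumps_def slice_def split: if_splits)
  have c0: "card (jumps 1 z \<inter> (A1 \<union> X)) \<le> 0" if "z \<in> two_layers 1" for z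
  proof -
    have "jumps 1 z \<inter> (A1 \<union> X) = {}" using jmp[OF that] 1(3) X(2) by blast
    thus ?thesis by simp
  qed
  have num2: "0 + (s - j) + 2 * (card B + 2 * (s - j)) < nat (p - 1)"
  proof -
    obtain k where k: "s = j + k" using j(2) le_iff_add by auto
    have "5 * k + 2 * j + 2 < 2 * m" using j num(2,3) k by linarith
    thus ?thesis unfolding N B(3) k by simp
  qed
  obtain S2 \<phi>2 A2 where 2: "partial_emb S2 \<phi>2 A2" "B \<subseteq> S2" "S2 \<subseteq> V'" "A2 \<inter> X = {}"
    "slice 0 \<subseteq> A2 \<union> X" "\<phi>2 ` S2 \<subseteq> two_layers 1" "card S2 = card B + 2 * (s - j)"
    "card (S2 - I) \<le> card (B - I) + (s - j)" "A2 \<subseteq> A1 \<union> slice 0 \<union> diff_class 1"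
    using pair_steps[OF 1(1) lay1 _ _ X(1) XL 1(4) I(1,2) V'(1) I(3) B(2) rem IB c0 num2] qr by auto
  \<comment> \<open>At most \<open>j\<close> vertices of \<open>B\<close> lie outside
    \<open>I\<close>, as \<open>w\<close> is in \<open>I\<close>, and each pair step adds at most
    one: in total at most \<open>s\<close>.\<close>
  have "card (B - I) \<le> card (B - {w})"
    using I(1) fB by (intro card_mono) (auto simp: connected_from_def)
  also have "\<dots> = j" using B(1,3) fB by simp
  finally have S2I: "card (S2 - I) \<le> s" using 2(8) j by linarith
  have f2: "connected_from E w S2" "finite S2" "card A2 + 2 = 2 * card S2" "A2 \<subseteq> L" "\<And>d. d \<in> A2 \<Longrightarrow> neg d \<in> A2"
    using partial_emb_facts[OF 2(1)] by auto
  \<comment> \<open>Of the \<open>2 * card S - 2\<close> differences, \<open>2 * s\<close> lie in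
    \<open>slice 0\<close>; the others are split evenly between the two slices of class 1.\<close>
  have half: "card (jumps 1 z \<inter> A) + s = card S - 1"
    if "partial_emb S \<phi> A" "A \<inter> X = {}" "slice 0 \<subseteq> A \<union> X" "A \<subseteq> slice 0 \<union> diff_class 1" for S \<phi> A z
  proof -
    have a: "card A + 2 = 2 * card S" "A \<subseteq> L" "\<And>d. d \<in> A \<Longrightarrow> neg d \<in> A"
      using partial_emb_facts[OF that(1)] by auto
    have fA: "finite A" using a(2) finite_L finite_subset by blast
    have "A \<inter> slice 0 = slice 0 - X" using that(2,3) by blast
    hence "card (A \<inter> slice 0) = 2 * s"
      using X(2,3) fin N s(1) m(3) by (simp add: card_Diff_subset)
    moreover have "card A = card (A \<inter> slice 0) + card (A \<inter> diff_class 1)"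
    proof -
      have "A = (A \<inter> slice 0) \<union> (A \<inter> diff_class 1)" using that(4) by blast
      moreover have "(A \<inter> slice 0) \<inter> (A \<inter> diff_class 1) = {}"
        using qr by (auto simp: diff_class_def slice_def)
      ultimately show ?thesis using fA by (metis card_Un_disjoint finite_Int)
    qed
    moreover have "2 * card (jumps 1 z \<inter> A) = card (A \<inter> diff_class 1)"
      using card_jumps_Int[OF a(2,3), of 1 z] qr by simp
    ultimately show ?thesis using a(1) by linarith
  qed
  have A2s: "A2 \<subseteq> slice 0 \<union> diff_class 1" using 2(9) 1(3) by blast
  have con: "connected_from E w (S2 \<union> I)" by (rule connected_from_Un[OF f2(1) I(1)])
  have sub: "S2 \<union> I \<subseteq> V'" using 2(3) I(2) by blast
  have cu: "card (S2 \<union> I) \<le> m1 + 1 + s"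
  proof -
    have "S2 \<union> I = I \<union> (S2 - I)" by blast
    thus ?thesis using card_Un_le[of I "S2 - I"] S2I m(4) by simp
  qed
  \<comment> \<open>At least \<open>m1 + 1\<close> vertices are wanted, so that at most
    \<open>m - m1\<close> leaves remain. At most \<open>m1 + 1 + s\<close> are allowed, so that by
    \<open>half\<close> at most \<open>m1\<close> jumps get blocked.\<close>
  obtain W where W: "S2 \<union> I \<subseteq> W" "W \<subseteq> V'" "card W = max (m1 + 1) (card (S2 \<union> I))" "connected_from E w W"
    using connected_from_extend[OF con V'(2) sub fV, of "max (m1 + 1) (card (S2 \<union> I))"] m(2,3)
      card_mono[OF fV sub] by auto
  have fW: "finite W" using W(2) fV finite_subset by blast
  have cW: "card W \<le> m1 + 1 + s" using W(3) cu by simp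
  have S2W: "card S2 \<le> card W" using W(1) fW by (intro card_mono) auto
  have bnd: "card (jumps 1 z \<inter> (A2 \<union> X)) \<le> card S2 - 1 - s" if "z \<in> two_layers 1" for z
  proof -
    have "jumps 1 z \<inter> (A2 \<union> X) = jumps 1 z \<inter> A2" using jmp[OF that] X(2) by blast
    thus ?thesis using half[OF 2(1,4,5) A2s, of z] by simp
  qed
  have s2: "s + 1 \<le> card S2" using half[OF 2(1,4,5) A2s, of "(0,0)"] 2(7) B(3) by linarith
  have num3: "(card S2 - 1 - s) + (card W - card S2 - 1) + card W + 0 \<le> nat (p - 1)"
    unfolding N using cW S2W s2 sm num by linarith
  obtain \<phi>3 A3 where 3: "partial_emb W \<phi>3 A3" "A2 \<subseteq> A3" "A3 \<inter> X = {}" "\<phi>3 ` W \<subseteq> two_layers 1"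
    "A3 - A2 \<subseteq> diff_class 1"
    using grow_in_two_layers[OF 2(1) W(4,2) _ 2(6) _ _ X(1) XL 2(4) bnd, of "{}" 0] W(1) qr num3 by auto
  have A3: "slice 0 \<subseteq> A3 \<union> X" "A3 \<subseteq> slice 0 \<union> diff_class 1" using 2(5) 3(2,5) A2s by blast+
  have "card (jumps 1 z \<inter> A3) \<le> m1" for z
    using half[OF 3(1,3) A3, of z] cW by linarith
  moreover have "m1 + 1 \<le> card W" using W(3) by simp
  ultimately show ?thesis using 3 A3 W(1,2) by blast
qed

lemma diff_class_disjoint:
  assumes "0 < g" "g \<le> q" "0 < h" "h \<le> q" "g \<noteq> h"
  shows "diff_class g \<inter> diff_class h = {}"
  using assms qr by (auto simp: diff_class_def slice_def)

lemma slice_0_diff_class_disjoint: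
  assumes "0 < g" "g \<le> q" shows "slice 0 \<inter> diff_class g = {}"
  using assms qr by (auto simp: diff_class_def slice_def)

lemma partial_emb_diffs: "partial_emb S \<phi> A \<Longrightarrow> d \<in> A \<Longrightarrow> neg d \<in> A"
  "partial_emb S \<phi> A \<Longrightarrow> A \<subseteq> L" "partial_emb S \<phi> A \<Longrightarrow> card A + 2 = 2 * card S"
  using partial_emb_facts[of S \<phi> A] by blast+

text \<open>\<open>e\<close> is the triple of embedded vertices, embedding and differences, bundled
  so that one function can list all copies.\<close>

definition base_copy :: "'a set \<Rightarrow> nat \<Rightarrow> nat \<Rightarrow> 'a set \<times> ('a \<Rightarrow> int \<times> int) \<times> (int \<times> int) set \<Rightarrow> bool" where
  "base_copy I k g e \<longleftrightarrow> partial_emb (fst e) (fst (snd e)) (snd (snd e)) \<and> I \<subseteq> fst e \<and> fst e \<subseteq> V' \<and>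
     k \<le> card (fst e) \<and> fst (snd e) ` fst e \<subseteq> two_layers (int g)"

text \<open>Copy 0 lies in layer 0, and the copies \<open>2 * g - 1\<close> and \<open>2 * g\<close>
  share the layers 0 and \<open>g\<close>. Different classes have disjoint differences, so conflicts
  arise only within a class, and between the copies 0 and 1 over \<open>slice 0\<close>.\<close>

lemma base_copiesI:
  assumes I: "connected_from E w I" "I \<subseteq> V'"
      "\<And>v. v \<in> I - {w} \<Longrightarrow> \<exists>a\<in>V'. \<exists>b\<in>V'. a \<noteq> b \<and> {v, a} \<in> E \<and> {v, b} \<in> E"
    and m: "p = 2 * int m + 1" "card V' = m + 1" "m1 < m" "card I \<le> m1 + 1"
    and s: "s = m - m1" "j = 2 * s div 3" "j + 1 + 2 * (s - j) \<le> card I"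
    and num: "3 * m1 + 1 \<le> 2 * m" "2 * s + 2 \<le> m" "2 \<le> s"
  obtains F where
    "\<And>i. i \<le> 2 * nat q \<Longrightarrow> base_copy I (m1 + 1) ((i + 1) div 2) (F i)"
    "\<And>i. i \<le> 2 * nat q \<Longrightarrow> snd (snd (F i)) \<subseteq> nonzero_diffs"
    "\<And>i k. \<lbrakk>i \<le> 2 * nat q; k \<le> 2 * nat q; i \<noteq> k\<rbrakk> \<Longrightarrow> snd (snd (F i)) \<inter> snd (snd (F k)) = {}"
    "\<And>i. \<lbrakk>i \<le> 2 * nat q; even i; 0 < i\<rbrakk> \<Longrightarrow> (0, int (i div 2)) \<notin> fst (snd (F i)) ` fst (F i)"
    "card (fst (F 0)) = m1 + 1" "slice 0 \<subseteq> snd (snd (F 0)) \<union> snd (snd (F 1))"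
proof -
  have N: "nat (p - 1) = 2 * m" using m(1) by simp
  have fV: "finite V'" by (rule nonzero_diffs_facts)
  obtain W where W: "I \<subseteq> W" "W \<subseteq> V'" "card W = m1 + 1" "connected_from E w W"
    using connected_from_extend[OF I(1) V'(2) I(2) fV, of "m1 + 1"] m(2-4) by auto
  have "0 + 3 * card W \<le> nat (p - 1) + 4" unfolding N W(3) using num(1) by simp
  then obtain \<phi>0 A0 where 0: "partial_emb W \<phi>0 A0" "\<phi>0 ` W \<subseteq> two_layers 0" "A0 \<subseteq> slice 0"
    using grow_in_layer_0[OF W(4,2), of "{}" 0] by auto
  note A0 = partial_emb_diffs[OF 0(1)]
  have cA0: "card A0 = 2 * m1" using A0(3) W(3) by simp
  have num': "3 * m1 \<le> 2 * m" using num(1) by simp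
  obtain S1 \<phi>1 A1 where 1: "partial_emb S1 \<phi>1 A1" "I \<subseteq> S1" "S1 \<subseteq> V'" "m1 + 1 \<le> card S1"
    "\<phi>1 ` S1 \<subseteq> two_layers 1" "A1 \<inter> A0 = {}" "slice 0 \<subseteq> A1 \<union> A0" "A1 \<subseteq> slice 0 \<union> diff_class 1"
    "\<And>z. z \<in> two_layers 1 \<Longrightarrow> card (jumps 1 z \<inter> A1) \<le> m1"
    using exhaust_slice_0[OF I A0(1) 0(3) cA0 m s num' num(2,3)] by metis
  define cls where "cls g = (if g = 1 then slice 0 else {}) \<union> diff_class (int g)" for g
  have first: "\<exists>e. base_copy I (m1 + 1) g e \<and> snd (snd e) \<subseteq> cls g \<and> snd (snd e) \<inter> A0 = {} \<and>
      (g = 1 \<longrightarrow> slice 0 \<subseteq> A0 \<union> snd (snd e)) \<and>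
      (\<forall>z\<in>two_layers (int g). card (jumps (int g) z \<inter> snd (snd e)) \<le> m1)"
    if g: "0 < g" "int g \<le> q" for g
  proof (cases "g = 1")
    case True
    thus ?thesis
      using 1 by (intro exI[of _ "(S1, \<phi>1, A1)"]) (auto simp: base_copy_def cls_def)
  next
    case False
    have g': "0 < int g" "int g \<le> q" "int g < r" using g qr by auto
    have "0 + 2 * card W \<le> nat (p - 1) + 1" unfolding N W(3) using num(1) m(3) by simp
    then obtain \<phi> A where R: "partial_emb W \<phi> A" "\<phi> ` W \<subseteq> two_layers (int g)" "A \<subseteq> diff_class (int g)"
      using first_in_two_layers[OF W(4,2) g'(1,2), of "{}" 0] by auto
    have "card (jumps (int g) z \<inter> A) \<le> m1" for z
    proof -
      have "2 * card (jumps (int g) z \<inter> A) = card (A \<inter> diff_class (int g))"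
        using card_jumps_Int[OF partial_emb_diffs(2,1)[OF R(1)] g'(1,3)] by simp
      also have "A \<inter> diff_class (int g) = A" using R(3) by blast
      also have "card A = 2 * m1" using partial_emb_diffs(3)[OF R(1)] W(3) by simp
      finally show ?thesis by simp
    qed
    moreover have "A \<inter> A0 = {}" using slice_0_diff_class_disjoint[OF g'(1,2)] R(3) 0(3) by blast
    ultimately show ?thesis using R W(1,2,3) False
      by (intro exI[of _ "(W, \<phi>, A)"]) (auto simp: base_copy_def cls_def)
  qed
  have "\<exists>e e'. base_copy I (m1 + 1) g e \<and> snd (snd e) \<subseteq> cls g \<and> snd (snd e) \<inter> A0 = {} \<and>
      (g = 1 \<longrightarrow> slice 0 \<subseteq> A0 \<union> snd (snd e)) \<and> base_copy I (m1 + 1) g e' \<and>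
      snd (snd e') \<subseteq> diff_class (int g) \<and> snd (snd e') \<inter> snd (snd e) = {} \<and>
      (0, int g) \<notin> fst (snd e') ` fst e'"
    if g: "0 < g" "int g \<le> q" for g
  proof -
    obtain e where e: "base_copy I (m1 + 1) g e" "snd (snd e) \<subseteq> cls g" "snd (snd e) \<inter> A0 = {}"
      "g = 1 \<longrightarrow> slice 0 \<subseteq> A0 \<union> snd (snd e)"
      "\<And>z. z \<in> two_layers (int g) \<Longrightarrow> card (jumps (int g) z \<inter> snd (snd e)) \<le> m1"
      using first[OF g] by blast
    have g': "0 < int g" "int g \<le> q" using g by auto
    have pe: "partial_emb (fst e) (fst (snd e)) (snd (snd e))" using e(1) by (simp add: base_copy_def)
    \<comment> \<open>The first copy of the class blocks up to \<open>m1\<close> jumps. This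
      inequality is the reason for the hypothesis \<open>3 * m1 + 1 \<le> 2 * m\<close>.\<close>
    have "m1 + 2 * card W \<le> nat (p - 1) + 1" unfolding N W(3) using num(1) by simp
    then obtain \<phi> A where "partial_emb W \<phi> A" "\<phi> ` W \<subseteq> two_layers (int g)" "A \<subseteq> diff_class (int g)"
      "A \<inter> snd (snd e) = {}" "(0, int g) \<notin> \<phi> ` W"
      using first_in_two_layers[OF W(4,2) g' partial_emb_diffs(1,2)[OF pe] e(5)] by blast
    hence "base_copy I (m1 + 1) g (W, \<phi>, A) \<and> snd (snd (W, \<phi>, A)) \<subseteq> diff_class (int g) \<and>
      snd (snd (W, \<phi>, A)) \<inter> snd (snd e) = {} \<and> (0, int g) \<notin> fst (snd (W, \<phi>, A)) ` fst (W, \<phi>, A)"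
      using W(1-3) by (simp add: base_copy_def)
    thus ?thesis using e(1-4) by blast
  qed
  then obtain f f' where ff: "\<And>g. \<lbrakk>0 < g; int g \<le> q\<rbrakk> \<Longrightarrow> base_copy I (m1 + 1) g (f g) \<and>
      snd (snd (f g)) \<subseteq> cls g \<and> snd (snd (f g)) \<inter> A0 = {} \<and>
      (g = 1 \<longrightarrow> slice 0 \<subseteq> A0 \<union> snd (snd (f g))) \<and> base_copy I (m1 + 1) g (f' g) \<and>
      snd (snd (f' g)) \<subseteq> diff_class (int g) \<and> snd (snd (f' g)) \<inter> snd (snd (f g)) = {} \<and>
      (0, int g) \<notin> fst (snd (f' g)) ` fst (f' g)"
    by metis
  define F where "F i = (if i = 0 then (W, \<phi>0, A0) else if odd i then f ((i + 1) div 2) else f' (i div 2))" for i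
  have half: "0 < (i + 1) div 2" "int ((i + 1) div 2) \<le> q" if "0 < i" "i \<le> 2 * nat q" for i :: nat
    using that by auto
  have half_even: "(i + 1) div 2 = i div 2" if "even i" for i :: nat using that by auto
  have Fodd: "F i = f ((i + 1) div 2)" if "odd i" for i using that odd_pos[OF that] unfolding F_def by simp
  have Feven: "F i = f' ((i + 1) div 2)" if "even i" "0 < i" for i
    unfolding half_even[OF that(1)] using that unfolding F_def by simp
  have cl: "snd (snd (F i)) \<subseteq> (if i \<le> 1 then slice 0 else {}) \<union> (if i = 0 then {} else diff_class (int ((i + 1) div 2)))"
    if "i \<le> 2 * nat q" for i
  proof (cases "i = 0")
    case True
    thus ?thesis using 0(3) by (simp add: F_def)
  next
    case False
    note h = half[OF _ that]
    show ?thesis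
    proof (cases "odd i")
      case True
      have one: "i = 1" if "(i + 1) div 2 = 1" using that True by (cases i rule: nat.exhaust) (auto simp: div_if split: if_splits)
      have "snd (snd (F i)) \<subseteq> cls ((i + 1) div 2)" using ff[OF h] Fodd[OF True] False by simp
      thus ?thesis using False one unfolding cls_def by (auto split: if_splits)
    next
      case even: False
      hence "snd (snd (F i)) \<subseteq> diff_class (int ((i + 1) div 2))"
        using ff[OF h] False Feven[of i] by simp
      thus ?thesis using False by auto
    qed
  qed
  show thesis
  proof (rule that[of F])
    show "base_copy I (m1 + 1) ((i + 1) div 2) (F i)" if "i \<le> 2 * nat q" for i
    proof (cases "i = 0")
      case True
      thus ?thesis using 0 W by (simp add: F_def base_copy_def)
    next
      case False
      hence h: "0 < (i + 1) div 2" "int ((i + 1) div 2) \<le> q" using half[OF _ that] by simp_all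
      show ?thesis
      proof (cases "odd i")
        case True
        show ?thesis unfolding Fodd[OF True] using ff[OF h] by blast
      next
        case e: False
        hence "F i = f' ((i + 1) div 2)" using Feven False by simp
        thus ?thesis using ff[OF h] by metis
      qed
    qed
    show "snd (snd (F i)) \<subseteq> nonzero_diffs" if "i \<le> 2 * nat q" for i
      using cl[OF that] slice_0_nonzero diff_class_nonzero[of "int ((i + 1) div 2)"] half[of i] that
      by (auto split: if_splits)
    show "(0, int (i div 2)) \<notin> fst (snd (F i)) ` fst (F i)" if "i \<le> 2 * nat q" "even i" "0 < i" for i
      using ff[OF half[OF that(3,1)]] Feven[OF that(2,3)] half_even[OF that(2)] by metis
    show "card (fst (F 0)) = m1 + 1" using W(3) by (simp add: F_def)
    show "slice 0 \<subseteq> snd (snd (F 0)) \<union> snd (snd (F 1))"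
      using ff[of 1] qr by (simp add: F_def)
    have dis: "snd (snd (F i)) \<inter> snd (snd (F k)) = {}" if "i < k" "k \<le> 2 * nat q" for i k
    proof -
      define g where "g = (i + 1) div 2"
      define h where "h = (k + 1) div 2"
      have h: "0 < int h" "int h \<le> q" using half[of k] that by (auto simp: h_def)
      show ?thesis
      proof (cases "i = 0")
        case True
        show ?thesis
        proof (cases "k = 1")
          case k: True
          show ?thesis using ff[of 1] qr True k by (auto simp: F_def)
        next
          case k: False
          have "snd (snd (F k)) \<subseteq> diff_class (int h)" using cl[OF that(2)] k True that by (simp add: h_def)
          moreover have "snd (snd (F i)) \<subseteq> slice 0" using True 0(3) by (simp add: F_def)
          ultimately show ?thesis using slice_0_diff_class_disjoint[OF h] by blast
        qed
      next
        case False
        have g: "0 < int g" "int g \<le> q" using half[of i] that False by (auto simp: g_def)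
        have ck: "snd (snd (F k)) \<subseteq> diff_class (int h)" using cl[OF that(2)] that False by (simp add: h_def)
        have ci: "snd (snd (F i)) \<subseteq> slice 0 \<union> diff_class (int g)"
          using cl[of i] that False by (auto simp: g_def split: if_splits)
        show ?thesis
        proof (cases "g = h")
          case True
          hence e: "(i + 1) div 2 = (k + 1) div 2" by (simp add: g_def h_def)
          have "odd i \<and> even k" using e that(1) by presburger
          hence "F i = f g" "F k = f' g"
            using Fodd[of i] Feven[of k] that(1) True unfolding g_def h_def by auto
          thus ?thesis using ff[of g] g by auto
        next
          case False
          thus ?thesis
            using ck ci diff_class_disjoint[OF g h] slice_0_diff_class_disjoint[OF h] by auto
        qed
      qed
    qed
    show "snd (snd (F i)) \<inter> snd (snd (F k)) = {}" if "i \<le> 2 * nat q" "k \<le> 2 * nat q" "i \<noteq> k" for i k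
      using dis[of i k] dis[of k i] that by (metis Int_commute linorder_neqE_nat)
  qed
qed

lemma rainbow_family:
  assumes I: "connected_from E w I" "I \<subseteq> V'"
      "\<And>v. v \<in> I - {w} \<Longrightarrow> \<exists>a\<in>V'. \<exists>b\<in>V'. a \<noteq> b \<and> {v, a} \<in> E \<and> {v, b} \<in> E"
      "\<And>v. v \<in> V' - I \<Longrightarrow> \<exists>u\<in>I. {u, v} \<in> E"
    and m: "p = 2 * int m + 1" "card V' = m + 1" "m1 < m" "card I \<le> m1 + 1"
    and s: "s = m - m1" "j = 2 * s div 3" "j + 1 + 2 * (s - j) \<le> card I"
    and num: "3 * m1 + 1 \<le> 2 * m" "2 * s + 2 \<le> m" "2 \<le> s"
  obtains \<phi> A where
    "\<And>i. i \<le> 2 * nat q \<Longrightarrow> partial_emb V' (\<phi> i) (A i) \<and> A i \<subseteq> nonzero_diffs"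
    "\<And>i k. \<lbrakk>i \<le> 2 * nat q; k \<le> 2 * nat q; i \<noteq> k\<rbrakk> \<Longrightarrow> A i \<inter> A k = {}"
    "\<And>i. \<lbrakk>i \<le> 2 * nat q; even i; 0 < i\<rbrakk> \<Longrightarrow> (0, int (i div 2)) \<notin> \<phi> i ` V'"
proof -
  define N where "N = 2 * nat q"
  have fV: "finite V'" by (rule nonzero_diffs_facts)
  obtain F where F: "\<And>i. i \<le> N \<Longrightarrow> base_copy I (m1 + 1) ((i + 1) div 2) (F i)"
    "\<And>i. i \<le> N \<Longrightarrow> snd (snd (F i)) \<subseteq> nonzero_diffs"
    "\<And>i k. \<lbrakk>i \<le> N; k \<le> N; i \<noteq> k\<rbrakk> \<Longrightarrow> snd (snd (F i)) \<inter> snd (snd (F k)) = {}"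
    "\<And>i. \<lbrakk>i \<le> N; even i; 0 < i\<rbrakk> \<Longrightarrow> (0, int (i div 2)) \<notin> fst (snd (F i)) ` fst (F i)"
    "card (fst (F 0)) = m1 + 1" "slice 0 \<subseteq> snd (snd (F 0)) \<union> snd (snd (F 1))"
    by (rule base_copiesI[OF I(1-3) m s num, folded N_def]) (assumption, rule that)
  define S where "S i = fst (F i)" for i
  have S: "I \<subseteq> S i" "S i \<subseteq> V'" "m1 + 1 \<le> card (S i)" if "i \<le> N" for i
    using F(1)[OF that] unfolding base_copy_def S_def by blast+
  have lv: "\<exists>u\<in>S i. {u, v} \<in> E" if "i \<le> N" "v \<in> V' - S i" for i v
    using I(4)[of v] S(1)[OF that(1)] that(2) by blast
  \<comment> \<open>The part of copy \<open>i\<close> that is embedded after \<open>n\<close>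
    completions; copy 0 stays incomplete throughout.\<close>
  define T where "T n i = (if 1 \<le> i \<and> i \<le> n then V' else S i)" for n i
  define ok where "ok n \<phi> A \<longleftrightarrow>
      (\<forall>i\<le>N. partial_emb (T n i) (\<phi> i) (A i) \<and> A i \<subseteq> nonzero_diffs) \<and>
      (\<forall>i\<le>N. \<forall>k\<le>N. i \<noteq> k \<longrightarrow> A i \<inter> A k = {}) \<and>
      (\<forall>i\<le>N. even i \<longrightarrow> 0 < i \<longrightarrow> (0, int (i div 2)) \<notin> \<phi> i ` T n i) \<and>
      slice 0 \<subseteq> A 0 \<union> A 1 \<and>
      (\<forall>i\<le>N. (i = 0 \<or> n < i) \<longrightarrow> \<phi> i ` S i \<subseteq> two_layers (int ((i + 1) div 2)))" for n \<phi> A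
  have okP: "partial_emb (T n i) (\<phi> i) (A i)" "A i \<subseteq> nonzero_diffs" if "ok n \<phi> A" "i \<le> N" for n \<phi> A i
    using that unfolding ok_def by simp_all
  have okD: "A i \<inter> A k = {}" if "ok n \<phi> A" "i \<le> N" "k \<le> N" "i \<noteq> k" for n \<phi> A i k
    using that unfolding ok_def by simp
  have okZ: "(0, int (i div 2)) \<notin> \<phi> i ` T n i" if "ok n \<phi> A" "i \<le> N" "even i" "0 < i" for n \<phi> A i
    using that unfolding ok_def by simp
  have okS: "slice 0 \<subseteq> A 0 \<union> A 1" if "ok n \<phi> A" for n \<phi> A
    using that unfolding ok_def by simp
  have okL: "\<phi> i ` S i \<subseteq> two_layers (int ((i + 1) div 2))" if "ok n \<phi> A" "i \<le> N" "i = 0 \<or> n < i" for n \<phi> A i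
    using that unfolding ok_def by metis
  have N1: "1 \<le> N" using qr by (simp add: N_def)
  have cardNZ: "card nonzero_diffs = 2 * m * (N + 1)"
  proof -
    have "nat (p - 1) = 2 * m" using m(1) by simp
    moreover have "nat r = N + 1" using qr by (simp add: N_def)
    ultimately show ?thesis by (simp add: nonzero_diffs_def card_cartesian_product)
  qed
  have cardA: "card (A i) \<le> 2 * m" "i = 0 \<Longrightarrow> card (A i) = 2 * m1" "1 \<le> i \<Longrightarrow> i \<le> n \<Longrightarrow> card (A i) = 2 * m"
    if "ok n \<phi> A" "i \<le> N" for n \<phi> A i
  proof -
    have pe: "partial_emb (T n i) (\<phi> i) (A i)" using okP(1)[OF that] .
    have "card (T n i) \<le> card V'" using S(2)[OF that(2)] fV by (intro card_mono) (auto simp: T_def)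
    thus "card (A i) \<le> 2 * m" using partial_emb_diffs(3)[OF pe] m(2) by simp
    show "card (A i) = 2 * m1" if "i = 0"
      using partial_emb_diffs(3)[OF pe] F(5) that by (simp add: T_def S_def)
    show "card (A i) = 2 * m" if "1 \<le> i" "i \<le> n"
      using partial_emb_diffs(3)[OF pe] m(2) that by (simp add: T_def)
  qed
  have "\<exists>\<phi> A. ok n \<phi> A" if "n \<le> N" for n
    using that
  proof (induction n)
    case 0
    have "ok 0 (\<lambda>i. fst (snd (F i))) (\<lambda>i. snd (snd (F i)))"
      using F unfolding ok_def T_def S_def base_copy_def by auto
    thus ?case by blast
  next
    case (Suc n)
    then obtain \<phi> A where ok: "ok n \<phi> A" by auto
    define i where "i = Suc n"
    have i: "i \<le> N" "0 < i" "n < i" using Suc.prems by (auto simp: i_def)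
    define g where "g = int ((i + 1) div 2)"
    have g: "0 < g" "g \<le> q" using i by (auto simp: g_def N_def)
    have Ti: "T n i = S i" by (simp add: T_def i_def)
    have pe: "partial_emb (S i) (\<phi> i) (A i)" using okP(1)[OF ok i(1)] Ti by simp
    define X where "X = (\<Union>k\<in>{..N} - {i}. A k)"
    have X1: "neg d \<in> X" if "d \<in> X" for d
    proof -
      obtain k where "k \<le> N" "k \<noteq> i" "d \<in> A k" using \<open>d \<in> X\<close> unfolding X_def by auto
      moreover from this have "neg d \<in> A k" using partial_emb_diffs(1)[OF okP(1)[OF ok]] by blast
      ultimately show ?thesis unfolding X_def by blast
    qed
    have X2: "X \<subseteq> nonzero_diffs" unfolding X_def by (intro UN_least okP(2)[OF ok]) simp
    have AX: "A i \<inter> X = {}" unfolding X_def using okD[OF ok i(1)] by auto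
    have An: "A i \<subseteq> nonzero_diffs" using okP(2)[OF ok i(1)] .
    have sl: "slice 0 \<subseteq> A i \<union> X"
    proof -
      have "A 0 \<union> A 1 \<subseteq> A i \<union> X" unfolding X_def using N1 by auto
      thus ?thesis using okS[OF ok] by (rule order_trans[rotated])
    qed
    have cX: "card X \<le> 2 * m1 + (N - 1) * (2 * m)"
    proof -
      have "X \<subseteq> A 0 \<union> (\<Union>k\<in>{1..N} - {i}. A k)"
      proof
        fix d assume "d \<in> X"
        then obtain k where "k \<le> N" "k \<noteq> i" "d \<in> A k" unfolding X_def by auto
        thus "d \<in> A 0 \<union> (\<Union>k\<in>{1..N} - {i}. A k)" by (cases k) auto
      qed
      moreover have "finite (A 0 \<union> (\<Union>k\<in>{1..N} - {i}. A k))"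
        using finite_subset[OF okP(2)[OF ok] nonzero_diffs_facts(1)] by auto
      ultimately have "card X \<le> card (A 0 \<union> (\<Union>k\<in>{1..N} - {i}. A k))" by (rule card_mono[rotated])
      also have "\<dots> \<le> card (A 0) + card (\<Union>k\<in>{1..N} - {i}. A k)" by (rule card_Un_le)
      also have "card (\<Union>k\<in>{1..N} - {i}. A k) \<le> (\<Sum>k\<in>{1..N} - {i}. card (A k))"
        by (rule card_UN_le) simp
      also have "\<dots> \<le> (\<Sum>k\<in>{1..N} - {i}. 2 * m)"
        by (intro sum_mono cardA(1)[OF ok]) auto
      also have "\<dots> = (N - 1) * (2 * m)" using i by simp
      finally show ?thesis using cardA(2)[OF ok, of 0] by simp
    qed
    have cVS: "card (V' - S i) \<le> m - m1"
      using S(2,3)[OF i(1)] fV m(2) finite_subset[OF S(2)[OF i(1)] fV] by (simp add: card_Diff_subset)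
    have num: "2 * card V' + card X + 2 * card (V' - S i) \<le> card nonzero_diffs + 4"
    proof -
      obtain N' where N': "N = Suc N'" using N1 by (cases N) auto
      have "2 * m * (N + 1) = 4 * m + N' * (2 * m)" unfolding N' by (simp add: algebra_simps)
      moreover have "card X \<le> 2 * m1 + N' * (2 * m)" using cX unfolding N' by simp
      ultimately show ?thesis unfolding cardNZ using cVS m(2,3) by linarith
    qed
    have lay: "\<phi> i ` S i \<subseteq> two_layers g" unfolding g_def using okL[OF ok i(1)] i(3) by blast
    obtain \<phi>' A' where R: "partial_emb V' \<phi>' A'" "A i \<subseteq> A'" "A' \<inter> X = {}" "A' \<subseteq> nonzero_diffs"
      "\<forall>v\<in>S i. \<phi>' v = \<phi> i v" "\<phi>' ` (V' - S i) \<inter> two_layers g = {}"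
      using leaf_phase[OF pe order_refl S(2)[OF i(1)] g lay lv[OF i(1)] X1 X2 AX An sl num] by auto
    have "ok (Suc n) (\<phi>(i := \<phi>')) (A(i := A'))"
      unfolding ok_def
    proof (intro conjI allI impI)
      fix k assume k: "k \<le> N"
      show "partial_emb (T (Suc n) k) ((\<phi>(i := \<phi>')) k) ((A(i := A')) k)"
      proof (cases "k = i")
        case True
        thus ?thesis using R(1) by (simp add: T_def i_def)
      next
        case False
        hence "T (Suc n) k = T n k" by (auto simp: T_def i_def)
        thus ?thesis using okP(1)[OF ok k] False by simp
      qed
      show "(A(i := A')) k \<subseteq> nonzero_diffs" using R(4) okP(2)[OF ok k] by simp
    next
      fix k l assume kl: "k \<le> N" "l \<le> N" "k \<noteq> l"
      have "A k \<subseteq> X" if "k \<noteq> i" "k \<le> N" for k using that by (auto simp: X_def)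
      thus "(A(i := A')) k \<inter> (A(i := A')) l = {}"
        using R(3) okD[OF ok kl] kl by (cases "k = i"; cases "l = i") auto
    next
      fix k assume k: "k \<le> N" "even k" "0 < k"
      show "(0, int (k div 2)) \<notin> (\<phi>(i := \<phi>')) k ` T (Suc n) k"
      proof (cases "k = i")
        case True
        have Tk: "T (Suc n) k = V'" using True by (simp add: T_def i_def)
        have "(0, int (k div 2)) \<notin> \<phi> i ` S i" using okZ[OF ok k] True Ti by simp
        \<comment> \<open>The reserved position lies in the two layers that the new leaves
          avoid.\<close>
        moreover have "(0, int (k div 2)) \<in> two_layers g"
          using k True p_pos by (auto simp: g_def two_layers_def)
        ultimately have "(0, int (k div 2)) \<notin> \<phi>' ` S i" "(0, int (k div 2)) \<notin> \<phi>' ` (V' - S i)"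
          using R(5,6) by auto
        moreover have "V' = S i \<union> (V' - S i)" using S(2)[OF i(1)] by blast
        ultimately have "(0, int (k div 2)) \<notin> \<phi>' ` V'" by (metis Un_iff image_Un)
        thus ?thesis using True Tk by simp
      next
        case False
        hence "T (Suc n) k = T n k" by (auto simp: T_def i_def)
        thus ?thesis using okZ[OF ok k] False by simp
      qed
    next
      have "A 0 \<union> A 1 \<subseteq> (A(i := A')) 0 \<union> (A(i := A')) 1" using R(2) by auto
      thus "slice 0 \<subseteq> (A(i := A')) 0 \<union> (A(i := A')) 1" using okS[OF ok] by (rule order_trans[rotated])
    next
      fix k assume k: "k \<le> N" "k = 0 \<or> Suc n < k"
      hence "k \<noteq> i" "k = 0 \<or> n < k" by (auto simp: i_def)
      thus "(\<phi>(i := \<phi>')) k ` S k \<subseteq> two_layers (int ((k + 1) div 2))"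
        using okL[OF ok k(1)] unfolding fun_upd_other[OF \<open>k \<noteq> i\<close>] by blast
    qed
    thus ?case by blast
  qed
  then obtain \<phi> A where ok: "ok N \<phi> A" by blast
  have pe: "partial_emb (S 0) (\<phi> 0) (A 0)" using okP(1)[OF ok, of 0] by (simp add: T_def)
  define X where "X = (\<Union>k\<in>{1..N}. A k)"
  have fA: "finite (A k)" if "k \<le> N" for k
    using finite_subset[OF okP(2)[OF ok that] nonzero_diffs_facts(1)] .
  have X1: "neg d \<in> X" if "d \<in> X" for d
  proof -
    obtain k where "1 \<le> k" "k \<le> N" "d \<in> A k" using \<open>d \<in> X\<close> unfolding X_def by auto
    moreover from this have "neg d \<in> A k" using partial_emb_diffs(1)[OF okP(1)[OF ok]] by blast
    ultimately show ?thesis unfolding X_def by auto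
  qed
  have X2: "X \<subseteq> nonzero_diffs" unfolding X_def by (intro UN_least okP(2)[OF ok]) simp
  have A0X: "A 0 \<inter> X = {}"
  proof -
    have "A 0 \<inter> A k = {}" if "k \<in> {1..N}" for k using okD[OF ok, of 0 k] that by auto
    thus ?thesis unfolding X_def by blast
  qed
  have A0n: "A 0 \<subseteq> nonzero_diffs" using okP(2)[OF ok, of 0] by simp
  have sl: "slice 0 \<subseteq> A 0 \<union> X"
  proof -
    have "A 1 \<subseteq> X" using N1 by (auto simp: X_def)
    thus ?thesis using okS[OF ok] by blast
  qed
  have "card X = (\<Sum>k\<in>{1..N}. card (A k))"
    unfolding X_def using fA okD[OF ok] by (intro card_UN_disjoint) auto
  also have "\<dots> = (\<Sum>k\<in>{1..N}. 2 * m)" by (intro sum.cong refl cardA(3)[OF ok]) auto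
  finally have cX: "card X = N * (2 * m)" by simp
  have "card (V' - S 0) = m - m1"
    using S(2)[OF le0] fV m(2) finite_subset[OF S(2)[OF le0] fV] F(5) by (simp add: card_Diff_subset S_def)
  hence num0: "card (A 0) + card X + 2 * card (V' - S 0) = card nonzero_diffs"
    unfolding cardNZ cX using cardA(2)[OF ok, of 0] m(3) by (simp add: algebra_simps)
  have lay0: "\<phi> 0 ` S 0 \<subseteq> two_layers 0" using okL[OF ok, of 0] by simp
  obtain \<phi>0 A0 where Z: "partial_emb V' \<phi>0 A0" "A0 \<inter> X = {}" "A0 \<subseteq> nonzero_diffs"
    using absorb_leaves[OF pe S(2)[OF le0] lay0 lv[OF le0] X1 X2 A0X A0n sl num0] by auto
  show thesis
  proof (rule that[of "\<phi>(0 := \<phi>0)" "A(0 := A0)"])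
    fix i assume i: "i \<le> 2 * nat q"
    have "partial_emb V' (\<phi> i) (A i) \<and> A i \<subseteq> nonzero_diffs" if "i \<noteq> 0"
      using okP[OF ok, of i] that i by (simp add: T_def N_def)
    thus "partial_emb V' ((\<phi>(0 := \<phi>0)) i) ((A(0 := A0)) i) \<and> (A(0 := A0)) i \<subseteq> nonzero_diffs"
      using Z by auto
    fix k assume k: "k \<le> 2 * nat q" "i \<noteq> k"
    have "A k \<subseteq> X" if "k \<noteq> 0" "k \<le> N" for k using that by (auto simp: X_def Suc_le_eq)
    thus "(A(0 := A0)) i \<inter> (A(0 := A0)) k = {}"
      using Z(2) okD[OF ok, of i k] i k unfolding N_def[symmetric] by (cases "i = 0"; cases "k = 0") auto
  next
    fix i assume i: "i \<le> 2 * nat q" "even i" "0 < i"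
    hence "T N i = V'" by (auto simp: T_def N_def)
    thus "(0, int (i div 2)) \<notin> (\<phi>(0 := \<phi>0)) i ` V'"
      using okZ[OF ok, of i] i by (simp add: N_def)
  qed
qed

end

context grid begin

section \<open>The decomposition\<close>

lemma add_assoc: "add (add a b) c = add a (add b c)"
  by (auto simp: add_def mod_add_left_eq mod_add_right_eq ac_simps)

lemma add_swap: "add (add a d) g = add (add a g) d"
  by (metis add_assoc add_commute)

definition enc :: "nat \<Rightarrow> int \<times> int \<Rightarrow> nat" where
  "enc t z = t + (nat (fst z) * nat r + nat (snd z))"

lemma enc_ge: "t \<le> enc t z" by (simp add: enc_def)

lemma enc_less: "z \<in> L \<Longrightarrow> enc t z < nat r * nat p + t"
proof -
  assume "z \<in> L"
  hence "nat (fst z) < nat p" "nat (snd z) < nat r" by (auto simp: L_def)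
  hence "nat (fst z) * nat r + nat (snd z) < (nat (fst z) + 1) * nat r" "nat (fst z) + 1 \<le> nat p"
    by (simp_all add: Suc_leI)
  moreover from this(2) have "(nat (fst z) + 1) * nat r \<le> nat p * nat r" by (rule mult_le_mono1)
  ultimately have "nat (fst z) * nat r + nat (snd z) < nat p * nat r" by linarith
  thus ?thesis by (simp add: enc_def mult.commute)
qed

lemma enc_inj: "\<lbrakk>y \<in> L; z \<in> L; enc t y = enc t z\<rbrakk> \<Longrightarrow> y = z"
proof -
  assume h: "y \<in> L" "z \<in> L" "enc t y = enc t z"
  have b: "nat (snd y) < nat r" "nat (snd z) < nat r" "0 \<le> fst y" "0 \<le> fst z" "0 \<le> snd y" "0 \<le> snd z"
    using h(1,2) by (auto simp: L_def)
  have e: "nat (fst y) * nat r + nat (snd y) = nat (fst z) * nat r + nat (snd z)"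
    using h(3) by (simp add: enc_def)
  have "(nat (fst y) * nat r + nat (snd y)) div nat r = nat (fst y)"
    "(nat (fst z) * nat r + nat (snd z)) div nat r = nat (fst z)"
    using b r_pos by simp_all
  hence "nat (fst y) = nat (fst z)" using e by simp
  moreover from this have "nat (snd y) = nat (snd z)" using e by simp
  ultimately have "fst y = fst z" "snd y = snd z" using b(3-6) eq_nat_nat_iff by blast+
  thus "y = z" by (simp add: prod_eq_iff)
qed

lemma enc_surj:
  assumes "t \<le> k" "k < nat r * nat p + t"
  obtains z where "z \<in> L" "k = enc t z"
proof
  let ?z = "(int ((k - t) div nat r), int ((k - t) mod nat r))"
  have "k - t < nat p * nat r" using assms by (simp add: mult.commute less_diff_conv2)
  hence "(k - t) div nat r < nat p" by (simp add: less_mult_imp_div_less)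
  moreover have "(k - t) mod nat r < nat r" using r_pos by simp
  ultimately show "?z \<in> L" by (auto simp: L_def)
  show "k = enc t ?z" using assms(1) by (simp add: enc_def)
qed

end

context tree_grid begin

text \<open>Used to read a difference back as an edge, when the translates are shown to cover
  everything.\<close>

lemma partial_emb_diff_of_edge:
  "partial_emb S \<phi> A \<Longrightarrow> d \<in> A \<Longrightarrow> \<exists>a\<in>S. \<exists>b\<in>S. {a, b} \<in> E \<and> d = sub (\<phi> b) (\<phi> a)"
proof (induction rule: partial_emb.induct)
  case (step S \<phi> A u v y)
  have uv: "u \<noteq> v" "v \<notin> S" using step.hyps by auto
  consider "d = sub y (\<phi> u)" | "d = sub (\<phi> u) y" | "d \<in> A" using step.prems by blast
  thus ?case
  proof cases
    case 1
    thus ?thesis using uv step.hyps by (intro bexI[of _ u] bexI[of _ v]) auto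
  next
    case 2
    thus ?thesis using uv step.hyps by (intro bexI[of _ v] bexI[of _ u]) (auto simp: insert_commute)
  next
    case 3
    then obtain a b where "a \<in> S" "b \<in> S" "{a, b} \<in> E" "d = sub (\<phi> b) (\<phi> a)" using step.IH by blast
    thus ?thesis using uv by (intro bexI[of _ a] bexI[of _ b]) auto
  qed
qed simp

end

context odd_tree_grid begin

text \<open>The method of differences: an edge between two group elements determines its copy by its
  difference and then the translate by its position. An edge at an independent vertex determines its
  copy by that vertex and the translate by its other end, since \<open>w\<close> is moved from the
  origin to \<open>\<gamma>\<close>.\<close>

lemma family_decomposes:
  assumes p: "p = 2 * int m + 1" "card V' = m + 1"
    and fam: "\<And>i. i \<le> 2 * nat q \<Longrightarrow> partial_emb V' (\<phi> i) (A i) \<and> A i \<subseteq> nonzero_diffs"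
      "\<And>i k. \<lbrakk>i \<le> 2 * nat q; k \<le> 2 * nat q; i \<noteq> k\<rbrakk> \<Longrightarrow> A i \<inter> A k = {}"
      "\<And>i. \<lbrakk>i \<le> 2 * nat q; even i; 0 < i\<rbrakk> \<Longrightarrow> (0, int (i div 2)) \<notin> \<phi> i ` V'"
    and x0: "V = insert x0 V'" "x0 \<notin> V'" "\<And>u. {x0, u} \<in> E \<longleftrightarrow> u = w"
    and t: "t = nat q + 1"
  shows "decomposes (V, E) (complete_minus_clique (nat r * nat p + t) t)"
proof -
  define N where "N = 2 * nat q"
  note fam = fam[folded N_def]
  define K where "K = complete_minus_clique (nat r * nat p + t) t"
  have edK: "edges K = all_pairs {..<nat r * nat p + t} - all_pairs {..<t}"
    and veK: "verts K = {..<nat r * nat p + t}" by (simp_all add: K_def complete_minus_clique_def)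
  have facts: "inj_on (\<phi> i) V'" "\<phi> i ` V' \<subseteq> L" "\<phi> i w = (0, 0)" "rainbow V' (\<phi> i)"
    "\<And>a b. \<lbrakk>a \<in> V'; b \<in> V'; {a, b} \<in> E\<rbrakk> \<Longrightarrow> sub (\<phi> i b) (\<phi> i a) \<in> A i" "card (A i) = 2 * m"
    if "i \<le> N" for i
    using partial_emb_facts[of V' "\<phi> i" "A i"] fam(1)[OF that] p(2) by auto
  have wV': "w \<in> V'" using V'(2) by (simp add: connected_from_def)
  define finite_at where "finite_at i v \<longleftrightarrow> v \<in> V' \<or> (v = x0 \<and> even i \<and> 0 < i)" for i :: nat and v
  \<comment> \<open>As \<open>w\<close> sits at the origin, the edge at \<open>x0\<close> then has
    the differences \<open>(0, g)\<close> and \<open>(0, r - g)\<close> with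
    \<open>g = i div 2\<close>.\<close>
  define pos where "pos i v = (if v = x0 then (0, int (i div 2)) else \<phi> i v)" for i v
  \<comment> \<open>Numbers below \<open>t\<close> are the vertices of the independent set; the translates of copy \<open>i\<close> send \<open>x0\<close> to
    the vertex \<open>(i + 1) div 2\<close> of it when \<open>i\<close> is odd or 0.\<close>
  define \<Phi> where "\<Phi> i \<gamma> v = (if finite_at i v then enc t (add (pos i v) \<gamma>) else (i + 1) div 2)" for i \<gamma> v
  have pos_L: "pos i v \<in> L" if "i \<le> N" "finite_at i v" for i v
    using that facts(2)[OF that(1)] p_pos qr unfolding finite_at_def pos_def N_def by (auto simp: L_def)
  have pos_inj: "a = b" if "i \<le> N" "finite_at i a" "finite_at i b" "pos i a = pos i b" for i a b
  proof -
    have V: "v \<in> V'" if "finite_at i v" "v \<noteq> x0" for v using that by (auto simp: finite_at_def)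
    have no: False if "finite_at i x0" "finite_at i v" "v \<noteq> x0" "pos i v = pos i x0" for v
    proof -
      have "even i" "0 < i" using that(1) x0(2) by (auto simp: finite_at_def)
      hence "(0, int (i div 2)) \<notin> \<phi> i ` V'" using fam(3) \<open>i \<le> N\<close> by blast
      moreover have "\<phi> i v = (0, int (i div 2))" using that(3,4) by (simp add: pos_def)
      ultimately show False using V[OF that(2,3)] by (metis imageI)
    qed
    show ?thesis
    proof (cases "a = x0 \<or> b = x0")
      case True
      thus ?thesis using no[of a] no[of b] that by metis
    next
      case False
      hence "\<phi> i a = \<phi> i b" using that(4) by (simp add: pos_def)
      thus ?thesis using inj_onD[OF facts(1)[OF that(1)]] V that(2,3) False by blast
    qed
  qed
  have inf: "v = x0" "(i + 1) div 2 < t" "i = 0 \<or> odd i" if "i \<le> N" "v \<in> V" "\<not> finite_at i v" for i v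
    using that x0(1) unfolding finite_at_def N_def t by auto
  have \<Phi>_fin: "\<Phi> i \<gamma> v = enc t (add (pos i v) \<gamma>)" if "finite_at i v" for i \<gamma> v using that by (simp add: \<Phi>_def)
  have \<Phi>_inf: "\<Phi> i \<gamma> v = (i + 1) div 2" if "\<not> finite_at i v" for i \<gamma> v unfolding \<Phi>_def using that by simp
  have \<Phi>_less: "\<Phi> i \<gamma> v < t \<longleftrightarrow> \<not> finite_at i v" if "i \<le> N" "v \<in> V" for i \<gamma> v
    using inf(2)[OF that] \<Phi>_fin[of i v \<gamma>] \<Phi>_inf[of i v \<gamma>] enc_ge[of t] by (cases "finite_at i v") (auto simp: not_less)
  have \<Phi>_n: "\<Phi> i \<gamma> v < nat r * nat p + t" if "i \<le> N" "v \<in> V" for i \<gamma> v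
    using inf(2)[OF that] \<Phi>_fin[of i v \<gamma>] \<Phi>_inf[of i v \<gamma>] enc_less[of "add (pos i v) \<gamma>" t] L_closed(1)
    by (cases "finite_at i v") (auto intro: trans_less_add2)
  have \<Phi>_inj: "inj_on (\<Phi> i \<gamma>) V" if i: "i \<le> N" for i \<gamma>
  proof (rule inj_onI)
    fix a b assume h: "a \<in> V" "b \<in> V" "\<Phi> i \<gamma> a = \<Phi> i \<gamma> b"
    have iff: "finite_at i a \<longleftrightarrow> finite_at i b" using \<Phi>_less[OF i h(1), of \<gamma>] \<Phi>_less[OF i h(2), of \<gamma>] h(3) by simp
    show "a = b"
    proof (cases "finite_at i a")
      case True
      hence b: "finite_at i b" using iff by simp
      have "add (pos i a) \<gamma> = add (pos i b) \<gamma>"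
        using h(3) unfolding \<Phi>_fin[OF True] \<Phi>_fin[OF b] by (rule enc_inj[OF L_closed(1) L_closed(1)])
      hence "pos i a = pos i b"
        using add_eq_iff[OF pos_L[OF i True] pos_L[OF i b], of \<gamma>] by (simp add: add_commute)
      thus ?thesis by (rule pos_inj[OF i True b])
    next
      case False
      thus ?thesis using inf(1)[OF i h(1)] inf(1)[OF i h(2)] iff by simp
    qed
  qed
  define \<Delta> where "\<Delta> i a b = sub (pos i b) (pos i a)" for i a b
  have x0w: "{x0, w} \<in> E" "w \<noteq> x0" using x0(2,3) wV' by auto
  have half: "1 \<le> int (i div 2)" "int (i div 2) \<le> q" "i = 2 * (i div 2)" if "i \<le> N" "even i" "0 < i" for i
    using that qr unfolding N_def by auto
  have \<Delta>_cases: "(a \<in> V' \<and> b \<in> V' \<and> \<Delta> i a b \<in> A i \<and> \<Delta> i a b = sub (\<phi> i b) (\<phi> i a)) \<or>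
      (a = w \<and> b = x0 \<and> even i \<and> 0 < i \<and> \<Delta> i a b = (0, int (i div 2))) \<or>
      (a = x0 \<and> b = w \<and> even i \<and> 0 < i \<and> \<Delta> i a b = (0, r - int (i div 2)))"
    if i: "i \<le> N" and e: "{a, b} \<in> E" and f: "finite_at i a" "finite_at i b" for i a b
  proof -
    consider "a \<in> V'" "b \<in> V'" | "a = x0" "even i" "0 < i" | "b = x0" "even i" "0 < i" "a \<noteq> x0"
      using f unfolding finite_at_def by blast
    thus ?thesis
    proof cases
      case 1
      hence "pos i a = \<phi> i a" "pos i b = \<phi> i b" using x0(2) by (auto simp: pos_def)
      thus ?thesis using 1 facts(5)[OF i 1 e] by (simp add: \<Delta>_def)
    next
      case 2
      hence "b = w" using e x0(3) by simp
      thus ?thesis using 2 half[OF i 2(2,3)] qr facts(3)[OF i] x0w(2) mod_minus_pos[of "int (i div 2)" r]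
        by (auto simp: \<Delta>_def pos_def sub_def)
    next
      case 3
      hence "a = w" using e x0(3)[of a] by (simp add: insert_commute)
      thus ?thesis using 3 half[OF i 3(2,3)] qr facts(3)[OF i] x0w(2)
        by (auto simp: \<Delta>_def pos_def sub_def)
    qed
  qed
  have A_fst: "fst d \<noteq> 0" if "d \<in> A i" "i \<le> N" for d i
    using fam(1)[OF that(2)] that(1) by (auto simp: nonzero_diffs_def)
  have \<Delta>_inj: "i = i' \<and> a = a' \<and> b = b'"
    if i: "i \<le> N" "i' \<le> N" and e: "{a, b} \<in> E" "{a', b'} \<in> E"
      and f: "finite_at i a" "finite_at i b" "finite_at i' a'" "finite_at i' b'"
      and eq: "\<Delta> i a b = \<Delta> i' a' b'" for i i' a b a' b'
  proof -
    note c1 = \<Delta>_cases[OF i(1) e(1) f(1,2)] and c2 = \<Delta>_cases[OF i(2) e(2) f(3,4)]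
    show ?thesis
    proof (cases "fst (\<Delta> i a b) = 0")
      case False
      have 1: "a \<in> V'" "b \<in> V'" "\<Delta> i a b \<in> A i" "\<Delta> i a b = sub (\<phi> i b) (\<phi> i a)"
        using c1 False by auto
      have 2: "a' \<in> V'" "b' \<in> V'" "\<Delta> i' a' b' \<in> A i'" "\<Delta> i' a' b' = sub (\<phi> i' b') (\<phi> i' a')"
        using c2 False eq by auto
      have ii: "i = i'" using fam(2)[OF i] 1(3) 2(3) eq by auto
      have "sub (\<phi> i b) (\<phi> i a) = sub (\<phi> i b') (\<phi> i a')" using eq 1(4) 2(4) ii by simp
      thus ?thesis using facts(4)[OF i(1)] 1(1,2) 2(1,2) e ii unfolding rainbow_def by blast
    next
      case True
      have 1: "(a = w \<and> b = x0 \<and> even i \<and> 0 < i \<and> \<Delta> i a b = (0, int (i div 2))) \<or>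
          (a = x0 \<and> b = w \<and> even i \<and> 0 < i \<and> \<Delta> i a b = (0, r - int (i div 2)))"
        using c1 True A_fst[of "\<Delta> i a b" i] i(1) by blast
      have 2: "(a' = w \<and> b' = x0 \<and> even i' \<and> 0 < i' \<and> \<Delta> i' a' b' = (0, int (i' div 2))) \<or>
          (a' = x0 \<and> b' = w \<and> even i' \<and> 0 < i' \<and> \<Delta> i' a' b' = (0, r - int (i' div 2)))"
        using c2 True A_fst[of "\<Delta> i' a' b'" i'] i(2) unfolding eq by blast
      have ev: "even i" "0 < i" "even i'" "0 < i'" using 1 2 by auto
      note h = half[OF i(1) ev(1,2)] half[OF i(2) ev(3,4)]
      \<comment> \<open>Both halves are at most \<open>q\<close>, whereas \<open>r - g\<close>
        exceeds \<open>q\<close> whenever \<open>g \<le> q\<close>.\<close>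
      have no: "int (i div 2) \<noteq> r - int (i' div 2)" "r - int (i div 2) \<noteq> int (i' div 2)"
        using h qr by linarith+
      have "i div 2 = i' div 2 \<and> a = a' \<and> b = b'" using 1 2 eq no by auto
      thus ?thesis using h(3,6) by simp
    qed
  qed
  have \<Delta>_surj: "\<exists>i a b. i \<le> N \<and> {a, b} \<in> E \<and> finite_at i a \<and> finite_at i b \<and> \<Delta> i a b = d"
    if d: "d \<in> L" "d \<noteq> (0, 0)" for d
  proof (cases "fst d = 0")
    case False
    hence dn: "d \<in> nonzero_diffs" using d(1) by (auto simp: nonzero_diffs_def L_def)
    have fA: "finite (A i)" if "i \<le> N" for i
      using fam(1)[OF that] nonzero_diffs_facts(1) finite_subset by blast
    \<comment> \<open>Covering follows by counting: \<open>r\<close> disjoint sets of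
      \<open>2 * m = p - 1\<close> elements fill \<open>nonzero_diffs\<close>.\<close>
    have "card (\<Union>i\<in>{..N}. A i) = (\<Sum>i\<in>{..N}. card (A i))"
      using fA fam(2) by (intro card_UN_disjoint) auto
    also have "\<dots> = (\<Sum>i\<in>{..N}. 2 * m)" by (intro sum.cong refl facts(6)) simp
    also have "\<dots> = card nonzero_diffs"
    proof -
      have "nat (p - 1) = 2 * m" using p(1) by simp
      moreover have "nat r = N + 1" using qr by (simp add: N_def)
      ultimately show ?thesis by (simp add: nonzero_diffs_def card_cartesian_product)
    qed
    finally have "card (\<Union>i\<in>{..N}. A i) = card nonzero_diffs" .
    moreover have "(\<Union>i\<in>{..N}. A i) \<subseteq> nonzero_diffs" using fam(1) by blast
    ultimately have "(\<Union>i\<in>{..N}. A i) = nonzero_diffs" using nonzero_diffs_facts(1) by (metis card_subset_eq)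
    then obtain i where i: "i \<le> N" "d \<in> A i" using dn by blast
    have pe: "partial_emb V' (\<phi> i) (A i)" using fam(1)[OF i(1)] by simp
    obtain a b where ab: "a \<in> V'" "b \<in> V'" "{a, b} \<in> E" "d = sub (\<phi> i b) (\<phi> i a)"
      using partial_emb_diff_of_edge[OF pe i(2)] by blast
    have "a \<noteq> x0" "b \<noteq> x0" using ab x0(2) by auto
    hence "\<Delta> i a b = d" using ab(4) by (simp add: \<Delta>_def pos_def)
    thus ?thesis using i(1) ab(1-3) unfolding finite_at_def by blast
  next
    case True
    define h where "h = snd d"
    have h: "0 < h" "h < r" "d = (0, h)" using d True by (auto simp: h_def L_def prod_eq_iff)
    define i where "i = 2 * nat (if h \<le> q then h else r - h)"
    have i: "i \<le> N" "even i" "0 < i" "int (i div 2) = (if h \<le> q then h else r - h)"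
      using h qr unfolding i_def N_def by auto
    have f: "finite_at i x0" "finite_at i w" using i wV' by (auto simp: finite_at_def)
    have e: "{w, x0} \<in> E" using x0w(1) by (simp add: insert_commute)
    have "\<Delta> i w x0 = (0, int (i div 2))" using \<Delta>_cases[OF i(1) e f(2,1)] x0w(2) x0(2) by auto
    moreover have "\<Delta> i x0 w = (0, r - int (i div 2))" using \<Delta>_cases[OF i(1) x0w(1) f] x0w(2) x0(2) by auto
    ultimately have "\<Delta> i w x0 = d \<or> \<Delta> i x0 w = d" using i(4) h(3) by auto
    thus ?thesis using i(1) f e x0w(1) by blast
  qed
  define part where "part i \<gamma> = (\<lambda>e. \<Phi> i \<gamma> ` e) ` E" for i \<gamma>
  have edge_form: "\<exists>a b. e = {a, b} \<and> a \<noteq> b \<and> a \<in> V \<and> b \<in> V" if "e \<in> E" for e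
  proof -
    have "e \<subseteq> V" "card e = 2" using tree that by (auto simp: tree_def simple_graph_def)
    then obtain a b where "e = {a, b}" "a \<noteq> b" by (auto simp: card_2_iff)
    thus ?thesis using \<open>e \<subseteq> V\<close> by blast
  qed
  have some_fin: "finite_at i a \<or> finite_at i b" if "{a, b} \<in> E" "i \<le> N" for i a b
    using inf(1)[OF that(2)] edge_verts[OF that(1)] edge_ne[OF that(1)] by metis
  have part_sub: "part i \<gamma> \<subseteq> edges K" if i: "i \<le> N" for i \<gamma>
  proof
    fix e' assume "e' \<in> part i \<gamma>"
    then obtain a b where ab: "{a, b} \<in> E" "e' = {\<Phi> i \<gamma> a, \<Phi> i \<gamma> b}" "a \<noteq> b" "a \<in> V" "b \<in> V"
      using edge_form unfolding part_def by blast
    have ne: "\<Phi> i \<gamma> a \<noteq> \<Phi> i \<gamma> b" using inj_onD[OF \<Phi>_inj[OF i, of \<gamma>]] ab(3-5) by blast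
    have "\<not> (\<Phi> i \<gamma> a < t \<and> \<Phi> i \<gamma> b < t)"
      using some_fin[OF ab(1) i] \<Phi>_less[OF i ab(4)] \<Phi>_less[OF i ab(5)] by blast
    thus "e' \<in> edges K"
      using ne \<Phi>_n[OF i ab(4)] \<Phi>_n[OF i ab(5)] unfolding edK all_pairs_def ab(2) by auto
  qed
  have cover: "\<exists>i\<le>N. \<exists>\<gamma>\<in>L. e' \<in> part i \<gamma>" if "e' \<in> edges K" for e'
  proof -
    obtain y z where yz: "e' = {y, z}" "y \<noteq> z" "y < nat r * nat p + t" "z < nat r * nat p + t" "t \<le> z"
    proof -
      have c: "card e' = 2" "e' \<subseteq> {..<nat r * nat p + t}" "\<not> e' \<subseteq> {..<t}"
        using \<open>e' \<in> edges K\<close> unfolding edK all_pairs_def by auto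
      obtain a b where "e' = {a, b}" "a \<noteq> b" using c(1) by (auto simp: card_2_iff)
      thus thesis using c(2,3) that[of a b] that[of b a] by (cases "t \<le> b") (auto simp: insert_commute)
    qed
    obtain z' where z': "z' \<in> L" "z = enc t z'" using enc_surj[OF yz(5,4)] .
    show ?thesis
    proof (cases "y < t")
      case True
      \<comment> \<open>The inverse of \<open>(i + 1) div 2\<close> on the indices 0 and odd, which
        are those that send \<open>x0\<close> to an independent vertex.\<close>
      define i where "i = (if y = 0 then 0 else 2 * y - 1)"
      have i: "i \<le> N" "(i + 1) div 2 = y" "i = 0 \<or> odd i" using True unfolding i_def N_def t by auto
      have "\<not> finite_at i x0" using i(3) x0(2) by (auto simp: finite_at_def)
      hence "\<Phi> i z' x0 = y" using i(2) \<Phi>_inf by simp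
      moreover have "\<Phi> i z' w = z"
        using wV' x0w(2) facts(3)[OF i(1)] z' by (simp add: \<Phi>_def finite_at_def pos_def)
      ultimately have "\<Phi> i z' ` {x0, w} = e'" using yz(1) by simp
      thus ?thesis using i(1) z'(1) x0w(1) unfolding part_def by blast
    next
      case False
      obtain y' where y': "y' \<in> L" "y = enc t y'" using enc_surj[of t y] False yz(3) by auto
      have "y' \<noteq> z'" using yz(2) y' z' by auto
      hence "sub z' y' \<noteq> (0, 0)" using sub_eq_0_iff[OF z'(1) y'(1)] by simp
      then obtain i a b where i: "i \<le> N" "{a, b} \<in> E" "finite_at i a" "finite_at i b" "\<Delta> i a b = sub z' y'"
        using \<Delta>_surj[of "sub z' y'"] by auto
      define \<gamma> where "\<gamma> = sub y' (pos i a)"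
      have 1: "add (pos i a) \<gamma> = y'" unfolding \<gamma>_def using y'(1) by simp
      have "pos i b = add (pos i a) (\<Delta> i a b)" unfolding \<Delta>_def using pos_L[OF i(1,4)] by simp
      hence "add (pos i b) \<gamma> = add (add (pos i a) \<gamma>) (\<Delta> i a b)" by (simp add: add_swap)
      hence 2: "add (pos i b) \<gamma> = z'" using 1 i(5) z'(1) by simp
      have "\<Phi> i \<gamma> ` {a, b} = e'" using \<Phi>_fin[OF i(3)] \<Phi>_fin[OF i(4)] 1 2 y' z' yz(1) by simp
      moreover have "\<gamma> \<in> L" by (simp add: \<gamma>_def)
      ultimately show ?thesis using i(1,2) unfolding part_def by blast
    qed
  qed
  have fin_case: "i = i' \<and> \<gamma> = \<gamma>'"
    if i: "i \<le> N" "i' \<le> N" and g: "\<gamma> \<in> L" "\<gamma>' \<in> L" and e: "{a, b} \<in> E" "{a', b'} \<in> E"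
      and eq: "\<Phi> i \<gamma> a = \<Phi> i' \<gamma>' a'" "\<Phi> i \<gamma> b = \<Phi> i' \<gamma>' b'" for i i' \<gamma> \<gamma>' a b a' b'
  proof -
    note v = edge_verts[OF e(1)] edge_verts[OF e(2)]
    have fa: "finite_at i a \<longleftrightarrow> finite_at i' a'" "finite_at i b \<longleftrightarrow> finite_at i' b'"
      using \<Phi>_less[OF i(1), of a \<gamma>] \<Phi>_less[OF i(2), of a' \<gamma>'] \<Phi>_less[OF i(1), of b \<gamma>] \<Phi>_less[OF i(2), of b' \<gamma>'] v eq by auto
    have dec: "add (pos i c) \<gamma> = add (pos i' c') \<gamma>'"
      if "finite_at i c" "finite_at i' c'" "\<Phi> i \<gamma> c = \<Phi> i' \<gamma>' c'" for c c'
      using that(3) unfolding \<Phi>_fin[OF that(1)] \<Phi>_fin[OF that(2)]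
      by (rule enc_inj[OF L_closed(1) L_closed(1)])
    have infc: "i = i' \<and> \<gamma> = \<gamma>'"
      if c: "{c, d} \<in> E" "{c', d'} \<in> E" "\<not> finite_at i c" "\<not> finite_at i' c'"
        "\<Phi> i \<gamma> c = \<Phi> i' \<gamma>' c'" "\<Phi> i \<gamma> d = \<Phi> i' \<gamma>' d'" for c d c' d'
    proof -
      note vv = edge_verts[OF c(1)] edge_verts[OF c(2)]
      have x: "c = x0" "c' = x0" "i = 0 \<or> odd i" "i' = 0 \<or> odd i'"
        using inf(1,3)[OF i(1) _ c(3)] inf(1,3)[OF i(2) _ c(4)] vv by auto
      have dw: "d = w" "d' = w" using c(1,2) x x0(3) by auto
      have "(i + 1) div 2 = (i' + 1) div 2" using c(5) unfolding \<Phi>_inf[OF c(3)] \<Phi>_inf[OF c(4)] .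
      hence ii: "i = i'" using x(3,4) by presburger
      have fw: "finite_at i w" "finite_at i' w" using wV' by (auto simp: finite_at_def)
      have "pos i w = (0, 0)" "pos i' w = (0, 0)" using facts(3) i x0w(2) by (auto simp: pos_def)
      hence "\<gamma> = \<gamma>'" using dec[OF fw] c(6) dw g by simp
      thus ?thesis using ii by simp
    qed
    show ?thesis
    proof (cases "finite_at i a \<and> finite_at i b")
      case True
      hence f: "finite_at i a" "finite_at i b" "finite_at i' a'" "finite_at i' b'" using fa by auto
      have ad: "add (pos i a) \<gamma> = add (pos i' a') \<gamma>'" "add (pos i b) \<gamma> = add (pos i' b') \<gamma>'"
        using dec[OF f(1,3) eq(1)] dec[OF f(2,4) eq(2)] .
      have "\<Delta> i a b = \<Delta> i' a' b'"
        unfolding \<Delta>_def using sub_translate[of "pos i b" \<gamma> "pos i a"] sub_translate[of "pos i' b'" \<gamma>' "pos i' a'"] ad by simp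
      hence "i = i'" "a = a'" using \<Delta>_inj[OF i e f] by auto
      moreover from this have "\<gamma> = \<gamma>'" using ad(1) add_eq_iff[OF g] by simp
      ultimately show ?thesis by simp
    next
      case False
      show ?thesis
      proof (cases "finite_at i a")
        case a: True
        hence "\<not> finite_at i b" using False by simp
        thus ?thesis using infc[of b a b' a'] e fa eq by (simp add: insert_commute)
      next
        case a: False
        thus ?thesis using infc[OF e _ _ eq] fa by simp
      qed
    qed
  qed
  have unique: "i = i' \<and> \<gamma> = \<gamma>'"
    if i: "i \<le> N" "i' \<le> N" and g: "\<gamma> \<in> L" "\<gamma>' \<in> L" and e: "e' \<in> part i \<gamma>" "e' \<in> part i' \<gamma>'" for i i' \<gamma> \<gamma>' e'
  proof -
    obtain a b where ab: "{a, b} \<in> E" "e' = {\<Phi> i \<gamma> a, \<Phi> i \<gamma> b}" using e(1) edge_form unfolding part_def by blast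
    obtain a' b' where ab': "{a', b'} \<in> E" "e' = {\<Phi> i' \<gamma>' a', \<Phi> i' \<gamma>' b'}" using e(2) edge_form unfolding part_def by blast
    have "(\<Phi> i \<gamma> a = \<Phi> i' \<gamma>' a' \<and> \<Phi> i \<gamma> b = \<Phi> i' \<gamma>' b') \<or> (\<Phi> i \<gamma> a = \<Phi> i' \<gamma>' b' \<and> \<Phi> i \<gamma> b = \<Phi> i' \<gamma>' a')"
      using ab(2) ab'(2) by (metis doubleton_eq_iff)
    moreover have "{b', a'} \<in> E" using ab'(1) by (simp add: insert_commute)
    ultimately show ?thesis using fin_case[OF i g ab(1)] ab'(1) by blast
  qed
  have partne: "part i \<gamma> \<noteq> {}" for i \<gamma> using x0w(1) by (auto simp: part_def)
  define P where "P = {part i \<gamma> |i \<gamma>. i \<le> N \<and> \<gamma> \<in> L}"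
  have Pform: "\<exists>i\<le>N. \<exists>\<gamma>\<in>L. a = part i \<gamma>" if "a \<in> P" for a
    using that unfolding P_def by auto
  have PI: "part i \<gamma> \<in> P" if "i \<le> N" "\<gamma> \<in> L" for i \<gamma>
    using that unfolding P_def by blast
  have "partition_on (edges K) P"
    unfolding partition_on_def
  proof (intro conjI)
    show "\<Union> P = edges K"
    proof (intro equalityI subsetI)
      fix x assume "x \<in> \<Union> P"
      then obtain a where a: "a \<in> P" "x \<in> a" by blast
      obtain i \<gamma> where "i \<le> N" "\<gamma> \<in> L" "a = part i \<gamma>" using Pform[OF a(1)] by blast
      thus "x \<in> edges K" using part_sub[of i \<gamma>] a(2) by blast
    next
      fix x assume "x \<in> edges K"
      then obtain i \<gamma> where "i \<le> N" "\<gamma> \<in> L" "x \<in> part i \<gamma>" using cover by blast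
      thus "x \<in> \<Union> P" using PI[of i \<gamma>] by blast
    qed
    show "disjoint P"
      unfolding disjoint_def
    proof (intro ballI impI)
      fix a b assume "a \<in> P" "b \<in> P" "a \<noteq> b"
      obtain i \<gamma> where "i \<le> N" "\<gamma> \<in> L" "a = part i \<gamma>" using Pform[OF \<open>a \<in> P\<close>] by blast
      moreover obtain i' \<gamma>' where "i' \<le> N" "\<gamma>' \<in> L" "b = part i' \<gamma>'" using Pform[OF \<open>b \<in> P\<close>] by blast
      ultimately show "a \<inter> b = {}" using unique[of i i' \<gamma> \<gamma>'] \<open>a \<noteq> b\<close> by blast
    qed
    show "{} \<notin> P"
    proof
      assume "{} \<in> P"
      from Pform[OF this] partne show False by metis
    qed
  qed
  moreover have "\<exists>S. subgraph S K \<and> graph_iso (V, E) S \<and> edges S = a" if "a \<in> P" for a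
  proof -
    obtain i \<gamma> where i: "i \<le> N" "\<gamma> \<in> L" "a = part i \<gamma>" using Pform[OF \<open>a \<in> P\<close>] by blast
    have iso: "graph_iso (V, E) (\<Phi> i \<gamma> ` V, part i \<gamma>)"
      unfolding graph_iso_def part_def using \<Phi>_inj[OF i(1), of \<gamma>] by (intro exI[of _ "\<Phi> i \<gamma>"]) (simp add: bij_betw_def)
    moreover have "simple_graph (V, E)" using tree by (simp add: tree_def)
    ultimately have "simple_graph (\<Phi> i \<gamma> ` V, part i \<gamma>)" by (metis simple_graph_iso)
    hence "subgraph (\<Phi> i \<gamma> ` V, part i \<gamma>) K"
      unfolding subgraph_def veK using \<Phi>_n[OF i(1), of _ \<gamma>] part_sub[OF i(1), of \<gamma>] by auto
    thus ?thesis using iso i(3) by (intro exI[of _ "(\<Phi> i \<gamma> ` V, part i \<gamma>)"]) simp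
  qed
  ultimately show ?thesis unfolding decomposes_def K_def by blast
qed

end

section \<open>Trees with a moderate number of non-leaves\<close>

theorem tree_decomposes_complete_minus_clique:
  fixes V :: "'a set" and r m :: nat
  assumes tree: "tree (V, E)" and cV: "card V = m + 2" and r: "odd r" "r \<ge> 3" and m: "m \<ge> 12"
    and I: "3 * card (inner_verts (V, E)) \<le> 2 * m" "4 * m + 27 \<le> 9 * card (inner_verts (V, E))"
  shows "decomposes (V, E) (complete_minus_clique (r * (2 * m + 1) + (r + 1) div 2) ((r + 1) div 2))"
proof -
  define I where "I = inner_verts (V, E)"
  have fV: "finite V" and sg: "\<And>e. e \<in> E \<Longrightarrow> e \<subseteq> V \<and> card e = 2"
    and con: "\<And>u v. \<lbrakk>u \<in> V; v \<in> V\<rbrakk> \<Longrightarrow> (u, v) \<in> (adjacency (V, E))\<^sup>*"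
    using tree by (auto simp: tree_def simple_graph_def connected_graph_def)
  have ev: "a \<in> V" "b \<in> V" "a \<noteq> b" if "{a, b} \<in> E" for a b
    using sg[OF that] by auto
  have I_iff: "v \<in> I \<longleftrightarrow> v \<in> V \<and> 2 \<le> card (neighbours E v)" for v
    by (simp add: I_def inner_verts_def)
  have nbV: "neighbours E v \<subseteq> V" for v using ev by (auto simp: neighbours_def)
  have nbf: "finite (neighbours E v)" for v using nbV fV finite_subset by blast
  have nb_ne: "neighbours E v \<noteq> {}" if "v \<in> V" for v
  proof -
    have "\<not> V \<subseteq> {v}" using card_mono[of "{v}" V] cV by auto
    then obtain u where u: "u \<in> V" "u \<noteq> v" by blast
    from con[OF \<open>v \<in> V\<close> u(1)] u(2) obtain x where "(v, x) \<in> adjacency (V, E)" by (metis converse_rtranclE)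
    thus ?thesis by (auto simp: adjacency_def neighbours_def)
  qed
  have leaf: "\<exists>u. neighbours E v = {u}" if "v \<in> V" "v \<notin> I" for v
  proof -
    have "card (neighbours E v) \<noteq> 0" using nb_ne[OF that(1)] nbf by simp
    hence "card (neighbours E v) = 1" using that I_iff[of v] by auto
    thus ?thesis by (rule card_1_singletonE) blast
  qed
  \<comment> \<open>Two adjacent leaves would form a component of their own, but the tree has more
    than two vertices.\<close>
  have leaf_nb: "u \<in> I" if "v \<in> V" "v \<notin> I" "{v, u} \<in> E" for u v
  proof (rule ccontr)
    note v = that
    assume "u \<notin> I"
    have u: "u \<in> V" using ev[OF that(3)] by simp
    obtain a where a: "neighbours E v = {a}" using leaf[OF v(1,2)] by blast
    obtain b where b: "neighbours E u = {b}" using leaf[OF u \<open>u \<notin> I\<close>] by blast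
    have "a = u" "b = v" using a b that(3) by (auto simp: neighbours_def insert_commute)
    have "x \<in> {u, v}" if "(v, x) \<in> (adjacency (V, E))\<^sup>*" for x
      using that
    proof (induction rule: rtrancl_induct)
      case (step x y)
      hence "y \<in> neighbours E x" by (simp add: adjacency_def neighbours_def)
      thus ?case using step.IH a b \<open>a = u\<close> \<open>b = v\<close> by auto
    qed simp
    hence "V \<subseteq> {u, v}" using con[OF that(1)] by blast
    hence "card V \<le> card {u, v}" by (intro card_mono) auto
    also have "\<dots> \<le> 2" by (simp add: card_insert_if)
    finally show False using cV m by simp
  qed
  have IV: "I \<subseteq> V" using I_iff by blast
  have "card I < card V" using I(1) cV unfolding I_def[symmetric] by simp
  hence "I \<noteq> V" by auto
  then obtain x0 where x0: "x0 \<in> V" "x0 \<notin> I" using IV by blast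
  then obtain w where w: "neighbours E x0 = {w}" using leaf by blast
  have x0w: "{x0, u} \<in> E \<longleftrightarrow> u = w" for u using w by (auto simp: neighbours_def)
  have wI: "w \<in> I" using leaf_nb[OF x0] x0w by blast
  have wV: "w \<in> V" using wI IV by blast
  define V' where "V' = V - {x0}"
  have conI: "connected_from E w I"
  proof -
    let ?R = "(adjacency (I, {e \<in> E. e \<subseteq> I}))\<^sup>*"
    \<comment> \<open>A walk enters and leaves a leaf through the same vertex, so its visits to
      leaves can be cut out; the second alternative remembers that vertex.\<close>
    have "(v \<in> I \<and> (w, v) \<in> ?R) \<or> (v \<notin> I \<and> (\<exists>u\<in>I. {u, v} \<in> E \<and> (w, u) \<in> ?R))"
      if "(w, v) \<in> (adjacency (V, E))\<^sup>*" for v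
      using that
    proof (induction rule: rtrancl_induct)
      case base
      show ?case using wI by simp
    next
      case (step v v')
      have e: "{v, v'} \<in> E" using step.hyps by (simp add: adjacency_def)
      show ?case
      proof (cases "v \<in> I")
        case True
        hence v: "(w, v) \<in> ?R" using step.IH by blast
        show ?thesis
        proof (cases "v' \<in> I")
          case True
          hence "(v, v') \<in> adjacency (I, {e \<in> E. e \<subseteq> I})" using e \<open>v \<in> I\<close> by (simp add: adjacency_def)
          thus ?thesis using v True by (meson rtrancl.rtrancl_into_rtrancl)
        next
          case False
          thus ?thesis using e v \<open>v \<in> I\<close> by blast
        qed
      next
        case False
        then obtain u where u: "u \<in> I" "{u, v} \<in> E" "(w, u) \<in> ?R" using step.IH by blast
        obtain a where a: "neighbours E v = {a}" using leaf[of v] ev[OF e] False by blast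
        have "v' \<in> neighbours E v" "u \<in> neighbours E v"
          using e u(2) by (simp_all add: neighbours_def insert_commute)
        hence "v' = u" unfolding a by simp
        thus ?thesis using u by blast
      qed
    qed
    thus ?thesis using con[OF wV] IV wI unfolding connected_from_def by blast
  qed
  have conV': "connected_from E w V'"
  proof -
    let ?R = "(adjacency (V', {e \<in> E. e \<subseteq> V'}))\<^sup>*"
    have "v = x0 \<or> (w, v) \<in> ?R" if "(w, v) \<in> (adjacency (V, E))\<^sup>*" for v
      using that
    proof (induction rule: rtrancl_induct)
      case (step v v')
      have e: "{v, v'} \<in> E" using step.hyps by (simp add: adjacency_def)
      show ?case
      proof (cases "v = x0 \<or> v' = x0")
        case True
        thus ?thesis using e x0w by auto
      next
        case False
        hence "(v, v') \<in> adjacency (V', {e \<in> E. e \<subseteq> V'})" using e ev[OF e] by (simp add: adjacency_def V'_def)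
        thus ?thesis using step.IH False by (meson rtrancl.rtrancl_into_rtrancl)
      qed
    qed simp
    thus ?thesis using con[OF wV] wV wI x0(2) unfolding connected_from_def V'_def by blast
  qed
  have "w \<noteq> x0" using wI x0(2) by blast
  define q where "q = int ((r - 1) div 2)"
  have qf: "int r = 2 * q + 1" "0 < q" "nat q = (r - 1) div 2" using r by (auto simp: q_def elim!: oddE)
  interpret odd_tree_grid "2 * int m + 1" "int r" V E w q V'
  proof
    show "odd (2 * int m + 1)" "2 * int m + 1 > 0" by simp_all
    show "odd (int r)" "int r > 0" using r by simp_all
    show "tree (V, E)" "w \<in> V" by (rule tree, rule wV)
    show "int r = 2 * q + 1" "q > 0" by (rule qf)+
    show "V' \<subseteq> V" "connected_from E w V'" using conV' by (auto simp: V'_def)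
  qed
  \<comment> \<open>The largest value with \<open>3 * m1 + 1 \<le> 2 * m\<close>, the room required
    by two copies in one class.\<close>
  define m1 where "m1 = (2 * m - 1) div 3"
  define s where "s = m - m1"
  define j where "j = 2 * s div 3"
  have cV': "card V' = m + 1" using x0(1) cV fV by (simp add: V'_def)
  have IV': "I \<subseteq> V'" using IV x0(2) by (auto simp: V'_def)
  have I3: "\<exists>a\<in>V'. \<exists>b\<in>V'. a \<noteq> b \<and> {v, a} \<in> E \<and> {v, b} \<in> E" if v: "v \<in> I - {w}" for v
  proof -
    have "2 \<le> card (neighbours E v)" using v I_iff by blast
    then obtain S where S: "S \<subseteq> neighbours E v" "card S = 2" by (rule obtain_subset_with_card_n)
    then obtain a b where "S = {a, b}" "a \<noteq> b" by (auto simp: card_2_iff)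
    with S have ab: "a \<in> neighbours E v" "b \<in> neighbours E v" "a \<noteq> b" by auto
    have "a \<noteq> x0" "b \<noteq> x0" using ab v x0w[of v] by (auto simp: neighbours_def insert_commute)
    moreover have "a \<in> V" "b \<in> V" using ab nbV by blast+
    moreover have "{v, a} \<in> E" "{v, b} \<in> E" using ab by (simp_all add: neighbours_def)
    ultimately show ?thesis using ab(3) unfolding V'_def by blast
  qed
  have I4: "\<exists>u\<in>I. {u, v} \<in> E" if v: "v \<in> V' - I" for v
  proof -
    have vV: "v \<in> V" "v \<notin> I" using v by (auto simp: V'_def)
    obtain u where "neighbours E v = {u}" using leaf[OF vV] by blast
    hence "{v, u} \<in> E" by (auto simp: neighbours_def)
    thus ?thesis using leaf_nb[OF vV] by (auto simp: insert_commute)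
  qed
  note Ib = I[folded I_def]
  have n1: "m1 < m" "card I \<le> m1 + 1" "3 * m1 + 1 \<le> 2 * m" using Ib m unfolding m1_def by linarith+
  \<comment> \<open>With \<open>3 * s \<le> m + 3\<close>, the inequality
    \<open>2 * s + 2 \<le> m\<close> is where \<open>m \<ge> 12\<close> comes from.\<close>
  have n2: "3 * s \<le> m + 3" "2 * s + 2 \<le> m" "2 \<le> s" using m unfolding s_def m1_def by linarith+
  have n3: "j + 1 + 2 * (s - j) \<le> card I"
  proof -
    have jj: "2 * s \<le> 3 * j + 2" "j \<le> s" unfolding j_def by linarith+
    then obtain k where k: "s = j + k" using le_iff_add by auto
    \<comment> \<open>The constant 27 pays exactly for the roundings in \<open>m1\<close> and
      \<open>j\<close>: here \<open>4 * m + 27 \<ge> 12 * s + 15\<close> and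
      \<open>2 * k \<le> j + 2\<close>.\<close>
    have "9 * j + 18 * k + 9 \<le> 9 * card I" using jj(1) n2(1) k Ib(2) by linarith
    thus ?thesis using k by simp
  qed
  obtain \<phi> A where fam: "\<And>i. i \<le> 2 * nat q \<Longrightarrow> partial_emb V' (\<phi> i) (A i) \<and> A i \<subseteq> nonzero_diffs"
    "\<And>i k. \<lbrakk>i \<le> 2 * nat q; k \<le> 2 * nat q; i \<noteq> k\<rbrakk> \<Longrightarrow> A i \<inter> A k = {}"
    "\<And>i. \<lbrakk>i \<le> 2 * nat q; even i; 0 < i\<rbrakk> \<Longrightarrow> (0, int (i div 2)) \<notin> \<phi> i ` V'"
    by (rule rainbow_family[OF conI IV' I3 I4 refl cV' n1(1,2) s_def j_def n3 n1(3) n2(2,3)])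
      (assumption, assumption, rule that)
  have VV: "V = insert x0 V'" "x0 \<notin> V'" using x0(1) by (auto simp: V'_def)
  have t: "(r + 1) div 2 = nat q + 1" using qf(3) r by (auto elim!: oddE)
  have "decomposes (V, E) (complete_minus_clique (nat (int r) * nat (2 * int m + 1) + (r + 1) div 2) ((r + 1) div 2))"
    by (rule family_decomposes[OF refl cV' fam VV x0w t])
  moreover have "nat (2 * int m + 1) = 2 * m + 1" by simp
  ultimately show ?thesis by simp
qed

section \<open>Shapes of rooted trees\<close>

text \<open>With multisets of subtrees, isomorphic rooted trees become equal, so this type
  enumerates the unlabelled rooted trees.\<close>

datatype rtree = Nd "rtree multiset"

primrec nodes :: "rtree \<Rightarrow> nat" where
  "nodes (Nd M) = Suc (\<Sum>\<^sub># (image_mset nodes M))"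

text \<open>Counts nodes without children. A root with a single child is not counted although it is
  a leaf of the underlying tree, which causes the deviation by one in
  \<open>has_shape_inner_verts\<close>.\<close>

primrec lvs :: "rtree \<Rightarrow> nat" where
  "lvs (Nd M) = (if M = {#} then 1 else \<Sum>\<^sub># (image_mset lvs M))"

text \<open>Subtrees are grafted one at a time, which avoids indexed families of disjoint children;
  the price is that the order of grafting has to be shown irrelevant.\<close>

inductive has_shape :: "'a set \<Rightarrow> 'a set set \<Rightarrow> 'a \<Rightarrow> rtree \<Rightarrow> bool" where
  single: "has_shape {r} {} r (Nd {#})"
| graft: "\<lbrakk>has_shape V E r (Nd M); has_shape W F q s; V \<inter> W = {}\<rbrakk> \<Longrightarrow>
    has_shape (V \<union> W) (insert {r, q} (E \<union> F)) r (Nd (add_mset s M))"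

lemma has_shape_basic:
  assumes "has_shape V E r t"
  shows "finite V" "r \<in> V" "e \<in> E \<Longrightarrow> e \<subseteq> V \<and> card e = 2"
    "v \<in> V \<Longrightarrow> (r, v) \<in> (adjacency (V, E))\<^sup>*" "card V = nodes t"
proof -
  have "finite V \<and> r \<in> V \<and> (\<forall>e\<in>E. e \<subseteq> V \<and> card e = 2) \<and>
    (\<forall>v\<in>V. (r, v) \<in> (adjacency (V, E))\<^sup>*) \<and> card V = nodes t"
    using assms
  proof induction
    case (graft V E r M W F q s)
    let ?A = "adjacency (V \<union> W, insert {r, q} (E \<union> F))"
    have V: "finite V" "r \<in> V" "\<And>e. e \<in> E \<Longrightarrow> e \<subseteq> V \<and> card e = 2"
      "\<And>v. v \<in> V \<Longrightarrow> (r, v) \<in> (adjacency (V, E))\<^sup>*" "card V = nodes (Nd M)"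
      and W: "finite W" "q \<in> W" "\<And>e. e \<in> F \<Longrightarrow> e \<subseteq> W \<and> card e = 2"
      "\<And>v. v \<in> W \<Longrightarrow> (q, v) \<in> (adjacency (W, F))\<^sup>*" "card W = nodes s"
      using graft.IH by blast+
    have sub: "(adjacency (V, E))\<^sup>* \<subseteq> ?A\<^sup>*" "(adjacency (W, F))\<^sup>* \<subseteq> ?A\<^sup>*"
      by (intro rtrancl_mono adjacency_mono; blast)+
    have rq: "(r, q) \<in> ?A" by (simp add: adjacency_def)
    have "(r, v) \<in> ?A\<^sup>*" if "v \<in> V \<union> W" for v
    proof (cases "v \<in> V")
      case True
      thus ?thesis using V(4) sub by blast
    next
      case False
      hence "(q, v) \<in> ?A\<^sup>*" using that W(4) sub by blast
      thus ?thesis using rq by (rule converse_rtrancl_into_rtrancl[rotated])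
    qed
    moreover have "r \<noteq> q" using V(2) W(2) graft.hyps by blast
    moreover have "card (V \<union> W) = nodes (Nd (add_mset s M))"
      using V W graft.hyps by (subst card_Un_disjoint) auto
    moreover have "e \<subseteq> V \<union> W \<and> card e = 2" if "e \<in> insert {r, q} (E \<union> F)" for e
      using that V(2,3) W(2,3) \<open>r \<noteq> q\<close> by auto
    ultimately show ?case using V(1,2) W(1) by blast
  qed simp
  thus "finite V" "r \<in> V" "e \<in> E \<Longrightarrow> e \<subseteq> V \<and> card e = 2"
    "v \<in> V \<Longrightarrow> (r, v) \<in> (adjacency (V, E))\<^sup>*" "card V = nodes t" by blast+
qed

lemma has_shape_card_edges: "has_shape V E r t \<Longrightarrow> finite E \<and> Suc (card E) = nodes t"
proof (induction rule: has_shape.induct)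
  case (graft V E r M W F q s)
  note V = has_shape_basic[OF graft.hyps(1)] and W = has_shape_basic[OF graft.hyps(2)]
  have "e \<noteq> {}" if "e \<in> E" for e using V(3)[OF that] by auto
  hence "E \<inter> F = {}" using V(3) W(3) graft.hyps(3) by blast
  moreover have "{r, q} \<notin> E \<union> F" using V(2) W(2) V(3)[of "{r, q}"] W(3)[of "{r, q}"] graft.hyps(3) by auto
  ultimately show ?case using graft.IH by (simp add: card_Un_disjoint)
qed simp

text \<open>A path avoiding an edge of one of the grafted trees is projected to that tree by collapsing
  the other tree to the vertex it is attached to.\<close>

lemma has_shape_edge_is_bridge:
  "has_shape V E r t \<Longrightarrow> {a, b} \<in> E \<Longrightarrow> (a, b) \<notin> (adjacency (V, E - {{a, b}}))\<^sup>*"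
proof (induction arbitrary: a b rule: has_shape.induct)
  case (graft V E r M W F q s)
  note V = has_shape_basic[OF graft.hyps(1)] and W = has_shape_basic[OF graft.hyps(2)]
  note VW = graft.hyps(3)
  have EV: "x \<in> V \<and> y \<in> V" if "{x, y} \<in> E" for x y using V(3)[OF that] by simp
  have FW: "x \<in> W \<and> y \<in> W" if "{x, y} \<in> F" for x y using W(3)[OF that] by simp
  let ?E = "insert {r, q} (E \<union> F)"
  let ?A = "adjacency (V \<union> W, ?E - {{a, b}})"
  define f where "f v = (if v \<in> W then r else v)" for v
  define g where "g v = (if v \<in> V then q else v)" for v
  have rq: "r \<in> V" "r \<notin> W" "q \<in> W" "q \<notin> V" using V(2) W(2) VW by blast+
  have f1: "f v = v" if "v \<in> V" for v using that VW by (auto simp: f_def)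
  have g1: "g v = v" if "v \<in> W" for v using that VW by (auto simp: g_def)
  have edge: "{x, y} = {r, q} \<or> {x, y} \<in> E - {{a, b}} \<or> {x, y} \<in> F - {{a, b}}" "{x, y} \<noteq> {a, b}"
    if "(x, y) \<in> ?A" for x y using that by (auto simp: adjacency_def)
  consider "{a, b} = {r, q}" | "{a, b} \<in> E" | "{a, b} \<in> F" using graft.prems by blast
  thus ?case
  proof cases
    case 1
    have "x \<in> V \<longleftrightarrow> a \<in> V" if "(a, x) \<in> ?A\<^sup>*" for x
      using that
    proof (induction rule: rtrancl_induct)
      case (step x y)
      have "{x, y} \<in> E \<or> {x, y} \<in> F" using edge[OF step.hyps(2)] 1 by blast
      hence "x \<in> V \<longleftrightarrow> y \<in> V" using EV FW VW by blast
      thus ?case using step.IH by simp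
    qed simp
    moreover have "\<not> (b \<in> V \<longleftrightarrow> a \<in> V)" using 1 rq by (auto simp: doubleton_eq_iff)
    ultimately show ?thesis by blast
  next
    case 2
    have "(f a, f x) \<in> (adjacency (V, E - {{a, b}}))\<^sup>*" if "(a, x) \<in> ?A\<^sup>*" for x
      using that
    proof (induction rule: rtrancl_induct)
      case (step x y)
      have "f x = f y \<or> (f x, f y) \<in> adjacency (V, E - {{a, b}})"
        using edge(1)[OF step.hyps(2)]
      proof (elim disjE)
        assume "{x, y} = {r, q}"
        thus ?thesis using rq by (auto simp: doubleton_eq_iff f_def)
      next
        assume e: "{x, y} \<in> E - {{a, b}}"
        hence "f x = x" "f y = y" using EV f1 by blast+
        thus ?thesis using e by (simp add: adjacency_def)
      next
        assume "{x, y} \<in> F - {{a, b}}"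
        thus ?thesis using FW by (auto simp: f_def)
      qed
      thus ?case using step.IH by (metis rtrancl.rtrancl_into_rtrancl)
    qed simp
    thus ?thesis using graft.IH(1)[OF 2] f1 EV[OF 2] by metis
  next
    case 3
    have "(g a, g x) \<in> (adjacency (W, F - {{a, b}}))\<^sup>*" if "(a, x) \<in> ?A\<^sup>*" for x
      using that
    proof (induction rule: rtrancl_induct)
      case (step x y)
      have "g x = g y \<or> (g x, g y) \<in> adjacency (W, F - {{a, b}})"
        using edge(1)[OF step.hyps(2)]
      proof (elim disjE)
        assume "{x, y} = {r, q}"
        thus ?thesis using rq by (auto simp: doubleton_eq_iff g_def)
      next
        assume e: "{x, y} \<in> F - {{a, b}}"
        hence "g x = x" "g y = y" using FW g1 by blast+
        thus ?thesis using e by (simp add: adjacency_def)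
      next
        assume "{x, y} \<in> E - {{a, b}}"
        thus ?thesis using EV by (auto simp: g_def)
      qed
      thus ?case using step.IH by (metis rtrancl.rtrancl_into_rtrancl)
    qed simp
    thus ?thesis using graft.IH(2)[OF 3] g1 FW[OF 3] by metis
  qed
qed simp

text \<open>The rest of a cycle bypasses its closing edge. This reduces acyclicity to the bridge
  property, which is easier to carry through graftings.\<close>

lemma is_cycle_no_bridge:
  assumes "is_cycle (V, E) xs"
  obtains a b where "{a, b} \<in> E" "(a, b) \<in> (adjacency (V, E - {{a, b}}))\<^sup>*"
proof -
  let ?L = "length xs"
  have L: "3 \<le> ?L" "distinct xs" and e: "\<And>i. i < ?L \<Longrightarrow> {xs ! i, xs ! (Suc i mod ?L)} \<in> E"
    using assms by (auto simp: is_cycle_def)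
  define a b where "a = xs ! 0" and "b = xs ! (?L - 1)"
  have "Suc (?L - 1) = ?L" using L by simp
  hence "Suc (?L - 1) mod ?L = 0" by simp
  hence ab: "{a, b} \<in> E" using e[of "?L - 1"] L by (auto simp: a_def b_def insert_commute)
  have "(a, xs ! i) \<in> (adjacency (V, E - {{a, b}}))\<^sup>*" if "i < ?L" for i
    using that
  proof (induction i)
    case 0
    show ?case by (simp add: a_def)
  next
    case (Suc i)
    have "{xs ! i, xs ! Suc i} \<in> E" using e[of i] Suc.prems by simp
    moreover have "{xs ! i, xs ! Suc i} \<noteq> {a, b}"
    proof -
      have "xs \<noteq> []" using L(1) by auto
      have "xs ! i = a \<longleftrightarrow> i = 0" "xs ! Suc i = b \<longleftrightarrow> Suc i = ?L - 1" "xs ! Suc i \<noteq> a"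
        using Suc.prems L(1) \<open>xs \<noteq> []\<close> unfolding a_def b_def by (simp_all add: nth_eq_iff_index_eq[OF L(2)])
      thus ?thesis using L(1) by (auto simp: doubleton_eq_iff)
    qed
    ultimately have "(xs ! i, xs ! Suc i) \<in> adjacency (V, E - {{a, b}})" by (simp add: adjacency_def)
    thus ?case using Suc.IH Suc.prems by (meson Suc_lessD rtrancl.rtrancl_into_rtrancl)
  qed
  moreover have "?L - 1 < ?L" using L(1) by simp
  ultimately show ?thesis using that[OF ab] by (simp add: b_def)
qed

lemma has_shape_tree:
  assumes "has_shape V E r t"
  shows "tree (V, E)"
proof -
  note b = has_shape_basic[OF assms]
  have "sym (adjacency (V, E))" by (auto simp: sym_def adjacency_def insert_commute)
  hence "(v, r) \<in> (adjacency (V, E))\<^sup>*" if "v \<in> V" for v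
    using b(4)[OF that] sym_rtrancl by (metis symD)
  hence "(u, v) \<in> (adjacency (V, E))\<^sup>*" if "u \<in> V" "v \<in> V" for u v
    using b(4) that by (meson rtrancl_trans)
  moreover have "\<not> is_cycle (V, E) xs" for xs
    using is_cycle_no_bridge[of V E xs] has_shape_edge_is_bridge[OF assms] by metis
  ultimately show ?thesis using b(1-3) by (auto simp: tree_def simple_graph_def connected_graph_def)
qed

lemma has_shape_image: "has_shape V E r t \<Longrightarrow> inj_on f V \<Longrightarrow> has_shape (f ` V) ((`) f ` E) (f r) t"
proof (induction rule: has_shape.induct)
  case (single r)
  show ?case using has_shape.single by simp
next
  case (graft V E r M W F q s)
  have "inj_on f V" "inj_on f W" using graft.prems by (auto simp: inj_on_Un)
  moreover have "f ` V \<inter> f ` W = {}"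
    using graft.prems graft.hyps(3) inj_on_image_Int[of f "V \<union> W" V W] by auto
  ultimately show ?case
    using has_shape.graft[OF graft.IH(1) graft.IH(2)] by (simp add: image_Un)
qed

text \<open>Deleting an edge \<open>{r, q}\<close> at the root leaves two smaller trees, the
  component \<open>W\<close> of \<open>q\<close> and the rest, and grafting the first back gives the
  shape.\<close>

lemma tree_has_shape: "tree (V, E) \<Longrightarrow> r \<in> V \<Longrightarrow> \<exists>t. has_shape V E r t"
proof (induction "card V" arbitrary: V E r rule: less_induct)
  case less
  have fV: "finite V" and sg: "\<And>e. e \<in> E \<Longrightarrow> e \<subseteq> V \<and> card e = 2"
    and con: "\<And>u v. \<lbrakk>u \<in> V; v \<in> V\<rbrakk> \<Longrightarrow> (u, v) \<in> (adjacency (V, E))\<^sup>*"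
    and ac: "\<And>xs. \<not> is_cycle (V, E) xs"
    using less.prems(1) by (auto simp: tree_def simple_graph_def connected_graph_def)
  show ?case
  proof (cases "V = {r}")
    case True
    have "E = {}"
    proof (rule ccontr)
      assume "E \<noteq> {}"
      then obtain e where "e \<in> E" by blast
      thus False using sg[of e] card_mono[of "{r}" e] True by auto
    qed
    thus ?thesis using True has_shape.single[of r] by auto
  next
    case False
    then obtain v where "v \<in> V" "v \<noteq> r" using less.prems(2) by blast
    then obtain q where "(r, q) \<in> adjacency (V, E)"
      using con[OF less.prems(2) \<open>v \<in> V\<close>] by (metis converse_rtranclE)
    hence rqE: "{r, q} \<in> E" by (simp add: adjacency_def)
    define R where "R = adjacency (V, E - {{r, q}})"
    define W where "W = {v. (q, v) \<in> R\<^sup>*}"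
    define F where "F = {e \<in> E - {{r, q}}. e \<subseteq> W}"
    define E' where "E' = {e \<in> E - {{r, q}}. e \<subseteq> V - W}"
    have rV: "r \<in> V" "q \<in> V" "r \<noteq> q" using sg[OF rqE] by auto
    have symR: "sym R" by (auto simp: R_def sym_def adjacency_def insert_commute)
    have rW: "r \<notin> W"
      using tree_edge_is_bridge[OF less.prems(1) rqE] symD[OF sym_rtrancl[OF symR]] by (auto simp: W_def R_def)
    have qW: "q \<in> W" by (simp add: W_def)
    have closed: "y \<in> W" if "x \<in> W" "(x, y) \<in> R" for x y
      using that by (auto simp: W_def intro: rtrancl_into_rtrancl)
    have WV: "W \<subseteq> V"
    proof
      fix v assume "v \<in> W"
      hence "(q, v) \<in> R\<^sup>*" by (simp add: W_def)
      thus "v \<in> V"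
        by (induction rule: rtrancl_induct) (use rV sg in \<open>auto simp: R_def adjacency_def\<close>)
    qed
    have split: "e \<in> F \<or> e \<in> E'" if e: "e \<in> E" "e \<noteq> {r, q}" for e
    proof -
      obtain a b where ab: "e = {a, b}" using sg[OF e(1)] by (auto simp: card_2_iff)
      hence "(a, b) \<in> R" "(b, a) \<in> R" using e by (auto simp: R_def adjacency_def insert_commute)
      hence "a \<in> W \<longleftrightarrow> b \<in> W" using closed by blast
      thus ?thesis using ab e sg[OF e(1)] by (auto simp: F_def E'_def)
    qed
    have EU: "E = insert {r, q} (E' \<union> F)" using split rqE by (auto simp: F_def E'_def)
    have nocyc: "\<not> is_cycle (X, H) xs" if "H \<subseteq> E" for X H xs
      using ac[of xs] that by (auto simp: is_cycle_def)
    have conF: "(q, v) \<in> (adjacency (W, F))\<^sup>*" if "v \<in> W" for v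
    proof -
      have "(q, v) \<in> R\<^sup>*" using that by (simp add: W_def)
      thus ?thesis
      proof (induction rule: rtrancl_induct)
        case (step x y)
        have "x \<in> W" "y \<in> W" using step.hyps by (auto simp: W_def intro: rtrancl_into_rtrancl)
        hence "(x, y) \<in> adjacency (W, F)" using step.hyps(2) by (auto simp: R_def F_def adjacency_def)
        thus ?case using step.IH by (rule rtrancl_into_rtrancl[rotated])
      qed simp
    qed
    have conE: "(r, v) \<in> (adjacency (V - W, E'))\<^sup>*" if v: "v \<in> V - W" for v
    proof -
      \<comment> \<open>A walk can return from \<open>W\<close> only through \<open>r\<close>, which
        is why the invariant may forget what happens inside \<open>W\<close>.\<close>
      have "v \<in> W \<or> (r, v) \<in> (adjacency (V - W, E'))\<^sup>*" if "(r, v) \<in> (adjacency (V, E))\<^sup>*" for v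
        using that
      proof (induction rule: rtrancl_induct)
        case (step x y)
        have e: "{x, y} \<in> E" using step.hyps(2) by (simp add: adjacency_def)
        show ?case
        proof (cases "{x, y} = {r, q}")
          case True
          thus ?thesis using qW by (auto simp: doubleton_eq_iff)
        next
          case False
          from split[OF e this] show ?thesis
          proof
            assume "{x, y} \<in> F"
            thus ?thesis by (auto simp: F_def)
          next
            assume e': "{x, y} \<in> E'"
            hence "x \<notin> W" "(x, y) \<in> adjacency (V - W, E')" by (auto simp: E'_def adjacency_def)
            thus ?thesis using step.IH by (meson rtrancl.rtrancl_into_rtrancl)
          qed
        qed
      qed simp
      thus ?thesis using con[OF rV(1), of v] v by blast
    qed
    have tr: "tree (X, H)" if "finite X" "x \<in> X" "H \<subseteq> E" "\<And>e. e \<in> H \<Longrightarrow> e \<subseteq> X"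
      "\<And>v. v \<in> X \<Longrightarrow> (x, v) \<in> (adjacency (X, H))\<^sup>*" for X H and x
    proof -
      have "sym (adjacency (X, H))" by (auto simp: sym_def adjacency_def insert_commute)
      hence "(v, x) \<in> (adjacency (X, H))\<^sup>*" if "v \<in> X" for v
        using \<open>\<And>v. v \<in> X \<Longrightarrow> (x, v) \<in> (adjacency (X, H))\<^sup>*\<close>[OF that] sym_rtrancl by (metis symD)
      hence "(u, v) \<in> (adjacency (X, H))\<^sup>*" if "u \<in> X" "v \<in> X" for u v
        using that \<open>\<And>v. v \<in> X \<Longrightarrow> (x, v) \<in> (adjacency (X, H))\<^sup>*\<close> by (meson rtrancl_trans)
      thus ?thesis using that(1-4) sg nocyc[of H X] unfolding tree_def simple_graph_def connected_graph_def
        by auto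
    qed
    have "tree (W, F)"
      by (rule tr[of W q]) (use fV WV finite_subset qW conF in \<open>auto simp: F_def\<close>)
    moreover have "card W < card V" using fV WV rV(1) rW by (intro psubset_card_mono) auto
    ultimately obtain s where s: "has_shape W F q s" using less.hyps[of W F q] qW by blast
    have "tree (V - W, E')"
      by (rule tr[of _ r]) (use fV rV rW conE in \<open>auto simp: E'_def\<close>)
    moreover have "card (V - W) < card V" using fV rV(2) qW by (intro psubset_card_mono) auto
    ultimately obtain t where t: "has_shape (V - W) E' r t" using less.hyps[of "V - W" E' r] rV rW by blast
    obtain M where "t = Nd M" by (cases t)
    hence "has_shape ((V - W) \<union> W) (insert {r, q} (E' \<union> F)) r (Nd (add_mset s M))"
      using t s by (intro has_shape.graft) auto
    moreover have "(V - W) \<union> W = V" using WV by blast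
    ultimately show ?thesis using EU by auto
  qed
qed

lemma has_shape_neighbours:
  assumes "has_shape V E r (Nd M)" "has_shape W F q s" "V \<inter> W = {}"
  defines "G \<equiv> insert {r, q} (E \<union> F)"
  shows "neighbours G r = insert q (neighbours E r)" "neighbours G q = insert r (neighbours F q)"
    "v \<in> V - {r} \<Longrightarrow> neighbours G v = neighbours E v" "v \<in> W - {q} \<Longrightarrow> neighbours G v = neighbours F v"
proof -
  note V = has_shape_basic[OF assms(1)] and W = has_shape_basic[OF assms(2)]
  have EV: "x \<in> V \<and> y \<in> V" if "{x, y} \<in> E" for x y using V(3)[OF that] by simp
  have FW: "x \<in> W \<and> y \<in> W" if "{x, y} \<in> F" for x y using W(3)[OF that] by simp
  have rq: "r \<in> V" "r \<notin> W" "q \<in> W" "q \<notin> V" using V(2) W(2) assms(3) by blast+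
  show "neighbours G r = insert q (neighbours E r)" "neighbours G q = insert r (neighbours F q)"
    "v \<in> V - {r} \<Longrightarrow> neighbours G v = neighbours E v" "v \<in> W - {q} \<Longrightarrow> neighbours G v = neighbours F v"
    using rq EV FW assms(3) unfolding neighbours_def G_def
    by (auto simp: doubleton_eq_iff dest: EV FW)
qed

lemma has_shape_neighbours_empty: "has_shape V E r t \<Longrightarrow> neighbours E r = {} \<longleftrightarrow> t = Nd {#}"
proof (induction rule: has_shape.induct)
  case (graft V E r M W F q s)
  show ?case using has_shape_neighbours(1)[OF graft.hyps] by simp
qed (simp add: neighbours_def)

text \<open>Graftings at the same root commute, so any of them can be taken as the last one.\<close>

lemma has_shape_split_at:
  assumes "has_shape V E r t" "{r, q} \<in> E"
  obtains V1 E1 W F M s where "has_shape V1 E1 r (Nd M)" "has_shape W F q s" "V1 \<inter> W = {}"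
    "V = V1 \<union> W" "E = insert {r, q} (E1 \<union> F)" "t = Nd (add_mset s M)"
proof -
  have "\<exists>V1 E1 W F M s. has_shape V1 E1 r (Nd M) \<and> has_shape W F q s \<and> V1 \<inter> W = {} \<and>
    V = V1 \<union> W \<and> E = insert {r, q} (E1 \<union> F) \<and> t = Nd (add_mset s M)"
    using assms
  proof (induction rule: has_shape.induct)
    case (graft V E r M W F q' s)
    show ?case
    proof (cases "q' = q")
      case True
      show ?thesis using graft.hyps unfolding True by blast
    next
      case False
      have "q \<in> neighbours (insert {r, q'} (E \<union> F)) r" using graft.prems by (simp add: neighbours_def)
      hence "q \<in> neighbours E r" using has_shape_neighbours(1)[OF graft.hyps] False by simp
      hence "{r, q} \<in> E" by (simp add: neighbours_def)
      from graft.IH(1)[OF this] obtain V1 E1 W1 F1 M1 s1 where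
        a: "has_shape V1 E1 r (Nd M1)" "has_shape W1 F1 q s1" "V1 \<inter> W1 = {}"
        "V = V1 \<union> W1" "E = insert {r, q} (E1 \<union> F1)" "Nd M = Nd (add_mset s1 M1)" by blast
      have "has_shape (V1 \<union> W) (insert {r, q'} (E1 \<union> F)) r (Nd (add_mset s M1))"
        using a graft.hyps by (intro has_shape.graft) auto
      moreover have "(V1 \<union> W) \<inter> W1 = {}" using a graft.hyps(3) by blast
      moreover have "V \<union> W = (V1 \<union> W) \<union> W1" using a by blast
      moreover have "insert {r, q'} (E \<union> F) = insert {r, q} (insert {r, q'} (E1 \<union> F) \<union> F1)" using a(5) by blast
      moreover have "Nd (add_mset s M) = Nd (add_mset s1 (add_mset s M1))"
        using a(6) by (simp add: add_mset_commute)
      ultimately show ?thesis using a(2) by blast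
    qed
  qed simp
  thus ?thesis using that by blast
qed

text \<open>Counterpart of \<open>has_shape_split_at\<close> in which the shape of the last grafted
  tree is prescribed instead of its root.\<close>

lemma has_shape_split:
  assumes "has_shape V E r (Nd (add_mset s M))"
  obtains V1 E1 W F q where "has_shape V1 E1 r (Nd M)" "has_shape W F q s" "V1 \<inter> W = {}"
    "V = V1 \<union> W" "E = insert {r, q} (E1 \<union> F)"
proof -
  have "t = Nd N \<Longrightarrow> s \<in># N \<Longrightarrow> \<exists>V1 E1 W F q. has_shape V1 E1 r (Nd (N - {#s#})) \<and> has_shape W F q s \<and>
    V1 \<inter> W = {} \<and> V = V1 \<union> W \<and> E = insert {r, q} (E1 \<union> F)" if "has_shape V E r t" for V E r t N
    using that
  proof (induction arbitrary: N rule: has_shape.induct)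
    case (graft V E r M W F q s')
    have N: "N = add_mset s' M" using graft.prems by simp
    show ?case
    proof (cases "s' = s")
      case True
      show ?thesis using graft.hyps N unfolding True by (metis add_mset_remove_trivial)
    next
      case False
      hence sM: "s \<in># M" using graft.prems N by simp
      from graft.IH(1)[OF refl this] obtain V1 E1 W1 F1 q1 where
        a: "has_shape V1 E1 r (Nd (M - {#s#}))" "has_shape W1 F1 q1 s" "V1 \<inter> W1 = {}"
        "V = V1 \<union> W1" "E = insert {r, q1} (E1 \<union> F1)" by blast
      have "has_shape (V1 \<union> W) (insert {r, q} (E1 \<union> F)) r (Nd (add_mset s' (M - {#s#})))"
        using a graft.hyps by (intro has_shape.graft) auto
      moreover have "add_mset s' (M - {#s#}) = N - {#s#}" using N sM by simp
      moreover have "(V1 \<union> W) \<inter> W1 = {}" using a graft.hyps(3) by blast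
      moreover have "V \<union> W = (V1 \<union> W) \<union> W1" using a by blast
      moreover have "insert {r, q} (E \<union> F) = insert {r, q1} (insert {r, q} (E1 \<union> F) \<union> F1)" using a(5) by blast
      ultimately show ?thesis using a(2) by (metis (no_types))
    qed
  qed simp
  from this[OF assms refl] show ?thesis using that by auto
qed

lemma has_shape_root_only:
  assumes "has_shape V E r (Nd {#})"
  shows "V = {r}" "E = {}"
  using assms by (cases; simp)+

text \<open>Recovers both parts of a grafting from the whole graph and the edge
  \<open>{r, q}\<close> alone.\<close>

lemma has_shape_component:
  assumes "has_shape V E r (Nd M)" "has_shape W F q s" "V \<inter> W = {}"
  shows "W = {v. (q, v) \<in> (adjacency (V \<union> W, insert {r, q} (E \<union> F) - {{r, q}}))\<^sup>*}" (is "W = {v. (q, v) \<in> ?R\<^sup>*}")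
    "E = {e \<in> insert {r, q} (E \<union> F). e \<subseteq> V}" "F = {e \<in> insert {r, q} (E \<union> F). e \<subseteq> W}"
proof -
  note V = has_shape_basic[OF assms(1)] and W = has_shape_basic[OF assms(2)]
  have rq: "r \<in> V" "r \<notin> W" "q \<in> W" "q \<notin> V" using V(2) W(2) assms(3) by blast+
  have ne: "e \<noteq> {}" if "e \<in> E \<union> F" for e using V(3)[of e] W(3)[of e] that by auto
  show "E = {e \<in> insert {r, q} (E \<union> F). e \<subseteq> V}" "F = {e \<in> insert {r, q} (E \<union> F). e \<subseteq> W}"
    using rq V(3) W(3) ne assms(3) by blast+
  have "F \<subseteq> insert {r, q} (E \<union> F) - {{r, q}}" using W(3) rq by auto
  hence "adjacency (W, F) \<subseteq> ?R" by (rule adjacency_mono)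
  hence "(adjacency (W, F))\<^sup>* \<subseteq> ?R\<^sup>*" by (rule rtrancl_mono)
  moreover have "v \<in> W" if "(q, v) \<in> ?R\<^sup>*" for v
    using that
  proof (induction rule: rtrancl_induct)
    case (step x y)
    hence "{x, y} \<in> E \<or> {x, y} \<in> F" by (auto simp: adjacency_def)
    thus ?case using V(3)[of "{x, y}"] W(3)[of "{x, y}"] step.IH assms(3) by blast
  qed (rule rq)
  ultimately show "W = {v. (q, v) \<in> ?R\<^sup>*}" using W(4) by blast
qed

text \<open>The second derivation can be rearranged to end with the same edge \<open>{r, q}\<close>;
  then \<open>has_shape_component\<close> forces the same two parts.\<close>

lemma has_shape_unique: "has_shape V E r t \<Longrightarrow> has_shape V E r t' \<Longrightarrow> t = t'"
proof (induction arbitrary: t' rule: has_shape.induct)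
  case (single r)
  show ?case using has_shape_neighbours_empty[OF single] by (simp add: neighbours_def)
next
  case (graft V E r M W F q s)
  let ?G = "insert {r, q} (E \<union> F)"
  obtain V1 E1 W1 F1 M1 s1 where
    a: "has_shape V1 E1 r (Nd M1)" "has_shape W1 F1 q s1" "V1 \<inter> W1 = {}"
    "V \<union> W = V1 \<union> W1" "?G = insert {r, q} (E1 \<union> F1)" "t' = Nd (add_mset s1 M1)"
    by (rule has_shape_split_at[OF graft.prems insertI1])
  note c = has_shape_component[OF graft.hyps] and c' = has_shape_component[OF a(1-3), folded a(4,5)]
  have W: "W = W1" by (rule trans[OF c(1) c'(1)[symmetric]])
  hence V: "V = V1" using a(3,4) graft.hyps(3) by blast
  have "E = E1" "F = F1" using c(2,3) c'(2,3) V W by simp_all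
  thus ?case using graft.IH a V W by blast
qed

lemma has_shape_iso:
  "has_shape V E r t \<Longrightarrow> has_shape V' E' r' t \<Longrightarrow>
    \<exists>f. bij_betw f V V' \<and> E' = (`) f ` E \<and> f r = r'"
proof (induction arbitrary: V' E' r' rule: has_shape.induct)
  case (single r)
  show ?case using has_shape_root_only[OF single] by (intro exI[of _ "\<lambda>_. r'"]) (simp add: bij_betw_def)
next
  case (graft V E r M W F q s)
  obtain V1 E1 W1 F1 q1 where a: "has_shape V1 E1 r' (Nd M)" "has_shape W1 F1 q1 s" "V1 \<inter> W1 = {}"
    "V' = V1 \<union> W1" "E' = insert {r', q1} (E1 \<union> F1)" by (rule has_shape_split[OF graft.prems])
  obtain f g where f: "bij_betw f V V1" "E1 = (`) f ` E" "f r = r'"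
    and g: "bij_betw g W W1" "F1 = (`) g ` F" "g q = q1"
    using graft.IH(1)[OF a(1)] graft.IH(2)[OF a(2)] by blast
  note bV = has_shape_basic[OF graft.hyps(1)] and bW = has_shape_basic[OF graft.hyps(2)]
  define h where "h v = (if v \<in> V then f v else g v)" for v
  have hV: "h v = f v" if "v \<in> V" for v using that by (simp add: h_def)
  have hW: "h v = g v" if "v \<in> W" for v using that graft.hyps(3) by (auto simp: h_def)
  have "bij_betw h V V1" using f(1) hV by (simp cong: bij_betw_cong)
  moreover have "bij_betw h W W1" using g(1) hW by (simp cong: bij_betw_cong)
  ultimately have "bij_betw h (V \<union> W) V'" unfolding a(4) using a(3) by (rule bij_betw_combine)
  moreover have "(`) h ` E = E1"
    unfolding f(2) using bV(3) hV by (intro image_cong refl) (auto intro!: image_cong)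
  moreover have "(`) h ` F = F1"
    unfolding g(2) using bW(3) hW by (intro image_cong refl) (auto intro!: image_cong)
  moreover have "h ` {r, q} = {r', q1}" using hV[OF bV(2)] hW[OF bW(2)] f(3) g(3) by simp
  moreover have "h r = r'" using hV[OF bV(2)] f(3) by simp
  ultimately show ?case unfolding a(5) by (intro exI[of _ h]) (simp add: image_Un)
qed

lemma ex_has_shape: "\<exists>V E. has_shape (V :: nat set) E r t"
proof (induction t arbitrary: r)
  case (Nd M)
  show ?case
    using Nd
  proof (induction M)
    case empty
    show ?case using has_shape.single[of r] by (intro exI)
  next
    case (add s M)
    obtain V :: "nat set" and E where V: "has_shape V E r (Nd M)" using add by fastforce
    obtain W :: "nat set" and F where W: "has_shape W F 0 s" using add.prems by fastforce
    define k where "k = Suc (Max V)"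
    have "v < k" if "v \<in> V" for v
      using has_shape_basic(1)[OF V] that by (simp add: k_def less_Suc_eq_le)
    hence "V \<inter> (\<lambda>x. x + k) ` W = {}" by fastforce
    thus ?case using has_shape.graft[OF V has_shape_image[OF W, of "\<lambda>x. x + k"]] by auto
  qed
qed

text \<open>The root is left out because its degree changes with every grafting; the degree of any
  other vertex of the tree grafted onto is final.\<close>

lemma has_shape_leaves:
  "has_shape V E r (Nd M) \<Longrightarrow> card {v \<in> V. v \<noteq> r \<and> card (neighbours E v) \<le> 1} = \<Sum>\<^sub># (image_mset lvs M)"
proof (induction V E r "Nd M" arbitrary: M rule: has_shape.induct)
  case (graft V E r M W F q s)
  let ?G = "insert {r, q} (E \<union> F)"
  note bV = has_shape_basic[OF graft.hyps(1)] and bW = has_shape_basic[OF graft.hyps(3)]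
  note nb = has_shape_neighbours[OF graft.hyps(1,3,5)]
  define D where "D = {v \<in> V. v \<noteq> r \<and> card (neighbours E v) \<le> 1}"
  define D' where "D' = {v \<in> W. v \<noteq> q \<and> card (neighbours F v) \<le> 1}"
  define Q where "Q = (if s = Nd {#} then {q} else {})"
  obtain K where K: "s = Nd K" by (cases s)
  have rq: "r \<in> V" "r \<notin> W" "q \<in> W" "q \<notin> V" using bV(2) bW(2) graft.hyps by blast+
  have "neighbours F q \<subseteq> W" using bW(3) by (auto simp: neighbours_def)
  hence fin: "finite (neighbours F q)" "r \<notin> neighbours F q" using bW(1) rq finite_subset by blast+
  have q: "card (neighbours ?G q) \<le> 1 \<longleftrightarrow> s = Nd {#}"
    using nb(2) fin has_shape_neighbours_empty[OF graft.hyps(3)] by simp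
  have "{v \<in> V \<union> W. v \<noteq> r \<and> card (neighbours ?G v) \<le> 1} = D \<union> (D' \<union> Q)"
  proof (intro set_eqI)
    fix v
    consider "v = r" | "v = q" "v \<noteq> r" | "v \<in> V - {r}" | "v \<in> W - {q}" | "v \<notin> V \<union> W" by blast
    thus "v \<in> {v \<in> V \<union> W. v \<noteq> r \<and> card (neighbours ?G v) \<le> 1} \<longleftrightarrow> v \<in> D \<union> (D' \<union> Q)"
    proof cases
      case 3
      thus ?thesis using nb(3)[OF 3] rq graft.hyps(5) by (auto simp: D_def D'_def Q_def)
    next
      case 4
      thus ?thesis using nb(4)[OF 4] rq graft.hyps(5) by (auto simp: D_def D'_def Q_def)
    qed (use q rq in \<open>auto simp: D_def D'_def Q_def\<close>)
  qed
  moreover have "finite D" "finite D'" using bV(1) bW(1) by (simp_all add: D_def D'_def)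
  moreover have "D \<inter> (D' \<union> Q) = {}" "D' \<inter> Q = {}"
    using graft.hyps(5) rq by (auto simp: D_def D'_def Q_def split: if_splits)
  ultimately have "card {v \<in> V \<union> W. v \<noteq> r \<and> card (neighbours ?G v) \<le> 1} = card D + (card D' + card Q)"
    by (simp add: card_Un_disjoint Q_def)
  also have "card D' + card Q = lvs s"
    using graft.hyps(4)[OF K] K by (simp add: D'_def Q_def)
  finally show ?case using graft.hyps(2) by (simp add: D_def)
qed simp

text \<open>The two bounds differ by one because the root may be a leaf that \<open>lvs\<close> does
  not count.\<close>

lemma has_shape_inner_verts:
  assumes "has_shape V E r t" "nodes t \<ge> 2"
  shows "card (inner_verts (V, E)) + lvs t \<le> nodes t" "nodes t \<le> card (inner_verts (V, E)) + lvs t + 1"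
proof -
  note b = has_shape_basic[OF assms(1)]
  obtain M where M: "t = Nd M" by (cases t)
  have "M \<noteq> {#}" using assms(2) M by auto
  define D where "D = {v \<in> V. v \<noteq> r \<and> card (neighbours E v) \<le> 1}"
  have D: "card D = lvs t" "finite D" "D \<subseteq> V"
    using has_shape_leaves[OF assms(1)[unfolded M]] M \<open>M \<noteq> {#}\<close> b(1) by (simp_all add: D_def)
  have I: "inner_verts (V, E) \<union> D \<union> {r} = V" "inner_verts (V, E) \<inter> D = {}"
    using b(2) by (auto simp: D_def inner_verts_def)
  have fI: "finite (inner_verts (V, E))" using b(1) by (simp add: inner_verts_def)
  have "card (inner_verts (V, E) \<union> D) = card (inner_verts (V, E)) + lvs t"
    using fI D I by (simp add: card_Un_disjoint)
  moreover have "card (inner_verts (V, E) \<union> D) \<le> card V" using b(1) I(1) by (intro card_mono) auto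
  moreover have "card V \<le> card (inner_verts (V, E) \<union> D) + 1"
    using card_Un_le[of "inner_verts (V, E) \<union> D" "{r}"] unfolding I(1) by simp
  ultimately show "card (inner_verts (V, E)) + lvs t \<le> nodes t" "nodes t \<le> card (inner_verts (V, E)) + lvs t + 1"
    using b(5) by simp_all
qed

section \<open>Generating functions of rooted trees\<close>

text \<open>The bound on multiplicities keeps the set finite for finite \<open>A\<close>. Sums over
  it then are finite products of truncated geometric series, in place of the Euler product over all
  shapes.\<close>

definition bounded_msets :: "'a set \<Rightarrow> nat \<Rightarrow> 'a multiset set" where
  "bounded_msets A K = {M. set_mset M \<subseteq> A \<and> (\<forall>a. count M a \<le> K)}"

lemma bounded_msets_bij:
  assumes "finite A"
  shows "bij_betw (\<lambda>M. restrict (count M) A) (bounded_msets A K) (A \<rightarrow>\<^sub>E {..K})"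
  unfolding bij_betw_def
proof
  show "inj_on (\<lambda>M. restrict (count M) A) (bounded_msets A K)"
  proof (rule inj_onI)
    fix M N assume MN: "M \<in> bounded_msets A K" "N \<in> bounded_msets A K"
      "restrict (count M) A = restrict (count N) A"
    show "M = N"
    proof (rule multiset_eqI)
      fix a show "count M a = count N a"
      proof (cases "a \<in> A")
        case True
        thus ?thesis using fun_cong[OF MN(3), of a] by simp
      next
        case False
        hence "a \<notin># M" "a \<notin># N" using MN by (auto simp: bounded_msets_def)
        thus ?thesis by (simp add: not_in_iff)
      qed
    qed
  qed
  show "(\<lambda>M. restrict (count M) A) ` bounded_msets A K = A \<rightarrow>\<^sub>E {..K}"
  proof (intro equalityI subsetI)
    fix g assume g: "g \<in> A \<rightarrow>\<^sub>E {..K}"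
    define M where "M = (\<Sum>a\<in>A. replicate_mset (g a) a)"
    have c: "count M a = (if a \<in> A then g a else 0)" for a
      using assms by (simp add: M_def count_sum if_distrib cong: if_cong)
    have "restrict (count M) A = g" using g c by (auto simp: fun_eq_iff PiE_def extensional_def)
    moreover have "M \<in> bounded_msets A K"
      using g c by (auto simp: bounded_msets_def count_greater_zero_iff[symmetric] split: if_splits
        simp del: count_greater_zero_iff)
    ultimately show "g \<in> (\<lambda>M. restrict (count M) A) ` bounded_msets A K" by blast
  qed (auto simp: bounded_msets_def)
qed

lemma finite_bounded_msets: "finite A \<Longrightarrow> finite (bounded_msets A K)"
  using bij_betw_finite[OF bounded_msets_bij, of A K] by (simp add: finite_PiE)

lemma sum_bounded_msets:
  fixes w :: "'a \<Rightarrow> real"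
  assumes "finite A"
  shows "(\<Sum>M\<in>bounded_msets A K. \<Prod>\<^sub># (image_mset w M)) = (\<Prod>a\<in>A. \<Sum>k\<le>K. w a ^ k)"
proof -
  have "(\<Prod>a\<in>A. \<Sum>k\<le>K. w a ^ k) = (\<Sum>g\<in>A \<rightarrow>\<^sub>E {..K}. \<Prod>a\<in>A. w a ^ g a)"
    using assms by (simp add: prod_sum_PiE)
  also have "\<dots> = (\<Sum>M\<in>bounded_msets A K. \<Prod>a\<in>A. w a ^ restrict (count M) A a)"
    by (rule sum.reindex_bij_betw[OF bounded_msets_bij[OF assms], symmetric])
  also have "\<dots> = (\<Sum>M\<in>bounded_msets A K. \<Prod>\<^sub># (image_mset w M))"
  proof (rule sum.cong[OF refl])
    fix M assume "M \<in> bounded_msets A K"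
    hence "(\<Prod>a\<in>set_mset M. w a ^ count M a) = (\<Prod>a\<in>A. w a ^ count M a)"
      using assms by (intro prod.mono_neutral_left) (auto simp: bounded_msets_def not_in_iff)
    thus "(\<Prod>a\<in>A. w a ^ restrict (count M) A a) = \<Prod>\<^sub># (image_mset w M)"
      by (simp add: image_prod_mset_multiplicity)
  qed
  finally show ?thesis by simp
qed

definition trees_upto :: "nat \<Rightarrow> rtree set" where
  "trees_upto N = {t. nodes t \<le> N}"

lemma nodes_pos: "nodes t \<ge> 1" by (cases t) simp

lemma nodes_neq_0 [simp]: "nodes t \<noteq> 0"
  using nodes_pos[of t] by simp

lemma nodes_child_less: "s \<in># M \<Longrightarrow> nodes s < nodes (Nd M)"
  by (auto dest!: multi_member_split)

lemma size_le_sum_nodes: "size M \<le> \<Sum>\<^sub># (image_mset nodes M)"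
proof (induction M)
  case (add s M)
  show ?case using add nodes_pos[of s] by simp
qed simp

text \<open>The right-hand side also contains larger trees. As weights are positive, the inclusion
  is enough for upper bounds.\<close>

lemma trees_upto_Suc_subset: "trees_upto (Suc N) \<subseteq> Nd ` bounded_msets (trees_upto N) N"
proof
  fix t assume t: "t \<in> trees_upto (Suc N)"
  obtain M where M: "t = Nd M" by (cases t)
  have "count M a \<le> N" for a
    using count_le_size[of M a] size_le_sum_nodes[of M] t M by (simp add: trees_upto_def)
  moreover have "set_mset M \<subseteq> trees_upto N"
    using nodes_child_less[of _ M] t M by (fastforce simp: trees_upto_def)
  ultimately show "t \<in> Nd ` bounded_msets (trees_upto N) N" using M by (auto simp: bounded_msets_def)
qed

lemma trees_upto_0: "trees_upto 0 = {}"
  by (simp add: trees_upto_def)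

lemma finite_trees_upto: "finite (trees_upto N)"
proof (induction N)
  case (Suc N)
  show ?case by (rule finite_subset[OF trees_upto_Suc_subset]) (simp add: finite_bounded_msets Suc)
qed (simp add: trees_upto_0)

lemma nodes_eq_1: "nodes t = 1 \<longleftrightarrow> t = Nd {#}"
proof (cases t)
  case (Nd M)
  show ?thesis unfolding Nd by (cases M) simp_all
qed

lemma nodes_eq_2: "nodes t = 2 \<longleftrightarrow> t = Nd {#Nd {#}#}"
proof (cases t)
  case (Nd M)
  show ?thesis
  proof
    assume n: "nodes t = 2"
    have "M \<noteq> {#}" using n Nd by auto
    then obtain s M' where M: "M = add_mset s M'" by (metis multiset_cases)
    hence "nodes s + \<Sum>\<^sub># (image_mset nodes M') = 1" using n Nd by simp
    hence "\<Sum>\<^sub># (image_mset nodes M') = 0" "nodes s = 1" using nodes_pos[of s] by linarith+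
    hence "M' = {#}" "nodes s = 1" by (cases M'; simp)+
    thus "t = Nd {#Nd {#}#}" using M Nd nodes_eq_1 by simp
  qed simp
qed

definition weight :: "real \<Rightarrow> real \<Rightarrow> rtree \<Rightarrow> real" where
  "weight x u t = x ^ nodes t * u ^ lvs t"

lemma weight_Nd: "M \<noteq> {#} \<Longrightarrow> weight x u (Nd M) = x * \<Prod>\<^sub># (image_mset (weight x u) M)"
proof -
  have "x ^ \<Sum>\<^sub># (image_mset nodes M) * u ^ \<Sum>\<^sub># (image_mset lvs M) = \<Prod>\<^sub># (image_mset (weight x u) M)"
    by (induction M) (simp_all add: weight_def power_add mult_ac)
  thus "M \<noteq> {#} \<Longrightarrow> ?thesis" by (simp add: weight_def mult.assoc)
qed

lemma weight_pos: "0 < x \<Longrightarrow> 0 < u \<Longrightarrow> 0 < weight x u t" by (simp add: weight_def)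

definition weight_sum :: "real \<Rightarrow> real \<Rightarrow> nat \<Rightarrow> real" where
  "weight_sum x u N = (\<Sum>t\<in>trees_upto N. weight x u t)"

lemma weight_sum_mono:
  assumes "0 < x" "0 < u" "M \<le> N"
  shows "weight_sum x u M \<le> weight_sum x u N"
  unfolding weight_sum_def
  by (rule sum_mono2[OF finite_trees_upto])
    (use assms in \<open>auto simp: trees_upto_def less_imp_le weight_pos\<close>)

lemma sum_power_le:
  fixes w :: real
  assumes "0 \<le> w" "w < 1"
  shows "(\<Sum>k\<le>K. w ^ k) \<le> 1 / (1 - w)"
proof -
  have "(\<Sum>k\<le>K. w ^ k) \<le> (\<Sum>k. w ^ k)"
    using assms by (intro sum_le_suminf summable_geometric) auto
  thus ?thesis using assms by (simp add: suminf_geometric)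
qed

text \<open>Polya's equation in finite form, as an inequality. The empty multiset is treated apart,
  since a single node is a leaf and weighs \<open>x * u\<close> rather than
  \<open>x\<close>.\<close>

lemma weight_sum_Suc_le:
  assumes "0 < x" "0 < u" and w: "\<And>t. weight x u t < 1"
  shows "weight_sum x u (Suc N) \<le> x * u + x * ((\<Prod>t\<in>trees_upto N. 1 / (1 - weight x u t)) - 1)"
proof -
  let ?B = "bounded_msets (trees_upto N) N" and ?w = "weight x u"
  have fB: "finite ?B" by (simp add: finite_bounded_msets finite_trees_upto)
  have B0: "{#} \<in> ?B" by (simp add: bounded_msets_def)
  have "weight_sum x u (Suc N) \<le> (\<Sum>t\<in>Nd ` ?B. ?w t)"
    unfolding weight_sum_def using fB trees_upto_Suc_subset
    by (intro sum_mono2) (auto simp: less_imp_le weight_pos assms)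
  also have "\<dots> = (\<Sum>M\<in>?B. ?w (Nd M))" by (subst sum.reindex) (auto simp: inj_on_def)
  also have "\<dots> = x * u + (\<Sum>M\<in>?B - {{#}}. ?w (Nd M))"
    by (subst sum.remove[OF fB B0]) (simp add: weight_def)
  also have "(\<Sum>M\<in>?B - {{#}}. ?w (Nd M)) = (\<Sum>M\<in>?B - {{#}}. x * \<Prod>\<^sub># (image_mset ?w M))"
    by (intro sum.cong) (auto simp: weight_Nd)
  also have "\<dots> = x * ((\<Sum>M\<in>?B. \<Prod>\<^sub># (image_mset ?w M)) - 1)"
    by (subst sum.remove[OF fB B0]) (simp add: sum_distrib_left)
  also have "\<dots> \<le> x * ((\<Prod>t\<in>trees_upto N. 1 / (1 - ?w t)) - 1)"
    unfolding sum_bounded_msets[OF finite_trees_upto]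
    using assms(1) sum_power_le[OF less_imp_le[OF weight_pos[OF assms(1,2)]] w]
    by (intro mult_left_mono diff_right_mono prod_mono conjI)
      (auto intro!: sum_nonneg simp: less_imp_le weight_pos assms)
  finally show ?thesis by simp
qed

lemma trees_upto_2: "trees_upto 2 = {Nd {#}, Nd {#Nd {#}#}}"
proof -
  have "nodes t \<le> 2 \<longleftrightarrow> nodes t = 1 \<or> nodes t = 2" for t using nodes_pos[of t] by linarith
  thus ?thesis unfolding trees_upto_def nodes_eq_1 nodes_eq_2 by blast
qed

lemma trees_upto_split:
  assumes "N \<ge> 2"
  shows "trees_upto N = {Nd {#}, Nd {#Nd {#}#}} \<union> {t \<in> trees_upto N. nodes t \<ge> 3}"
    "{Nd {#}, Nd {#Nd {#}#}} \<inter> {t \<in> trees_upto N. nodes t \<ge> 3} = {}"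
proof -
  have "nodes t \<le> N \<longleftrightarrow> nodes t \<le> 2 \<or> (nodes t \<le> N \<and> 3 \<le> nodes t)" for t using assms by linarith
  thus "trees_upto N = {Nd {#}, Nd {#Nd {#}#}} \<union> {t \<in> trees_upto N. nodes t \<ge> 3}"
    unfolding trees_upto_2[symmetric] trees_upto_def by blast
qed simp

lemma weight_small: "weight x u (Nd {#}) = x * u" "weight x u (Nd {#Nd {#}#}) = x\<^sup>2 * u"
  by (simp_all add: weight_def power2_eq_square)

lemma weight_sum_split:
  assumes "N \<ge> 2"
  shows "weight_sum x u N = x * u + x\<^sup>2 * u + (\<Sum>t | t \<in> trees_upto N \<and> 3 \<le> nodes t. weight x u t)"
  unfolding weight_sum_def
  by (subst trees_upto_split(1)[OF assms], subst sum.union_disjoint[OF _ _ trees_upto_split(2)[OF assms]])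
    (simp_all add: weight_small finite_trees_upto)

lemma weight_prod_split:
  assumes "N \<ge> 2"
  shows "(\<Prod>t\<in>trees_upto N. f (weight x u t)) =
    f (x * u) * f (x\<^sup>2 * u) * (\<Prod>t | t \<in> trees_upto N \<and> 3 \<le> nodes t. f (weight x u t))"
  by (subst trees_upto_split(1)[OF assms], subst prod.union_disjoint[OF _ _ trees_upto_split(2)[OF assms]])
    (simp_all add: weight_small finite_trees_upto)

lemma inverse_1_minus_le_exp:
  fixes w :: real
  assumes "0 \<le> w" "w \<le> b" "b < 1"
  shows "1 / (1 - w) \<le> exp (w / (1 - b))"
proof -
  have "1 / (1 - w) = 1 + w / (1 - w)" using assms by (simp add: field_simps)
  also have "\<dots> \<le> 1 + w / (1 - b)" using assms by (intro add_left_mono divide_left_mono) auto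
  also have "\<dots> \<le> exp (w / (1 - b))" by (rule exp_ge_add_one_self)
  finally show ?thesis .
qed

text \<open>Trees with at most two vertices are treated exactly: estimating their factors
  \<open>1 / (1 - w)\<close> by exponentials as well would be too weak for the numerical bounds below.\<close>

lemma weight_sum_bound:
  assumes x: "0 < x" "x * u < 1" "x\<^sup>2 * u < 1" and u: "0 < u"
    and b: "b < 1" "\<And>t. 3 \<le> nodes t \<Longrightarrow> weight x u t \<le> b"
    and B: "x * u + x\<^sup>2 * u \<le> B"
      "x * u + x * (exp ((B - (x * u + x\<^sup>2 * u)) / (1 - b)) / ((1 - x * u) * (1 - x\<^sup>2 * u)) - 1) \<le> B"
  shows "weight_sum x u N \<le> B"
proof -
  let ?w = "weight x u"
  let ?T = "\<lambda>N. {t \<in> trees_upto N. 3 \<le> nodes t}"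
  have w1: "?w t < 1" for t
  proof -
    consider "nodes t = 1" | "nodes t = 2" | "3 \<le> nodes t" using nodes_pos[of t] by linarith
    thus ?thesis
    proof cases
      case 3
      show ?thesis using b(1) b(2)[OF 3] by simp
    qed (use x(2,3) in \<open>simp_all only: nodes_eq_1 nodes_eq_2 weight_small\<close>)
  qed
  have w0: "0 \<le> ?w t" for t using weight_pos[OF x(1) u] less_imp_le by blast
  \<comment> \<open>The hypotheses say that \<open>B\<close> is a supersolution of the recursion: a
    bound by \<open>B\<close> for one stage yields it for the next.\<close>
  have main: "weight_sum x u (N + 2) \<le> B" for N
  proof (induction N)
    case 0
    show ?case using B(1) trees_upto_2 by (simp add: weight_sum_def weight_small numeral_2_eq_2)
  next
    case (Suc N)
    let ?S = "\<Sum>t\<in>?T (N + 2). ?w t"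
    have S: "?S \<le> B - (x * u + x\<^sup>2 * u)" using Suc weight_sum_split[of "N + 2" x u] by simp
    have "(\<Prod>t\<in>?T (N + 2). 1 / (1 - ?w t)) \<le> (\<Prod>t\<in>?T (N + 2). exp (?w t / (1 - b)))"
      using w1 w0 b by (intro prod_mono conjI inverse_1_minus_le_exp) (auto simp: less_imp_le)
    also have "\<dots> = exp (?S / (1 - b))"
      by (simp add: exp_sum[symmetric] finite_trees_upto sum_divide_distrib)
    also have "\<dots> \<le> exp ((B - (x * u + x\<^sup>2 * u)) / (1 - b))"
      using S b(1) by (simp add: divide_right_mono)
    finally have P: "(\<Prod>t\<in>?T (N + 2). 1 / (1 - ?w t)) \<le> exp ((B - (x * u + x\<^sup>2 * u)) / (1 - b))" .
    have "(\<Prod>t\<in>trees_upto (N + 2). 1 / (1 - ?w t)) =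
        1 / (1 - x * u) * (1 / (1 - x\<^sup>2 * u)) * (\<Prod>t\<in>?T (N + 2). 1 / (1 - ?w t))"
      by (rule weight_prod_split) simp
    also have "\<dots> \<le> 1 / (1 - x * u) * (1 / (1 - x\<^sup>2 * u)) * exp ((B - (x * u + x\<^sup>2 * u)) / (1 - b))"
      using x P by (intro mult_left_mono) auto
    also have "\<dots> = exp ((B - (x * u + x\<^sup>2 * u)) / (1 - b)) / ((1 - x * u) * (1 - x\<^sup>2 * u))" by simp
    finally have "x * ((\<Prod>t\<in>trees_upto (N + 2). 1 / (1 - ?w t)) - 1) \<le>
        x * (exp ((B - (x * u + x\<^sup>2 * u)) / (1 - b)) / ((1 - x * u) * (1 - x\<^sup>2 * u)) - 1)"
      using x(1) by (intro mult_left_mono diff_right_mono) auto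
    thus ?case using weight_sum_Suc_le[OF x(1) u w1, of "N + 2"] B(2) by simp
  qed
  show ?thesis using weight_sum_mono[OF x(1) u, of N "N + 2"] main[of N] by simp
qed

lemma lvs_le_nodes: "1 \<le> lvs t" "nodes t \<ge> 2 \<Longrightarrow> lvs t < nodes t"
proof -
  have "1 \<le> lvs t \<and> lvs t \<le> nodes t \<and> (nodes t \<ge> 2 \<longrightarrow> lvs t < nodes t)"
  proof (induction t)
    case (Nd M)
    have "\<Sum>\<^sub># (image_mset lvs M) \<le> \<Sum>\<^sub># (image_mset nodes M) \<and> size M \<le> \<Sum>\<^sub># (image_mset lvs M)"
      using Nd by (induction M) fastforce+
    thus ?case by (cases "M = {#}") (auto simp: Suc_le_eq nonempty_has_size)
  qed
  thus "1 \<le> lvs t" "nodes t \<ge> 2 \<Longrightarrow> lvs t < nodes t" by blast+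
qed

text \<open>The quadratic bound is applied at \<open>y / 16\<close>, where it is accurate enough for
  the numerical estimates.\<close>

lemma exp_le_16:
  fixes y :: real
  assumes "0 \<le> y" "y \<le> 16"
  shows "exp y \<le> (1 + y / 16 + (y / 16)\<^sup>2) ^ 16"
proof -
  have "exp y = exp (y / 16) ^ 16" by (simp add: exp_of_nat_mult[symmetric])
  also have "\<dots> \<le> (1 + y / 16 + (y / 16)\<^sup>2) ^ 16"
    using assms by (intro power_mono exp_bound) auto
  finally show ?thesis .
qed

text \<open>\<open>0.43\<close> and \<open>0.233\<close> are close to the largest values of \<open>x\<close> for which \<open>weight_sum_bound\<close> applies with
  \<open>u = 1/2\<close> and \<open>u = 2\<close>.\<close>

lemma weight_sum_few: "weight_sum 0.43 0.5 N \<le> 0.742"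
proof (rule weight_sum_bound[where b = "0.04"])
  fix t assume t: "3 \<le> nodes t"
  have "weight 0.43 0.5 t \<le> 0.43 ^ 3 * 0.5 ^ 1"
    unfolding weight_def using t lvs_le_nodes(1)[of t] by (intro mult_mono power_decreasing) auto
  thus "weight 0.43 0.5 t \<le> 0.04" by (simp add: power3_eq_cube)
next
  have "exp ((0.742 - (0.43 * 0.5 + 0.43\<^sup>2 * 0.5)) / (1 - 0.04)) \<le> exp (0.4527 :: real)"
    by (simp add: power2_eq_square)
  also have "\<dots> \<le> (1 + 0.4527 / 16 + (0.4527 / 16)\<^sup>2) ^ 16" by (rule exp_le_16) simp_all
  also have "\<dots> \<le> 1.585" by (simp add: power2_eq_square eval_nat_numeral)
  finally show "0.43 * 0.5 + 0.43 * (exp ((0.742 - (0.43 * 0.5 + 0.43\<^sup>2 * 0.5)) / (1 - 0.04)) /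
      ((1 - 0.43 * 0.5) * (1 - 0.43\<^sup>2 * 0.5)) - 1) \<le> (0.742 :: real)"
    by (simp add: power2_eq_square field_simps)
qed (simp_all add: power2_eq_square)

lemma weight_sum_many: "weight_sum 0.233 2 N \<le> 1.18"
proof (rule weight_sum_bound[where b = "0.051"])
  fix t assume t: "3 \<le> nodes t"
  have "weight 0.233 2 t \<le> 0.233 ^ nodes t * 2 ^ (nodes t - 1)"
    unfolding weight_def using t lvs_le_nodes(2)[of t] by (intro mult_left_mono power_increasing) auto
  also have "\<dots> = 0.466 ^ nodes t / 2"
    using t by (subst power_diff) (auto simp: power_mult_distrib[symmetric])
  also have "\<dots> \<le> 0.466 ^ 3 / 2" using t by (intro divide_right_mono power_decreasing) auto
  finally show "weight 0.233 2 t \<le> 0.051" by (simp add: power3_eq_cube)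
next
  have "exp ((1.18 - (0.233 * 2 + 0.233\<^sup>2 * 2)) / (1 - 0.051)) \<le> exp (0.6381 :: real)"
    by (simp add: power2_eq_square)
  also have "\<dots> \<le> (1 + 0.6381 / 16 + (0.6381 / 16)\<^sup>2) ^ 16" by (rule exp_le_16) simp_all
  also have "\<dots> \<le> 1.93" by (simp add: power2_eq_square eval_nat_numeral)
  finally show "0.233 * 2 + 0.233 * (exp ((1.18 - (0.233 * 2 + 0.233\<^sup>2 * 2)) / (1 - 0.051)) /
      ((1 - 0.233 * 2) * (1 - 0.233\<^sup>2 * 2)) - 1) \<le> (1.18 :: real)"
    by (simp add: power2_eq_square field_simps)
qed (simp_all add: power2_eq_square)

section \<open>Lower bound for the number of trees\<close>

lemma exp_0_5444_ge: "(1.72 :: real) \<le> exp 0.5444"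
proof -
  have "(1.72 :: real) \<le> (1 + 0.1361 + 0.1361\<^sup>2 / 2) ^ 4" by (simp add: power2_eq_square eval_nat_numeral)
  also have "\<dots> \<le> exp 0.1361 ^ 4" by (intro power_mono exp_lower_Taylor_quadratic) auto
  also have "\<dots> = exp 0.5444" by (simp add: exp_of_nat_mult[symmetric])
  finally show ?thesis .
qed

text \<open>The opposite direction of \<open>weight_sum_Suc_le\<close> for \<open>u = 1\<close>:
  every multiset of small trees is the multiset of children of some tree. Multiplicities are cut off
  at \<open>K\<close> to stay within some \<open>trees_upto\<close>, and then \<open>K\<close> tends
  to infinity.\<close>

lemma prod_le_weight_sum:
  assumes x: "0 < x" "x < 1" and Z: "\<And>N. weight_sum x 1 N \<le> Z"
  shows "x * (\<Prod>t\<in>trees_upto N. 1 / (1 - weight x 1 t)) \<le> Z"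
proof (rule LIMSEQ_le_const2)
  let ?w = "weight x 1"
  have "norm (?w t) < 1" for t
    using x power_Suc_less_one[of x "nodes t - 1"] nodes_pos[of t] by (simp add: weight_def)
  hence "(\<lambda>K. \<Sum>k\<le>K. ?w t ^ k) \<longlonglongrightarrow> 1 / (1 - ?w t)" for t
    using geometric_sums[of "?w t"] by (simp add: sums_def_le)
  thus "(\<lambda>K. x * (\<Prod>t\<in>trees_upto N. \<Sum>k\<le>K. ?w t ^ k)) \<longlonglongrightarrow> x * (\<Prod>t\<in>trees_upto N. 1 / (1 - ?w t))"
    by (intro tendsto_intros tendsto_prod)
  have "x * (\<Prod>t\<in>trees_upto N. \<Sum>k\<le>K. ?w t ^ k) \<le> Z" for K
  proof -
    let ?B = "bounded_msets (trees_upto N) K"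
    have fB: "finite ?B" by (simp add: finite_bounded_msets finite_trees_upto)
    have "x * (\<Prod>t\<in>trees_upto N. \<Sum>k\<le>K. ?w t ^ k) = (\<Sum>M\<in>?B. x * \<Prod>\<^sub># (image_mset ?w M))"
      by (simp add: sum_bounded_msets[OF finite_trees_upto, symmetric] sum_distrib_left)
    also have "\<dots> = (\<Sum>M\<in>?B. ?w (Nd M))"
    proof (rule sum.cong[OF refl])
      fix M show "x * \<Prod>\<^sub># (image_mset ?w M) = ?w (Nd M)"
        by (cases "M = {#}") (simp_all add: weight_Nd, simp add: weight_def)
    qed
    also have "\<dots> = (\<Sum>t\<in>Nd ` ?B. ?w t)" by (subst sum.reindex) (auto simp: inj_on_def)
    also have "\<dots> \<le> weight_sum x 1 (Max (nodes ` Nd ` ?B))"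
      unfolding weight_sum_def
    proof (intro sum_mono2 finite_trees_upto subsetI)
      fix t assume "t \<in> Nd ` ?B"
      hence "nodes t \<le> Max (nodes ` Nd ` ?B)" using fB by (intro Max_ge) auto
      thus "t \<in> trees_upto (Max (nodes ` Nd ` ?B))" by (subst trees_upto_def) simp
    qed (simp add: x(1) less_imp_le weight_pos)
    finally show ?thesis using Z by (rule order_trans)
  qed
  thus "\<exists>K0. \<forall>K\<ge>K0. x * (\<Prod>t\<in>trees_upto N. \<Sum>k\<le>K. ?w t ^ k) \<le> Z" by blast
qed

text \<open>If all \<open>weight_sum x 1 N\<close> were bounded, their supremum \<open>Z\<close> would satisfy
  \<open>Z \<ge> c * exp Z\<close> with \<open>c * exp 1 > 1\<close>, although \<open>exp Z \<ge> exp 1 * Z\<close>.\<close>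

lemma weight_sum_ge_1: "\<exists>a. 1 \<le> weight_sum 0.34 1 a"
proof (rule ccontr)
  let ?ws = "weight_sum 0.34 1" and ?w = "weight 0.34 1"
  let ?T = "\<lambda>N. {t \<in> trees_upto N. 3 \<le> nodes t}"
  assume "\<not> ?thesis"
  hence le1: "?ws N \<le> 1" for N by (meson linear)
  define Z where "Z = (SUP N. ?ws N)"
  have bdd: "bdd_above (range ?ws)" using le1 by (auto intro!: bdd_aboveI)
  hence leZ: "?ws N \<le> Z" for N unfolding Z_def by (rule cSUP_upper[rotated]) simp
  have step2: "1.001 * ?ws N \<le> Z" if N: "2 \<le> N" for N
  proof -
    let ?S = "\<Sum>t\<in>?T N. ?w t"
    \<comment> \<open>0.4556 is \<open>0.34 + 0.34\<^sup>2\<close>, the weight of the two smallest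
      trees, and 0.5444 is its complement to 1.\<close>
    have S: "?S = ?ws N - 0.4556" using weight_sum_split[OF N, of "0.34" 1] by (simp add: power2_eq_square)
    have "1.72 * ?ws N \<le> exp 0.5444 * exp (?ws N - 1)"
      using exp_0_5444_ge exp_ge_add_one_self[of "?ws N - 1"] sum_nonneg[of "trees_upto N" ?w]
      by (intro mult_mono) (auto simp: weight_sum_def weight_def)
    also have "\<dots> = exp ?S" unfolding S by (simp add: exp_add[symmetric])
    also have "\<dots> = (\<Prod>t\<in>?T N. exp (?w t))" by (simp add: exp_sum finite_trees_upto)
    also have "\<dots> \<le> (\<Prod>t\<in>?T N. 1 / (1 - ?w t))"
    proof (intro prod_mono conjI)
      fix t
      have "1 - ?w t \<le> exp (- ?w t)" using exp_ge_add_one_self[of "- ?w t"] by simp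
      moreover have "?w t < 1"
        using power_Suc_less_one[of "0.34 :: real" "nodes t - 1"] nodes_pos[of t] by (simp add: weight_def)
      ultimately show "exp (?w t) \<le> 1 / (1 - ?w t)" by (simp add: exp_minus field_simps)
    qed simp
    finally have P: "1.72 * ?ws N \<le> (\<Prod>t\<in>?T N. 1 / (1 - ?w t))" .
    \<comment> \<open>\<open>0.34 * 1.72 / ((1 - 0.34) * (1 - 0.34\<^sup>2))\<close> is about
      1.0019. Any factor above 1 contradicts that \<open>Z\<close> is the supremum.\<close>
    have "1.001 * ?ws N \<le> 0.34 * (1 / (1 - 0.34 * 1) * (1 / (1 - 0.34\<^sup>2 * 1)) * (1.72 * ?ws N))"
      using sum_nonneg[of "trees_upto N" ?w] by (simp add: weight_sum_def weight_def power2_eq_square)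
    also have "\<dots> \<le> 0.34 * (1 / (1 - 0.34 * 1) * (1 / (1 - 0.34\<^sup>2 * 1)) * (\<Prod>t\<in>?T N. 1 / (1 - ?w t)))"
      using P by (intro mult_left_mono) (auto simp: power2_eq_square)
    also have "\<dots> = 0.34 * (\<Prod>t\<in>trees_upto N. 1 / (1 - ?w t))"
      by (subst weight_prod_split[OF N]) simp
    also have "\<dots> \<le> Z" using leZ by (intro prod_le_weight_sum) auto
    finally show ?thesis .
  qed
  have "1.001 * ?ws N \<le> Z" for N
    using step2[of "N + 2"] weight_sum_mono[of "0.34" 1 N "N + 2"] by simp
  hence "?ws N \<le> Z / 1.001" for N by (simp add: field_simps)
  hence "Z \<le> Z / 1.001" unfolding Z_def by (intro cSUP_least) auto
  moreover have "0.34 + 0.34\<^sup>2 = ?ws 2"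
    unfolding weight_sum_def trees_upto_2 by (simp add: weight_small)
  hence "0 < Z" using leZ[of 2] by (simp add: power2_eq_square)
  ultimately show False by simp
qed

text \<open>A path through the roots of the listed trees, closed by one extra vertex. Lists are easy
  to count from below, as their generating function is \<open>1 / (1 - T)\<close> with
  \<open>T\<close> that of rooted trees; spines transfer the bound to single trees.\<close>

primrec spine :: "rtree list \<Rightarrow> rtree" where
  "spine [] = Nd {#}"
| "spine (s # l) = (case s of Nd M \<Rightarrow> Nd (add_mset (spine l) M))"

lemma nodes_spine: "nodes (spine l) = Suc (sum_list (map nodes l))"
  by (induction l) (auto split: rtree.split)

lemma sum_set_mset_le: "sum f (set_mset M) \<le> \<Sum>\<^sub># (image_mset f M)" for f :: "'a \<Rightarrow> nat"
  by (induction M) (auto simp: sum.insert_if)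

text \<open>A list is recovered from its spine and the end vertex of the spine.\<close>

lemma card_spine_le: "finite {l. spine l = t} \<and> card {l. spine l = t} \<le> nodes t"
proof (induction t)
  case (Nd M)
  let ?P = "\<lambda>t. {l. spine l = t}"
  \<comment> \<open>A nonempty list is determined by the child \<open>c\<close> in which the spine
    continues and by a list for \<open>c\<close>.\<close>
  let ?A = "\<Union>c\<in>set_mset M. (\<lambda>l. Nd (M - {#c#}) # l) ` ?P c"
  have sub: "?P (Nd M) \<subseteq> insert [] ?A"
  proof
    fix l assume l: "l \<in> ?P (Nd M)"
    show "l \<in> insert [] ?A"
    proof (cases l)
      case (Cons s l')
      obtain N where s: "s = Nd N" by (cases s)
      hence "M = add_mset (spine l') N" using l Cons by simp
      thus ?thesis using Cons s by force
    qed simp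
  qed
  have fin: "finite ?A" using Nd by blast
  have "card (?P (Nd M)) \<le> card (insert [] ?A)" using sub fin by (intro card_mono) auto
  also have "\<dots> \<le> Suc (card ?A)" by (rule card_insert_le_m1) auto
  also have "card ?A \<le> (\<Sum>c\<in>set_mset M. card ((\<lambda>l. Nd (M - {#c#}) # l) ` ?P c))"
    by (rule card_UN_le) simp
  also have "\<dots> \<le> (\<Sum>c\<in>set_mset M. nodes c)"
    using Nd by (intro sum_mono) (meson card_image_le order_trans)
  also have "\<dots> \<le> \<Sum>\<^sub># (image_mset nodes M)" by (rule sum_set_mset_le)
  finally show ?case using finite_subset[OF sub] fin by simp
qed

definition forests :: "nat \<Rightarrow> rtree list set" where
  "forests n = {l. sum_list (map nodes l) = n}"

lemma finite_nodes_eq: "finite {t. nodes t = n}"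
  by (rule finite_subset[OF _ finite_trees_upto[of n]]) (auto simp: trees_upto_def)

lemma card_forests_le: "finite (forests n) \<and> card (forests n) \<le> card {t. nodes t = Suc n} * Suc n"
proof -
  have U: "forests n = (\<Union>t\<in>{t. nodes t = Suc n}. {l. spine l = t})"
    by (auto simp: forests_def nodes_spine)
  have "card (forests n) \<le> (\<Sum>t\<in>{t. nodes t = Suc n}. card {l. spine l = t})"
    unfolding U by (rule card_UN_le[OF finite_nodes_eq])
  also have "\<dots> \<le> (\<Sum>t\<in>{t. nodes t = Suc n}. Suc n)"
    using card_spine_le by (intro sum_mono) (metis mem_Collect_eq)
  finally show ?thesis using card_spine_le unfolding U by (simp add: finite_nodes_eq)
qed

text \<open>Prepending a tree with at most \<open>a\<close> nodes gives a renewal inequality, and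
  \<open>x ^ a / x ^ n\<close> is a subsolution of it since the weights of these trees add up to at
  least 1. The factor \<open>x ^ a\<close> makes the start \<open>n < a\<close> trivial.\<close>

lemma card_forests_ge:
  assumes x: "0 < x" "x \<le> 1" and a: "1 \<le> weight_sum x 1 a"
  shows "x ^ a / x ^ n \<le> real (card (forests n))"
proof (induction n rule: less_induct)
  case (less n)
  show ?case
  proof (cases "n < a")
    case True
    have "replicate n (Nd {#}) \<in> forests n" by (simp add: forests_def sum_list_replicate)
    hence "card (forests n) \<noteq> 0" using card_forests_le[of n] by auto
    hence "1 \<le> real (card (forests n))" by simp
    moreover have "x ^ a / x ^ n \<le> 1" using x True by (simp add: power_decreasing)
    ultimately show ?thesis by linarith
  next
    case False
    let ?S = "SIGMA s:trees_upto a. forests (n - nodes s)"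
    have "x ^ a / x ^ n * 1 \<le> x ^ a / x ^ n * weight_sum x 1 a"
      using a x by (intro mult_left_mono) auto
    also have "\<dots> = (\<Sum>s\<in>trees_upto a. x ^ a / x ^ (n - nodes s))"
      unfolding weight_sum_def sum_distrib_left
    proof (rule sum.cong[OF refl])
      fix s assume "s \<in> trees_upto a"
      hence "nodes s \<le> n" using False by (simp add: trees_upto_def)
      thus "x ^ a / x ^ n * weight x 1 s = x ^ a / x ^ (n - nodes s)"
        using x by (simp add: weight_def power_diff)
    qed
    also have "\<dots> \<le> (\<Sum>s\<in>trees_upto a. real (card (forests (n - nodes s))))"
    proof (intro sum_mono less.IH)
      fix s assume "s \<in> trees_upto a"
      thus "n - nodes s < n" using False nodes_pos[of s] by (simp add: trees_upto_def)
    qed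
    also have "\<dots> = real (card ?S)" by (simp add: card_SigmaI finite_trees_upto card_forests_le)
    also have "card ?S = card ((\<lambda>(s, l). s # l) ` ?S)" by (subst card_image) (auto simp: inj_on_def)
    also have "\<dots> \<le> card (forests n)"
    proof (rule card_mono)
      show "(\<lambda>(s, l). s # l) ` ?S \<subseteq> forests n"
        using False by (auto simp: forests_def trees_upto_def)
    qed (simp add: card_forests_le)
    finally show ?thesis by simp
  qed
qed

text \<open>Markov's inequality for the weights, in the form of an exponential tilting by
  leaves.\<close>

lemma card_weight_le:
  assumes "0 < x" "0 < u" and B: "\<And>N. weight_sum x u N \<le> B" and c: "0 < c"
    and A: "\<And>t. t \<in> A \<Longrightarrow> nodes t = n \<and> c \<le> weight x u t"
  shows "real (card A) \<le> B / c"
proof -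
  have "A \<subseteq> trees_upto n" using A by (auto simp: trees_upto_def)
  hence "(\<Sum>t\<in>A. weight x u t) \<le> weight_sum x u n"
    unfolding weight_sum_def by (intro sum_mono2 finite_trees_upto) (auto simp: assms less_imp_le weight_pos)
  moreover have "(\<Sum>t\<in>A. c) \<le> (\<Sum>t\<in>A. weight x u t)" using A by (intro sum_mono) blast
  ultimately have "real (card A) * c \<le> B" using B[of n] by simp
  thus ?thesis using c by (simp add: field_simps)
qed

text \<open>With at most about \<open>n / 3\<close> leaves the weight is at least about
  \<open>(0.43 * 0.5 ^ (1/3)) ^ n\<close>, and the base exceeds 0.341. Cubes are compared to keep
  exponents integral.\<close>

lemma card_few_leaves: "real (card {t. nodes t = n \<and> 3 * lvs t \<le> n + 3}) \<le> 1.484 / 0.341 ^ n"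
proof -
  have "real (card {t. nodes t = n \<and> 3 * lvs t \<le> n + 3}) \<le> 0.742 / (0.341 ^ n / 2)"
  proof (rule card_weight_le[where x = "0.43" and u = "0.5" and n = n])
    fix t assume t: "t \<in> {t. nodes t = n \<and> 3 * lvs t \<le> n + 3}"
    have "(y ^ n / 2) ^ 3 = (y ^ 3) ^ n * 0.5 ^ 3" for y :: real
      by (simp add: power_divide power_mult[symmetric] mult.commute)
    hence "(0.341 ^ n / 2 :: real) ^ 3 = (0.341 ^ 3) ^ n * 0.5 ^ 3" .
    also have "\<dots> \<le> (0.43 ^ 3 * 0.5) ^ n * 0.5 ^ 3"
      by (intro mult_right_mono power_mono) (simp_all add: power3_eq_cube)
    also have "\<dots> = 0.43 ^ (3 * n) * 0.5 ^ (n + 3)"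
      by (simp only: power_mult power_mult_distrib power_add mult.assoc)
    also have "\<dots> \<le> 0.43 ^ (3 * n) * 0.5 ^ (3 * lvs t)"
      using t by (intro mult_left_mono power_decreasing) auto
    also have "\<dots> = weight 0.43 0.5 t ^ 3"
      using t by (simp add: weight_def power_mult_distrib power_mult[symmetric] mult.commute)
    finally have "0.341 ^ n / 2 \<le> weight 0.43 0.5 t"
      by (rule power_le_imp_le_base[of _ 2, simplified]) (simp add: weight_def)
    thus "nodes t = n \<and> 0.341 ^ n / 2 \<le> weight 0.43 0.5 t" using t by simp
  qed (use weight_sum_few in auto)
  thus ?thesis by simp
qed

text \<open>The same with \<open>0.233 * 2 ^ (5/9)\<close>, which also exceeds 0.341. Ninth powers
  are compared, and the summand 27 becomes the factor \<open>8 = 2 ^ (27/9)\<close>.\<close>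

lemma card_many_leaves: "real (card {t. nodes t = n \<and> 5 * n \<le> 9 * lvs t + 27}) \<le> 9.44 / 0.341 ^ n"
proof -
  have "real (card {t. nodes t = n \<and> 5 * n \<le> 9 * lvs t + 27}) \<le> 1.18 / (0.341 ^ n / 8)"
  proof (rule card_weight_le[where x = "0.233" and u = 2 and n = n])
    fix t assume t: "t \<in> {t. nodes t = n \<and> 5 * n \<le> 9 * lvs t + 27}"
    have "(y ^ n) ^ 9 = (y ^ 9) ^ n" for y :: real by (simp add: power_mult[symmetric] mult.commute)
    hence "(0.341 ^ n :: real) ^ 9 = (0.341 ^ 9) ^ n" .
    also have "\<dots> \<le> (0.233 ^ 9 * 2 ^ 5) ^ n"
      by (intro power_mono) (simp_all add: eval_nat_numeral)
    also have "\<dots> = 0.233 ^ (9 * n) * 2 ^ (5 * n)" by (simp add: power_mult power_mult_distrib)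
    also have "\<dots> \<le> 0.233 ^ (9 * n) * 2 ^ (9 * lvs t + 27)"
      using t by (intro mult_left_mono power_increasing) auto
    also have "\<dots> = (8 * weight 0.233 2 t) ^ 9"
      using t by (simp add: weight_def power_mult_distrib power_mult[symmetric] mult.commute power_add)
    finally have "0.341 ^ n \<le> 8 * weight 0.233 2 t"
      by (rule power_le_imp_le_base[of _ 8, simplified]) (simp add: weight_def)
    thus "nodes t = n \<and> 0.341 ^ n / 8 \<le> weight 0.233 2 t" using t by simp
  qed (use weight_sum_many in auto)
  thus ?thesis by simp
qed

section \<open>Counting unlabelled trees\<close>

definition class_shape :: "nat ugraph set \<Rightarrow> rtree \<Rightarrow> bool" where
  "class_shape C t \<longleftrightarrow> (\<exists>V E r. (V, E) \<in> C \<and> has_shape V E r t)"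

lemma mem_unlabelled_trees:
  assumes "C \<in> unlabelled_trees k" "T \<in> C"
  shows "tree T" "card (edges T) = k" "S \<in> C \<longleftrightarrow> graph_iso T S"
proof -
  have T: "T \<in> trees_with_edges k" and C: "C = tree_iso_rel k `` {T}"
    using assms in_quotient_imp_subset[OF equiv_tree_iso_rel]
      Image_singleton_iff quotient_eq_iff[OF equiv_tree_iso_rel]
    unfolding unlabelled_trees_def by (blast, metis quotientE equiv_class_eq[OF equiv_tree_iso_rel] Image_singleton_iff)
  thus "tree T" "card (edges T) = k" by (simp_all add: trees_with_edges_def)
  show "S \<in> C \<longleftrightarrow> graph_iso T S"
    using T trees_with_edges_iso[OF T, of S] unfolding C tree_iso_rel_def by blast
qed

lemma class_shape_exists:
  assumes "C \<in> unlabelled_trees k"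
  obtains t where "class_shape C t"
proof -
  obtain V E where T: "(V, E) \<in> C"
    using in_quotient_imp_non_empty[OF equiv_tree_iso_rel assms[unfolded unlabelled_trees_def]] by auto
  have "tree (V, E)" by (rule mem_unlabelled_trees[OF assms T])
  moreover from this obtain r where "r \<in> V" by (auto simp: tree_def connected_graph_def)
  ultimately obtain t where "has_shape V E r t" using tree_has_shape[of V E r] by blast
  hence "class_shape C t" unfolding class_shape_def using T by blast
  thus ?thesis by (rule that)
qed

lemma class_shape_nodes:
  assumes "C \<in> unlabelled_trees k" "class_shape C t"
  shows "nodes t = Suc k"
proof -
  obtain V E r where "(V, E) \<in> C" "has_shape V E r t" using assms(2) by (auto simp: class_shape_def)
  thus ?thesis using mem_unlabelled_trees(2)[OF assms(1)] has_shape_card_edges by fastforce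
qed

lemma class_shape_inj:
  assumes "C \<in> unlabelled_trees k" "D \<in> unlabelled_trees k" "class_shape C t" "class_shape D t"
  shows "C = D"
proof -
  obtain V E r where C: "(V, E) \<in> C" "has_shape V E r t" using assms(3) by (auto simp: class_shape_def)
  obtain V' E' r' where D: "(V', E') \<in> D" "has_shape V' E' r' t" using assms(4) by (auto simp: class_shape_def)
  have "graph_iso (V, E) (V', E')" using has_shape_iso[OF C(2) D(2)] by (auto simp: graph_iso_def)
  hence "(V', E') \<in> C" using mem_unlabelled_trees(3)[OF assms(1) C(1)] by simp
  thus ?thesis using mem_unlabelled_trees(3)[OF assms(1)] mem_unlabelled_trees(3)[OF assms(2) D(1)] by blast
qed

text \<open>In a fixed representative each choice of root gives one shape. So passing from rooted to
  unrooted trees loses at most a factor \<open>k + 1\<close>.\<close>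

lemma card_class_shapes:
  assumes "C \<in> unlabelled_trees k"
  shows "finite {t. class_shape C t} \<and> card {t. class_shape C t} \<le> Suc k"
proof -
  obtain t0 where "class_shape C t0" by (rule class_shape_exists[OF assms])
  then obtain V E r0 where T: "(V, E) \<in> C" "has_shape V E r0 t0" by (auto simp: class_shape_def)
  note b = has_shape_basic[OF T(2)]
  have cV: "card V = Suc k" using b(5) class_shape_nodes[OF assms \<open>class_shape C t0\<close>] by simp
  have "{t. class_shape C t} \<subseteq> (\<lambda>r. THE t. has_shape V E r t) ` V"
  proof
    fix t assume "t \<in> {t. class_shape C t}"
    then obtain V' E' r' where D: "(V', E') \<in> C" "has_shape V' E' r' t" by (auto simp: class_shape_def)
    have "graph_iso (V', E') (V, E)" using mem_unlabelled_trees(3)[OF assms D(1)] T(1) by blast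
    then obtain f where f: "bij_betw f V' V" "E = (`) f ` E'" by (auto simp: graph_iso_def)
    have h: "has_shape V E (f r') t"
      using has_shape_image[OF D(2) bij_betw_imp_inj_on[OF f(1)]]
      unfolding bij_betw_imp_surj_on[OF f(1)] f(2) .
    hence "(THE t. has_shape V E (f r') t) = t" by (rule the_equality) (rule has_shape_unique[OF _ h])
    thus "t \<in> (\<lambda>r. THE t. has_shape V E r t) ` V"
      using imageI[OF has_shape_basic(2)[OF h], of "\<lambda>r. THE t. has_shape V E r t"] by simp
  qed
  from surj_card_le[OF b(1) this] finite_surj[OF b(1) this] show ?thesis unfolding cV by blast
qed

lemma card_nodes_le: "card {t. nodes t = Suc k} \<le> card (unlabelled_trees k) * Suc k"
proof -
  have U: "{t. nodes t = Suc k} \<subseteq> (\<Union>C\<in>unlabelled_trees k. {t. class_shape C t})"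
  proof
    fix t assume t: "t \<in> {t. nodes t = Suc k}"
    obtain V E where V: "has_shape (V :: nat set) E 0 t" using ex_has_shape by blast
    hence T: "(V, E) \<in> trees_with_edges k"
      using t has_shape_tree[OF V] has_shape_card_edges[OF V] by (simp add: trees_with_edges_def)
    let ?C = "tree_iso_rel k `` {(V, E)}"
    have "(V, E) \<in> ?C" using equiv_class_self[OF equiv_tree_iso_rel T] .
    moreover have "?C \<in> unlabelled_trees k" unfolding unlabelled_trees_def using T by (rule quotientI)
    moreover have "class_shape ?C t" unfolding class_shape_def using V \<open>(V, E) \<in> ?C\<close> by blast
    ultimately show "t \<in> (\<Union>C\<in>unlabelled_trees k. {t. class_shape C t})" by blast
  qed
  have "card {t. nodes t = Suc k} \<le> card (\<Union>C\<in>unlabelled_trees k. {t. class_shape C t})"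
    using U card_class_shapes finite_unlabelled_trees by (intro card_mono) auto
  also have "\<dots> \<le> (\<Sum>C\<in>unlabelled_trees k. card {t. class_shape C t})"
    by (rule card_UN_le[OF finite_unlabelled_trees])
  also have "\<dots> \<le> (\<Sum>C\<in>unlabelled_trees k. Suc k)" using card_class_shapes by (intro sum_mono) blast
  finally show ?thesis by simp
qed

text \<open>For \<open>n = m + 2\<close> the thresholds are the two bounds on the non-leaves of the
  decomposition theorem, rewritten for leaves by \<open>has_shape_inner_verts\<close>, including its
  deviation by one.\<close>

definition unbalanced :: "nat \<Rightarrow> rtree set" where
  "unbalanced n = {t. nodes t = n \<and> (3 * lvs t \<le> n + 3 \<or> 5 * n \<le> 9 * lvs t + 27)}"

lemma card_unbalanced: "finite (unbalanced n)" "real (card (unbalanced n)) \<le> 11 / 0.341 ^ n"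
proof -
  let ?F = "{t. nodes t = n \<and> 3 * lvs t \<le> n + 3}" and ?M = "{t. nodes t = n \<and> 5 * n \<le> 9 * lvs t + 27}"
  have U: "unbalanced n = ?F \<union> ?M" by (auto simp: unbalanced_def)
  show "finite (unbalanced n)" by (rule finite_subset[OF _ finite_nodes_eq[of n]]) (auto simp: unbalanced_def)
  have "real (card (unbalanced n)) \<le> real (card ?F) + real (card ?M)"
    unfolding U using card_Un_le[of ?F ?M] by linarith
  also have "\<dots> \<le> 1.484 / 0.341 ^ n + 9.44 / 0.341 ^ n"
    by (intro add_mono card_few_leaves card_many_leaves)
  also have "\<dots> = 10.924 / 0.341 ^ n" by (simp add: add_divide_distrib[symmetric])
  also have "\<dots> \<le> 11 / 0.341 ^ n" by (intro divide_right_mono) simp_all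
  finally show "real (card (unbalanced n)) \<le> 11 / 0.341 ^ n" .
qed

lemma balanced_class_decomposes:
  assumes C: "C \<in> unlabelled_trees (m + 1)" "class_shape C t" "t \<notin> unbalanced (m + 2)"
    and r: "odd r" "3 \<le> r" and m: "12 \<le> m"
  shows "class_decomposes C (complete_minus_clique (r * (2 * m + 1) + (r + 1) div 2) ((r + 1) div 2))"
proof -
  obtain V E q where T: "(V, E) \<in> C" "has_shape V E q t" using C(2) by (auto simp: class_shape_def)
  have n: "nodes t = m + 2" using class_shape_nodes[OF C(1,2)] by simp
  have l: "m + 5 < 3 * lvs t" "9 * lvs t + 27 < 5 * (m + 2)" using C(3) n by (auto simp: unbalanced_def)
  have "3 * card (inner_verts (V, E)) \<le> 2 * m" "4 * m + 27 \<le> 9 * card (inner_verts (V, E))"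
    using l has_shape_inner_verts[OF T(2)] unfolding n by simp_all
  hence "decomposes (V, E) (complete_minus_clique (r * (2 * m + 1) + (r + 1) div 2) ((r + 1) div 2))"
    using has_shape_tree[OF T(2)] has_shape_basic(5)[OF T(2)] n r m
    by (intro tree_decomposes_complete_minus_clique) auto
  thus ?thesis using T(1) by (auto simp: class_decomposes_def)
qed

text \<open>Choosing one rooted shape per class is injective, and a class that fails to decompose
  has only unbalanced shapes.\<close>

lemma card_not_decomposing:
  assumes "odd r" "3 \<le> r" "12 \<le> m"
  shows "card {C \<in> unlabelled_trees (m + 1). \<not> class_decomposes C
    (complete_minus_clique (r * (2 * m + 1) + (r + 1) div 2) ((r + 1) div 2))} \<le> card (unbalanced (m + 2))"
    (is "card ?B \<le> _")
proof (rule card_inj_on_le)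
  define g where "g C = (SOME t. class_shape C t)" for C
  have g: "class_shape C (g C)" if "C \<in> unlabelled_trees (m + 1)" for C
    unfolding g_def using class_shape_exists[OF that] by (metis someI)
  show "inj_on g ?B"
  proof (rule inj_onI)
    fix C D assume "C \<in> ?B" "D \<in> ?B" "g C = g D"
    thus "C = D" using class_shape_inj[of C "m + 1" D "g C"] g[of C] g[of D] by simp
  qed
  show "g ` ?B \<subseteq> unbalanced (m + 2)"
  proof (rule image_subsetI)
    fix C assume "C \<in> ?B"
    thus "g C \<in> unbalanced (m + 2)" using g[of C] balanced_class_decomposes[OF _ _ _ assms, of C "g C"] by blast
  qed
qed (rule card_unbalanced)

text \<open>One factor \<open>k + 1\<close> pays for the end of the spine, the other for the choice
  of a root.\<close>

lemma card_unlabelled_trees_ge: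
  "\<exists>a. \<forall>k. 0.34 ^ a / (0.34 ^ k * (real k + 1) ^ 2) \<le> real (card (unlabelled_trees k))"
proof -
  obtain a where a: "1 \<le> weight_sum 0.34 1 a" using weight_sum_ge_1 by blast
  have "0.34 ^ a / (0.34 ^ k * (real k + 1) ^ 2) \<le> real (card (unlabelled_trees k))" for k
  proof -
    have "0.34 ^ a / 0.34 ^ k \<le> real (card (forests k))" using a by (intro card_forests_ge) auto
    also have "card (forests k) \<le> card (unlabelled_trees k) * Suc k * Suc k"
      using card_forests_le[of k] mult_le_mono1[OF card_nodes_le[of k], of "Suc k"] by linarith
    finally have "0.34 ^ a / 0.34 ^ k \<le> real (card (unlabelled_trees k)) * (real k + 1) ^ 2"
      by (simp add: power2_eq_square algebra_simps)
    thus ?thesis by (simp add: field_simps)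
  qed
  thus ?thesis by blast
qed

theorem corollary3:
  fixes r :: nat
  assumes "r \<ge> 3" and "odd r"
  shows "((\<lambda>m::nat. measure_pmf.prob (random_tree (m + 1))
            {C. let t = (r + 1) div 2; n = r * (2 * m + 1) + t
                in class_decomposes C (complete_minus_clique n t)})
          \<longlongrightarrow> 1) (inf sequentially (principal {m. m > 0 \<and> prime (2 * m + 1)}))"
proof (rule tendsto_mono[OF inf_le1])
  let ?K = "\<lambda>m. complete_minus_clique (r * (2 * m + 1) + (r + 1) div 2) ((r + 1) div 2)"
  let ?U = "\<lambda>m. unlabelled_trees (m + 1)"
  let ?p = "\<lambda>m. measure_pmf.prob (random_tree (m + 1)) {C. class_decomposes C (?K m)}"
  obtain a where a: "\<And>k. 0.34 ^ a / (0.34 ^ k * (real k + 1) ^ 2) \<le> real (card (unlabelled_trees k))"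
    using card_unlabelled_trees_ge by blast
  define c :: real where "c = 11 / (0.341 * 0.34 ^ a)"
  \<comment> \<open>\<open>0.34 / 0.341 \<le> z\<^sup>2\<close>, so the error is at most
    \<open>c\<close> times the square of the null sequence \<open>(k + 1) * z ^ k\<close>.\<close>
  define z :: real where "z = 0.999"
  have lower: "1 - c * ((real (m + 1) + 1) * z ^ (m + 1))\<^sup>2 \<le> ?p m" if m: "12 \<le> m" for m
  proof -
    let ?B = "{C \<in> ?U m. \<not> class_decomposes C (?K m)}"
    define k where "k = m + 1"
    have fin: "finite (?U m)" and ne: "?U m \<noteq> {}"
      by (rule finite_unlabelled_trees, rule unlabelled_trees_nonempty)
    have pos: "0 < real (card (?U m))" using fin ne by (simp add: card_gt_0_iff)
    have "card (?U m \<inter> {C. class_decomposes C (?K m)}) + card ?B = card (?U m)"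
      using fin by (subst card_Un_disjoint[symmetric]) (auto intro: arg_cong[of _ _ card])
    hence "real (card (?U m \<inter> {C. class_decomposes C (?K m)})) = real (card (?U m)) - real (card ?B)"
      by linarith
    hence p: "?p m = 1 - real (card ?B) / real (card (?U m))"
      unfolding random_tree_def measure_pmf_of_set[OF ne fin] using pos by (simp add: diff_divide_distrib)
    have "real (card ?B) \<le> real (card (unbalanced (m + 2)))"
      using card_not_decomposing[OF assms(2,1) m] by simp
    also have "\<dots> \<le> 11 / 0.341 ^ (m + 2)" by (rule card_unbalanced)
    finally have B: "real (card ?B) \<le> 11 / 0.341 ^ (m + 2)" .
    have "real (card ?B) / real (card (?U m)) \<le>
        (11 / 0.341 ^ (m + 2)) / (0.34 ^ a / (0.34 ^ k * (real k + 1) ^ 2))"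
      using B a[of k] unfolding k_def by (intro frac_le) auto
    also have "\<dots> = c * (real k + 1)\<^sup>2 * (0.34 / 0.341) ^ k"
      by (simp only: c_def k_def power_divide) (simp add: field_simps)
    also have "\<dots> \<le> c * (real k + 1)\<^sup>2 * (z ^ 2) ^ k"
      by (intro mult_left_mono power_mono) (simp_all add: c_def z_def power2_eq_square)
    also have "\<dots> = c * ((real k + 1) * z ^ k)\<^sup>2"
      by (simp add: power_mult_distrib power_mult[symmetric] mult.commute)
    finally show ?thesis unfolding p k_def by simp
  qed
  have "(\<lambda>n. real n * z ^ n + z ^ n) \<longlonglongrightarrow> 0 + 0"
    by (intro tendsto_add powser_times_n_limit_0 LIMSEQ_power_zero) (simp_all add: z_def)
  hence "(\<lambda>n. (real n + 1) * z ^ n) \<longlonglongrightarrow> 0" by (simp add: algebra_simps)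
  hence "(\<lambda>m. (real (m + 1) + 1) * z ^ (m + 1)) \<longlonglongrightarrow> 0" by (rule LIMSEQ_ignore_initial_segment)
  hence "(\<lambda>m. 1 - c * ((real (m + 1) + 1) * z ^ (m + 1))\<^sup>2) \<longlonglongrightarrow> 1 - c * 0\<^sup>2"
    by (intro tendsto_intros)
  hence low: "(\<lambda>m. 1 - c * ((real (m + 1) + 1) * z ^ (m + 1))\<^sup>2) \<longlonglongrightarrow> 1" by simp
  have "?p \<longlonglongrightarrow> 1"
  proof (rule tendsto_sandwich[OF _ _ low tendsto_const])
    show "\<forall>\<^sub>F m in sequentially. 1 - c * ((real (m + 1) + 1) * z ^ (m + 1))\<^sup>2 \<le> ?p m"
      using lower by (rule eventually_sequentiallyI)
  qed simp
  thus "(\<lambda>m. measure_pmf.prob (random_tree (m + 1))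
            {C. let t = (r + 1) div 2; n = r * (2 * m + 1) + t
                in class_decomposes C (complete_minus_clique n t)}) \<longlonglongrightarrow> 1"
    by (simp only: Let_def)
qed

end
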